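(* Let $\mathbb{F}$ be a field, $1\le h\le n$, and let $\mu=(0^{n-h},1^{h-1},n-h+1)$ be a hook, viewed as the composition $(1^{h-1},n-h+1)$ of $n$ (so $D(\mu)=\{1,\dots,h-1\}$). Then the $H_n(0)$-module $R_\mu=\mathbb{F}[\mathbf{x}]/I_\mu$ satisfies \[ R_\mu\cong\bigoplus_{\alpha\preccurlyeq\mu}\mathbf P_\alpha . \]
   Context: $\mathbb{F}[\mathbf{x}]=\mathbb{F}[x_1,\dots,x_n]$. $H_n(0)$ is generated by $T_1,\dots,T_{n-1}$ with $T_i^2=-T_i$, $T_iT_{i+1}T_i=T_{i+1}T_iT_{i+1}$, $T_iT_j=T_jT_i$ ($|i-j|>1$); $T'_i=T_i+1$; $T_w,T'_w$ via reduced words. It acts on $\mathbb{F}[\mathbf{x}]$ by $T_i\mapsto\pi_i-1$ where $\pi_if=\frac{x_if-x_{i+1}s_i(f)}{x_i-x_{i+1}}$; this action preserves $I_\mu$ when $\mu$ is a hook, hence acts on $R_\mu$. Tanisaki ideal: writing $\mu$ and its conjugate increasingly with $n$ parts, $\mu'=(0\le\mu'_1\le\dots\le\mu'_n)$, $d_k(\mu)=\mu'_1+\dots+\mu'_k$, $I_\mu$ is generated by all $e_r(S)$ with $S\subseteq\{x_1,\dots,x_n\}$, $|S|=k$, $k\ge r>k-d_k(\mu)$ ($e_r(S)$ the elementary symmetric polynomial). For compositions $\alpha,\beta$ of $n$, $D(\alpha)$ is the set of partial sums $\alpha_1,\alpha_1+\alpha_2,\dots$ below $n$, and $\alpha\preccurlyeq\beta$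 iff $D(\alpha)\subseteq D(\beta)$; $\alpha^c$ has $D(\alpha^c)=[n-1]\setminus D(\alpha)$. $w_0(\alpha)$ is the longest element of the subgroup of $\mathfrak S_n$ generated by $\{s_i:i\in D(\alpha)\}$, and $\mathbf P_\alpha:=H_n(0)T_{w_0(\alpha)}T'_{w_0(\alpha^c)}$ is the projective indecomposable $H_n(0)$-module indexed by $\alpha$. *)

theory Defs
  imports "HOL-Library.Poly_Mapping" "HOL-Combinatorics.Permutations"
begin

type_synonym 'a mpoly = "(nat \<Rightarrow>\<^sub>0 nat) \<Rightarrow>\<^sub>0 'a"

definition polys :: "nat \<Rightarrow> ('a::field) mpoly set" where
  "polys n = {f. \<forall>m \<in> Poly_Mapping.keys f. Poly_Mapping.keys m \<subseteq> {1..n}}"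

definition var :: "nat \<Rightarrow> ('a::field) mpoly" where
  "var j = Poly_Mapping.single (Poly_Mapping.single j 1) 1"

definition const :: "'a::field \<Rightarrow> 'a mpoly" where
  "const c = Poly_Mapping.single 0 c"

definition sw :: "nat \<Rightarrow> nat \<Rightarrow> nat" where
  "sw i k = (if k = i then Suc i else if k = Suc i then i else k)"

definition swap_poly :: "nat \<Rightarrow> ('a::field) mpoly \<Rightarrow> 'a mpoly" where
  "swap_poly i f = Poly_Mapping.map_key (Poly_Mapping.map_key (sw i)) f"

text \<open>Isobaric divided difference pi_i f = (x_i f - x_{i+1} s_i f)/(x_i - x_{i+1}),
  the (exact) quotient in the polynomial ring.\<close>
definition pi_op :: "nat \<Rightarrow> ('a::field) mpoly \<Rightarrow> 'a mpoly" where
  "pi_op i f = (THE g. (var i - var (Suc i)) * g = var i * f - var (Suc i) * swap_poly i f)"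

definition T_poly :: "nat \<Rightarrow> ('a::field) mpoly \<Rightarrow> 'a mpoly" where
  "T_poly i f = pi_op i f - f"

definition elem_sym :: "nat \<Rightarrow> nat set \<Rightarrow> ('a::field) mpoly" where
  "elem_sym r S = (\<Sum>T \<in> {T. T \<subseteq> S \<and> card T = r}. \<Prod>j\<in>T. var j)"

definition gen_ideal :: "nat \<Rightarrow> ('a::field) mpoly set \<Rightarrow> 'a mpoly set" where
  "gen_ideal n G = {f. \<exists>k (c :: nat \<Rightarrow> 'a mpoly) g. f = (\<Sum>j<k. c j * g j) \<and> (\<forall>j<k. c j \<in> polys n \<and> g j \<in> G)}"

text \<open>A partition mu with n parts written increasingly as mu 1 <= ... <= mu n
  (a function on {1..n}).  Its conjugate, written increasingly with n parts:
  conj_part n mu k = mu'_k.\<close>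
definition conj_part :: "nat \<Rightarrow> (nat \<Rightarrow> nat) \<Rightarrow> nat \<Rightarrow> nat" where
  "conj_part n mu k = card {i \<in> {1..n}. mu i \<ge> n + 1 - k}"

definition d_part :: "nat \<Rightarrow> (nat \<Rightarrow> nat) \<Rightarrow> nat \<Rightarrow> nat" where
  "d_part n mu k = (\<Sum>j=1..k. conj_part n mu j)"

definition tanisaki :: "nat \<Rightarrow> (nat \<Rightarrow> nat) \<Rightarrow> ('a::field) mpoly set" where
  "tanisaki n mu = gen_ideal n
     {elem_sym r S | r S. S \<subseteq> {1..n} \<and> r \<le> card S
        \<and> int r > int (card S) - int (d_part n mu (card S))}"

definition hook :: "nat \<Rightarrow> nat \<Rightarrow> nat \<Rightarrow> nat" where
  "hook n h i = (if i = n then n - h + 1 else if n - h < i \<and> i < n then 1 else 0)"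

definition perm_len :: "nat \<Rightarrow> (nat \<Rightarrow> nat) \<Rightarrow> nat" where
  "perm_len n w = card {(i, j). 1 \<le> i \<and> i < j \<and> j \<le> n \<and> w i > w j}"

definition word_perm :: "nat list \<Rightarrow> nat \<Rightarrow> nat" where
  "word_perm ws = foldr (\<lambda>i p. sw i \<circ> p) ws id"

definition reduced_word :: "nat \<Rightarrow> (nat \<Rightarrow> nat) \<Rightarrow> nat list" where
  "reduced_word n w = (SOME ws. set ws \<subseteq> {1..<n} \<and> word_perm ws = w \<and> length ws = perm_len n w)"

definition parabolic :: "nat set \<Rightarrow> (nat \<Rightarrow> nat) set" where
  "parabolic D = {word_perm ws | ws. set ws \<subseteq> D}"

definition longest :: "nat \<Rightarrow> nat set \<Rightarrow> nat \<Rightarrow> nat" where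
  "longest n D = (THE w. w \<in> parabolic D \<and> (\<forall>u \<in> parabolic D. perm_len n u \<le> perm_len n w))"

text \<open>H_n(0) as the F-vector space with basis {T_w : w in S_n}; an element is a
  coefficient function on permutations of {1..n} (zero elsewhere).\<close>
type_synonym 'a hecke = "(nat \<Rightarrow> nat) \<Rightarrow> 'a"

definition hecke_space :: "nat \<Rightarrow> ('a::field) hecke set" where
  "hecke_space n = {f. \<forall>u. \<not> u permutes {1..n} \<longrightarrow> f u = 0}"

text \<open>Left multiplication by T_i:  T_i T_w = T_{s_i w} if l(s_i w) > l(w), and -T_w otherwise.\<close>
definition T_hecke :: "nat \<Rightarrow> nat \<Rightarrow> ('a::field) hecke \<Rightarrow> 'a hecke" where
  "T_hecke n i f = (\<lambda>u. if u permutes {1..n} \<and> perm_len n (sw i \<circ> u) < perm_len n u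
                          then f (sw i \<circ> u) - f u else 0)"

definition hecke_one :: "('a::field) hecke" where
  "hecke_one = (\<lambda>u. if u = id then 1 else 0)"

definition Tw_hecke :: "nat \<Rightarrow> (nat \<Rightarrow> nat) \<Rightarrow> ('a::field) hecke \<Rightarrow> 'a hecke" where
  "Tw_hecke n w v = foldr (\<lambda>i x. T_hecke n i x) (reduced_word n w) v"

definition Tw'_hecke :: "nat \<Rightarrow> (nat \<Rightarrow> nat) \<Rightarrow> ('a::field) hecke \<Rightarrow> 'a hecke" where
  "Tw'_hecke n w v = foldr (\<lambda>i x. (\<lambda>u. T_hecke n i x u + x u)) (reduced_word n w) v"

text \<open>Compositions alpha of n are encoded by their descent sets D(alpha) \<subseteq> [n-1];
  alpha^c corresponds to [n-1] - D.  The generator T_{w0(alpha)} T'_{w0(alpha^c)}.\<close>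
definition proj_gen :: "nat \<Rightarrow> nat set \<Rightarrow> ('a::field) hecke" where
  "proj_gen n D = Tw_hecke n (longest n D) (Tw'_hecke n (longest n ({1..<n} - D)) hecke_one)"

definition proj_mod :: "nat \<Rightarrow> nat set \<Rightarrow> ('a::field) hecke set" where
  "proj_mod n D = \<Inter>{S. S \<subseteq> hecke_space n \<and> proj_gen n D \<in> S \<and> (\<lambda>_. 0) \<in> S
      \<and> (\<forall>x\<in>S. \<forall>y\<in>S. (\<lambda>u. x u + y u) \<in> S)
      \<and> (\<forall>c. \<forall>x\<in>S. (\<lambda>u. c * x u) \<in> S)
      \<and> (\<forall>i\<in>{1..<n}. \<forall>x\<in>S. T_hecke n i x \<in> S)}"

definition dsum_proj :: "nat \<Rightarrow> nat set \<Rightarrow> (nat set \<Rightarrow> ('a::field) hecke) set" where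
  "dsum_proj n Dmu = {F. \<forall>D. (D \<subseteq> Dmu \<longrightarrow> F D \<in> proj_mod n D) \<and> (\<not> D \<subseteq> Dmu \<longrightarrow> F D = (\<lambda>_. 0))}"

end

theory Submission
  imports Defs "HOL-Library.Multiset" "HOL-Library.Infinite_Set" "HOL.Vector_Spaces"
begin

text \<open>
  For a hook, \<open>I\<^sub>\<mu>\<close> is generated by \<open>e\<^sub>1, \<dots>, e\<^sub>h\<^sub>-\<^sub>1\<close> and the monomials involving at least \<open>h\<close> variables.
  For a permutation \<open>w\<close> with descent set \<open>D \<subseteq> {1..<h}\<close> put \<open>b\<^sub>w = T\<^sub>w x\<^sub>D\<close>, where \<open>x\<^sub>D\<close> is the product of
  \<open>x\<^sub>1 \<cdots> x\<^sub>i\<close> over \<open>i \<in> D\<close>. Each monomial with fewer than \<open>h\<close> variables is the leading monomial of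
  exactly one product of a \<open>b\<^sub>w\<close> with elementary symmetric polynomials \<open>e\<^sub>1, \<dots>, e\<^sub>h\<^sub>-\<^sub>1\<close>
  (a version of the Garsia--Stanton straightening): the leading term maximizes first the sum of the
  squared exponents and then a linear weight of the positions. As the \<open>T\<^sub>i\<close> commute with
  multiplication by symmetric polynomials, the products with at least one factor \<open>e\<^sub>j\<close> together with
  the monomials in at least \<open>h\<close> variables form a basis of \<open>I\<^sub>\<mu>\<close>, so the \<open>b\<^sub>w\<close> form a basis of \<open>R\<^sub>\<mu>\<close>.

  In \<open>H\<^sub>n(0)\<close>, \<open>T'\<close> of the longest element of the parabolic subgroup generated by the \<open>s\<^sub>j\<close> with
  \<open>j \<notin> D\<close> is the indicator function of that subgroup, and \<open>P\<^sub>D\<close> has a basis of indicator functions of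
  its left cosets \<open>w W\<close>, one for each \<open>w\<close> with descent set \<open>D\<close>. The \<open>T\<^sub>i\<close> act on both bases by the same rule.
\<close>

text \<open>Two obstacles shape the proof. First, \<open>below\<close> is not a monomial order: sums
  of squares are not additive, so the leading term of a product need not be the product of the
  leading terms. Squares are used because \<open>T_poly i\<close> spreads a monomial over the
  segment from its exponent to the swapped one, and by convexity only the ends of this segment keep
  the sum of squares. The price is paid on multiplying by \<open>e_j\<close>: ties must be broken by
  the linear weight, which works only for index sets that respect the blocks of w. Second,
  \<open>reduced_word\<close> is a choice, so the vectors \<open>b_w\<close> obey a rule under each
  \<open>T_i\<close> only through Matsumoto's theorem. One function ties the two modules together,
  \<open>wt D\<close>. Its value at p is the exponent of \<open>x_p\<close> in \<open>x_D\<close>,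
  and its level sets are the blocks that the parabolic subgroup permutes. Both actions follow the
  same trichotomy: in the word of w the value i+1 stands left of i, immediately right of i, or
  further right. The results are the negative of the vector, zero, and the vector of
  \<open>sw i \<circ> w\<close>. The descent set never changes, so the decomposition over D is
  visible on the basis itself.\<close>

declare One_nat_def [simp del]

section \<open>Permutations and reduced words\<close>

lemma sw_eq_transpose: "sw i = Transposition.transpose i (Suc i)"
  by (rule ext) (auto simp: sw_def Transposition.transpose_def)

lemma sw_sw [simp]: "sw i (sw i k) = k"
  by (auto simp: sw_def)

lemma sw_comp_sw [simp]: "sw i \<circ> sw i = id"
  by (rule ext) simp

lemma sw_comp_sw_assoc [simp]: "sw i \<circ> (sw i \<circ> w) = w"
  by (rule ext) simp

lemma sw_simps [simp]: "sw i i = Suc i" "sw i (Suc i) = i"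
  "k \<noteq> i \<Longrightarrow> k \<noteq> Suc i \<Longrightarrow> sw i k = k"
  by (auto simp: sw_def)

lemma sw_permutes: "i \<in> {1..<n} \<Longrightarrow> sw i permutes {1..n}"
  unfolding sw_eq_transpose by (rule permutes_swap_id) auto

lemma sw_comp_permutes: "i \<in> {1..<n} \<Longrightarrow> w permutes {1..n} \<Longrightarrow> sw i \<circ> w permutes {1..n}"
  using permutes_compose sw_permutes by blast




lemma inv_sw_comp: "w permutes {1..n} \<Longrightarrow> inv (sw i \<circ> w) = inv w \<circ> sw i"
  by (subst o_inv_distrib) (auto simp: sw_eq_transpose permutes_bij)

lemma inv_sw_comp_apply: "w permutes {1..n} \<Longrightarrow> inv (sw i \<circ> w) k = inv w (sw i k)"
  by (simp add: inv_sw_comp)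

lemma inv_permutes_in: "w permutes {1..n} \<Longrightarrow> k \<in> {1..n} \<Longrightarrow> inv w k \<in> {1..n}"
  by (simp only: permutes_in_image[OF permutes_inv])

lemma inv_permutes_neq: "w permutes {1..n} \<Longrightarrow> j \<noteq> k \<Longrightarrow> inv w j \<noteq> inv w k"
  by (metis permutes_inverses(1))

section \<open>Inversion sets and length\<close>

definition inversions :: "nat \<Rightarrow> (nat \<Rightarrow> nat) \<Rightarrow> (nat \<times> nat) set" where
  "inversions n w = {(p, q). 1 \<le> p \<and> p < q \<and> q \<le> n \<and> w p > w q}"

lemma perm_len_inversions: "perm_len n w = card (inversions n w)"
  by (simp add: perm_len_def inversions_def)

lemma finite_inversions: "finite (inversions n w)"
  by (rule finite_subset[of _ "{1..n} \<times> {1..n}"]) (auto simp: inversions_def)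

text \<open>Only the comparison of the adjacent values i and i+1 is reversed by \<open>sw i\<close>,
  so one pair of positions changes. The equality of sets, beyond that of lengths, is what
  \<open>reduced_Cons_wt\<close> exploits.\<close>

lemma inversions_sw:
  assumes w: "w permutes {1..n}" and i: "i \<in> {1..<n}" and up: "inv w i < inv w (Suc i)"
  shows "inversions n (sw i \<circ> w) = insert (inv w i, inv w (Suc i)) (inversions n w)"
    and "(inv w i, inv w (Suc i)) \<notin> inversions n w"
proof -
  have wi: "w (inv w k) = k" for k using w by (simp add: permutes_inverses)
  have ri: "inv w i \<in> {1..n}" "inv w (Suc i) \<in> {1..n}"
    using w i inv_permutes_in[OF w, of i] inv_permutes_in[OF w, of "Suc i"] by auto
  show "(inv w i, inv w (Suc i)) \<notin> inversions n w"
    by (simp add: inversions_def wi)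
  have "(sw i (w p) > sw i (w q)) \<longleftrightarrow> w p > w q \<or> (p = inv w i \<and> q = inv w (Suc i))"
    if "p < q" for p q
  proof -
    have p: "p = inv w (w p)" "q = inv w (w q)" using w by (simp_all add: permutes_inverses)
    have "w p \<noteq> w q" using p that by (metis less_irrefl)
    moreover have "\<not> (w p = Suc i \<and> w q = i)" using p that up by auto
    ultimately have "(sw i (w p) > sw i (w q)) \<longleftrightarrow> w p > w q \<or> (w p = i \<and> w q = Suc i)"
      by (auto simp: sw_def)
    then show ?thesis using p wi by metis
  qed
  then show "inversions n (sw i \<circ> w) = insert (inv w i, inv w (Suc i)) (inversions n w)"
    using ri up by (auto simp: inversions_def)
qed

lemma perm_len_sw_up:
  assumes "w permutes {1..n}" "i \<in> {1..<n}" "inv w i < inv w (Suc i)"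
  shows "perm_len n (sw i \<circ> w) = Suc (perm_len n w)"
  using inversions_sw[OF assms] finite_inversions by (simp add: perm_len_inversions)

lemma perm_len_sw_down:
  assumes w: "w permutes {1..n}" and i: "i \<in> {1..<n}" and "inv w (Suc i) < inv w i"
  shows "perm_len n w = Suc (perm_len n (sw i \<circ> w))"
  using perm_len_sw_up[OF sw_comp_permutes[OF i w] i] assms by (simp add: inv_sw_comp_apply)

lemma perm_len_sw_less_iff:
  assumes w: "w permutes {1..n}" and i: "i \<in> {1..<n}"
  shows "perm_len n (sw i \<circ> w) < perm_len n w \<longleftrightarrow> inv w (Suc i) < inv w i"
  using perm_len_sw_up[OF assms] perm_len_sw_down[OF assms] inv_permutes_neq[OF w, of i "Suc i"]
  by (metis less_not_sym lessI linorder_neqE_nat n_not_Suc_n)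

lemma perm_len_inv:
  assumes w: "w permutes {1..n}"
  shows "perm_len n (inv w) = perm_len n w"
proof -
  have wi: "w (inv w k) = k" "inv w (w k) = k" for k using w by (simp_all add: permutes_inverses)
  have r: "1 \<le> w k" "w k \<le> n" "1 \<le> inv w k" "inv w k \<le> n" if "1 \<le> k" "k \<le> n" for k
    using permutes_in_image[OF w, of k] inv_permutes_in[OF w, of k] that by simp_all
  have "bij_betw (\<lambda>(p, q). (w q, w p)) (inversions n w) (inversions n (inv w))"
  proof (rule bij_betwI[where g = "\<lambda>(p, q). (inv w q, inv w p)"])
    show "(\<lambda>(p, q). (w q, w p)) \<in> inversions n w \<rightarrow> inversions n (inv w)"
      by (intro funcsetI) (clarsimp simp: inversions_def wi r)
    show "(\<lambda>(p, q). (inv w q, inv w p)) \<in> inversions n (inv w) \<rightarrow> inversions n w"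
      by (intro funcsetI) (clarsimp simp: inversions_def wi r)
  qed (clarsimp simp: wi)+
  then show ?thesis by (simp add: perm_len_inversions bij_betw_same_card)
qed

lemma comp_sw_eq_inv: "w permutes {1..n} \<Longrightarrow> w \<circ> sw j = inv (sw j \<circ> inv w)"
  by (simp add: inv_sw_comp[OF permutes_inv] permutes_inv_inv)

lemma perm_len_right_up:
  assumes "w permutes {1..n}" "j \<in> {1..<n}" "w j < w (Suc j)"
  shows "perm_len n (w \<circ> sw j) = Suc (perm_len n w)"
proof -
  have "perm_len n (w \<circ> sw j) = perm_len n (sw j \<circ> inv w)"
    unfolding comp_sw_eq_inv[OF assms(1)]
    by (rule perm_len_inv) (intro sw_comp_permutes permutes_inv assms)
  also have "\<dots> = Suc (perm_len n (inv w))"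
    using perm_len_sw_up[OF permutes_inv[OF assms(1)] assms(2)] assms by (simp add: permutes_inv_inv)
  finally show ?thesis using perm_len_inv[OF assms(1)] by simp
qed

text \<open>Induction from the left end gives \<open>k \<le> y k\<close>, and induction from the
  right end gives \<open>y k \<le> k\<close>.\<close>

lemma permutes_increasing_id:
  fixes y :: "nat \<Rightarrow> nat"
  assumes y: "y permutes {1..n}" and inc: "\<And>i. i \<in> {1..<n} \<Longrightarrow> y i < y (Suc i)"
  shows "y = id"
proof -
  have r: "y k \<in> {1..n}" if "k \<in> {1..n}" for k using permutes_in_image[OF y] that by blast
  have lo: "Suc k \<le> n \<Longrightarrow> Suc k \<le> y (Suc k)" for k
  proof (induction k)
    case 0 then show ?case using r[of 1] by (auto simp: One_nat_def)
  next
    case (Suc k) then show ?case using inc[of "Suc k"] by auto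
  qed
  have hi: "k < n \<Longrightarrow> y (n - k) \<le> n - k" for k
  proof (induction k)
    case 0 then show ?case using r[of n] by auto
  next
    case (Suc k)
    then have "y (n - Suc k) < y (Suc (n - Suc k))" by (intro inc) auto
    then show ?case using Suc by (simp add: Suc_diff_Suc)
  qed
  show ?thesis
  proof (rule ext)
    fix k
    show "y k = id k"
    proof (cases "k \<in> {1..n}")
      case True
      then show ?thesis using lo[of "k - 1"] hi[of "n - k"] by auto
    next
      case False then show ?thesis using y by (simp add: permutes_def)
    qed
  qed
qed

text \<open>The permutation \<open>v \<circ> inv w\<close> is not the identity, and any descent of it is the required \<open>i\<close>.\<close>
lemma ex_left_descent_outside:
  assumes v: "v permutes {1..n}" and w: "w permutes {1..n}"
    and sub: "inversions n v \<subseteq> inversions n w" and ne: "w \<noteq> v"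
  shows "\<exists>i\<in>{1..<n}. inv w (Suc i) < inv w i \<and> (inv w (Suc i), inv w i) \<notin> inversions n v"
proof -
  have perm: "v \<circ> inv w permutes {1..n}"
    by (intro permutes_compose permutes_inv v w)
  have "v \<circ> inv w \<noteq> id"
  proof
    assume "v \<circ> inv w = id"
    then have "v (inv w (w x)) = w x" for x by (metis comp_apply id_apply)
    then show False using ne permutes_inverses(2)[OF w] by auto
  qed
  then obtain i where i: "i \<in> {1..<n}" and "\<not> v (inv w i) < v (inv w (Suc i))"
    using permutes_increasing_id[OF perm] by auto
  moreover have "v (inv w i) \<noteq> v (inv w (Suc i))"
    using inv_permutes_neq[OF w, of i "Suc i"] v by (metis n_not_Suc_n permutes_inverses(2))
  ultimately have vi: "v (inv w (Suc i)) < v (inv w i)" by auto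
  have r: "inv w i \<in> {1..n}" "inv w (Suc i) \<in> {1..n}"
    using w i inv_permutes_in[OF w, of i] inv_permutes_in[OF w, of "Suc i"] by auto
  have "\<not> inv w i < inv w (Suc i)"
  proof
    assume "inv w i < inv w (Suc i)"
    then have "(inv w i, inv w (Suc i)) \<in> inversions n v" using vi r by (auto simp: inversions_def)
    then show False using sub w by (auto simp: inversions_def permutes_inverses)
  qed
  then have "inv w (Suc i) < inv w i" using inv_permutes_neq[OF w, of i "Suc i"] by auto
  then show ?thesis using i vi by (auto simp: inversions_def intro!: bexI[of _ i])
qed

lemma inversions_inject:
  assumes "v permutes {1..n}" "w permutes {1..n}" "inversions n v = inversions n w"
  shows "v = w"
proof (rule ccontr)
  assume "v \<noteq> w"
  then obtain i where "i \<in> {1..<n}" "inv w (Suc i) < inv w i"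
    and "(inv w (Suc i), inv w i) \<notin> inversions n w"
    using ex_left_descent_outside[OF assms(1,2)] assms(3) by auto
  moreover have "inv w i \<in> {1..n}" "inv w (Suc i) \<in> {1..n}"
    using \<open>i \<in> {1..<n}\<close> inv_permutes_in[OF assms(2), of i] inv_permutes_in[OF assms(2), of "Suc i"] by auto
  ultimately show False using assms(2) by (auto simp: inversions_def permutes_inverses)
qed

lemma inversions_id [simp]: "inversions n id = {}"
  by (auto simp: inversions_def)

lemma perm_len_id [simp]: "perm_len n id = 0"
  by (simp add: perm_len_inversions)

lemma ex_left_descent:
  assumes w: "w permutes {1..n}" and ne: "w \<noteq> id"
  shows "\<exists>i\<in>{1..<n}. inv w (Suc i) < inv w i"
  using ex_left_descent_outside[OF permutes_id w _ ne] by auto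

section \<open>Reduced words and Matsumoto's theorem\<close>

lemma word_perm_Nil [simp]: "word_perm [] = id"
  by (simp add: word_perm_def)

lemma word_perm_Cons [simp]: "word_perm (i # ws) = sw i \<circ> word_perm ws"
  by (simp add: word_perm_def)

lemma word_perm_append: "word_perm (vs @ ws) = word_perm vs \<circ> word_perm ws"
  by (induction vs) (auto simp: o_assoc)

lemma word_perm_permutes: "set ws \<subseteq> {1..<n} \<Longrightarrow> word_perm ws permutes {1..n}"
  by (induction ws) (auto intro!: sw_comp_permutes simp: permutes_id)

definition reduced :: "nat \<Rightarrow> nat list \<Rightarrow> bool" where
  "reduced n ws \<longleftrightarrow> set ws \<subseteq> {1..<n} \<and> length ws = perm_len n (word_perm ws)"

lemma perm_len_word_perm_le: "set ws \<subseteq> {1..<n} \<Longrightarrow> perm_len n (word_perm ws) \<le> length ws"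
proof (induction ws)
  case (Cons i ws)
  have p: "word_perm ws permutes {1..n}" by (rule word_perm_permutes) (use Cons in auto)
  have i: "i \<in> {1..<n}" using Cons by auto
  have "inv (word_perm ws) i \<noteq> inv (word_perm ws) (Suc i)"
    by (rule inv_permutes_neq[OF p]) auto
  then have "perm_len n (sw i \<circ> word_perm ws) \<le> Suc (perm_len n (word_perm ws))"
    using perm_len_sw_up[OF p i] perm_len_sw_down[OF p i] by linarith
  then show ?case using Cons by (simp del: o_apply)
qed auto

lemma reduced_Nil: "reduced n []"
  by (simp add: reduced_def)

text \<open>A letter changes the length by exactly one and a word is never shorter than the length
  of its permutation. So a word stays reduced only if every added letter goes up.\<close>

lemma reduced_Cons_iff:
  "reduced n (i # ws) \<longleftrightarrow>
    i \<in> {1..<n} \<and> reduced n ws \<and> inv (word_perm ws) i < inv (word_perm ws) (Suc i)"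
proof (cases "i \<in> {1..<n} \<and> set ws \<subseteq> {1..<n}")
  case True
  then have p: "word_perm ws permutes {1..n}" and i: "i \<in> {1..<n}" and s: "set ws \<subseteq> {1..<n}"
    by (auto intro: word_perm_permutes)
  have "inv (word_perm ws) i \<noteq> inv (word_perm ws) (Suc i)"
    by (rule inv_permutes_neq[OF p]) auto
  then have "Suc (length ws) = perm_len n (sw i \<circ> word_perm ws) \<longleftrightarrow>
      length ws = perm_len n (word_perm ws) \<and> inv (word_perm ws) i < inv (word_perm ws) (Suc i)"
    using perm_len_sw_up[OF p i] perm_len_sw_down[OF p i] perm_len_word_perm_le[OF s] by linarith
  then show ?thesis using True by (auto simp: reduced_def)
qed (auto simp: reduced_def)

lemma reduced_Cons_descent:
  assumes "reduced n (i # ws)"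
  shows "inv (word_perm (i # ws)) (Suc i) < inv (word_perm (i # ws)) i"
proof -
  have "word_perm ws permutes {1..n}"
    using assms by (auto simp: reduced_def intro!: word_perm_permutes)
  then show ?thesis using assms by (simp add: reduced_Cons_iff inv_sw_comp)
qed

lemma ex_reduced_word:
  "w permutes {1..n} \<Longrightarrow> \<exists>ws. reduced n ws \<and> word_perm ws = w"
proof (induction "perm_len n w" arbitrary: w rule: less_induct)
  case less
  show ?case
  proof (cases "w = id")
    case True then show ?thesis by (intro exI[of _ "[]"]) (auto simp: reduced_Nil)
  next
    case False
    then obtain i where i: "i \<in> {1..<n}" and d: "inv w (Suc i) < inv w i"
      using ex_left_descent less.prems by blast
    obtain ws where ws: "reduced n ws" "word_perm ws = sw i \<circ> w"
      using less.hyps[of "sw i \<circ> w"] perm_len_sw_down[OF less.prems i d]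
        sw_comp_permutes[OF i less.prems] by auto
    then show ?thesis using i d less.prems
      by (intro exI[of _ "i # ws"]) (auto simp: reduced_Cons_iff inv_sw_comp)
  qed
qed

lemma reduced_word:
  assumes "w permutes {1..n}"
  shows "reduced n (reduced_word n w)" "word_perm (reduced_word n w) = w"
proof -
  have "\<exists>ws. set ws \<subseteq> {1..<n} \<and> word_perm ws = w \<and> length ws = perm_len n w"
    using ex_reduced_word[OF assms] by (auto simp: reduced_def)
  from someI_ex[OF this] show "reduced n (reduced_word n w)" "word_perm (reduced_word n w) = w"
    unfolding reduced_word_def[symmetric] by (auto simp: reduced_def)
qed

text \<open>Only commutation and braid relations appear, because these alone connect the reduced
  words of a permutation. The family of operators is arbitrary since the result serves both
  \<open>T'_hecke\<close> and \<open>T_poly\<close>.\<close>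

definition braid_ops :: "nat \<Rightarrow> (nat \<Rightarrow> 'b \<Rightarrow> 'b) \<Rightarrow> bool" where
  "braid_ops n t \<longleftrightarrow>
    (\<forall>i\<in>{1..<n}. \<forall>j\<in>{1..<n}. \<forall>x. Suc i < j \<longrightarrow> t i (t j x) = t j (t i x)) \<and>
    (\<forall>i\<in>{1..<n}. \<forall>x. Suc i < n \<longrightarrow> t i (t (Suc i) (t i x)) = t (Suc i) (t i (t (Suc i) x)))"

text \<open>Matsumoto's theorem: two reduced words with first letters \<open>i \<noteq> j\<close> are both compared with
  words starting with the two reduced words of the longest element generated by \<open>s\<^sub>i, s\<^sub>j\<close>.\<close>
lemma foldr_reduced_cong:
  assumes t: "braid_ops n t"
  shows "reduced n ws \<Longrightarrow> reduced n vs \<Longrightarrow> word_perm ws = word_perm vs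
    \<Longrightarrow> foldr t ws x = foldr t vs x"
proof (induction "length ws" arbitrary: ws vs rule: less_induct)
  case less
  have IH: "foldr t as x = foldr t bs x"
    if "length as < length ws" "reduced n as" "reduced n bs" "word_perm as = word_perm bs" for as bs
    using less.hyps that by blast
  have len: "length ws = length vs" using less.prems by (simp add: reduced_def)
  have key: "foldr t (i # as) x = foldr t (j # bs) x"
    if ij: "i < j" and ra: "reduced n (i # as)" and rb: "reduced n (j # bs)"
      and eq: "word_perm (i # as) = word_perm (j # bs)" and l: "length ws = Suc (length as)"
    for i j as bs
  proof -
    define w where "w = word_perm (i # as)"
    have w: "w permutes {1..n}"
      unfolding w_def by (rule word_perm_permutes) (use ra in \<open>simp add: reduced_def\<close>)
    have i: "i \<in> {1..<n}" and j: "j \<in> {1..<n}" using ra rb by (auto simp: reduced_Cons_iff)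
    have as: "word_perm as = sw i \<circ> w" by (simp add: w_def)
    have bs: "word_perm bs = sw j \<circ> w" using eq by (simp add: w_def)
    have di: "inv w (Suc i) < inv w i" using reduced_Cons_descent[OF ra] by (simp add: w_def)
    have dj: "inv w (Suc j) < inv w j" using reduced_Cons_descent[OF rb] eq by (simp add: w_def)
    have ra': "reduced n as" and rb': "reduced n bs" using ra rb by (auto simp: reduced_Cons_iff)
    have l2: "length as = length bs" using ra rb eq by (auto simp: reduced_def)
    show ?thesis
    proof (cases "Suc i < j")
      case True
      define u where "u = sw i \<circ> (sw j \<circ> w)"
      have u: "u permutes {1..n}" unfolding u_def by (intro sw_comp_permutes i j w)
      have ui: "inv u k = inv w (sw j (sw i k))" for k
        by (simp only: u_def inv_sw_comp_apply[OF sw_comp_permutes[OF j w]] inv_sw_comp_apply[OF w])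
      obtain us where us: "reduced n us" "word_perm us = u" using ex_reduced_word[OF u] by auto
      have c: "sw i \<circ> sw j = sw j \<circ> sw i" using True by (auto simp: sw_def)
      have u2: "sw j \<circ> u = sw i \<circ> w" unfolding u_def by (metis c comp_assoc sw_comp_sw id_comp)
      have 1: "foldr t as x = foldr t (j # us) x"
        using us ui True dj j u2 by (intro IH) (auto simp: l ra' as reduced_Cons_iff)
      have 2: "foldr t bs x = foldr t (i # us) x"
        using us ui True di i by (intro IH) (auto simp: l l2 rb' bs reduced_Cons_iff u_def)
      have "t i (t j y) = t j (t i y)" for y
        using t True i j unfolding braid_ops_def by blast
      then show ?thesis using 1 2 by simp
    next
      case False
      then have ji: "j = Suc i" using ij by auto
      define u where "u = sw i \<circ> (sw j \<circ> (sw i \<circ> w))"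
      have u: "u permutes {1..n}" unfolding u_def by (intro sw_comp_permutes i j w)
      have ui: "inv u k = inv w (sw i (sw j (sw i k)))" for k
        by (simp only: u_def inv_sw_comp_apply[OF sw_comp_permutes[OF j sw_comp_permutes[OF i w]]]
          inv_sw_comp_apply[OF sw_comp_permutes[OF i w]] inv_sw_comp_apply[OF w])
      obtain us where us: "reduced n us" "word_perm us = u" using ex_reduced_word[OF u] by auto
      have c: "sw i \<circ> (sw j \<circ> sw i) = sw j \<circ> (sw i \<circ> sw j)" using ji by (auto simp: sw_def)
      have u1: "sw j \<circ> (sw i \<circ> u) = sw i \<circ> w" by (simp add: u_def)
      have "u = sw j \<circ> (sw i \<circ> (sw j \<circ> w))" unfolding u_def by (metis c comp_assoc)
      then have u2: "sw i \<circ> (sw j \<circ> u) = sw j \<circ> w" by simp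
      have ii: "inv (sw k \<circ> u) l = inv u (sw k l)" for k l using u by (rule inv_sw_comp_apply)
      have 1: "foldr t as x = foldr t (j # i # us) x"
        using us di dj i j u1 by (intro IH) (auto simp: l ra' as reduced_Cons_iff ii ui ji sw_def)
      have 2: "foldr t bs x = foldr t (i # j # us) x"
        using us di dj i j u2 by (intro IH) (auto simp: l l2 rb' bs reduced_Cons_iff ii ui ji sw_def)
      show ?thesis using 1 2 t i j ji by (simp add: braid_ops_def)
    qed
  qed
  show ?case
  proof (cases ws)
    case Nil then show ?thesis using len by auto
  next
    case (Cons i as)
    then obtain j bs where vs: "vs = j # bs" using len by (cases vs) auto
    show ?thesis
    proof (cases i j rule: linorder_cases)
      case less then show ?thesis using key[of i j as bs] less.prems Cons vs by auto
    next
      case greater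
      then show ?thesis using key[of j i bs as] less.prems Cons vs len by auto
    next
      case equal
      have "sw i \<circ> word_perm ws = sw j \<circ> word_perm vs"
        using less.prems equal by simp
      then have "word_perm as = word_perm bs" using Cons vs by simp
      then have "foldr t as x = foldr t bs x"
        using less.prems Cons vs by (intro IH) (auto simp: reduced_Cons_iff)
      then show ?thesis using Cons vs equal by simp
    qed
  qed
qed

text \<open>Removes the arbitrary choice in \<open>reduced_word\<close>: any convenient reduced word
  may be substituted for the chosen one.\<close>

lemma foldr_reduced_word:
  assumes "braid_ops n t" "reduced n ws"
  shows "foldr t (reduced_word n (word_perm ws)) x = foldr t ws x"
  using reduced_word[OF word_perm_permutes, of ws n] assms
  by (intro foldr_reduced_cong[OF assms(1)]) (auto simp: reduced_def)

lemma foldr_reduced_word_left: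
  assumes t: "braid_ops n t" and w: "w permutes {1..n}" and i: "i \<in> {1..<n}"
    and up: "inv w i < inv w (Suc i)"
  shows "foldr t (reduced_word n (sw i \<circ> w)) x = t i (foldr t (reduced_word n w) x)"
  using foldr_reduced_word[OF t, of "i # reduced_word n w" x] reduced_word[OF w] i up
  by (simp add: reduced_Cons_iff)

text \<open>A letter at the right end acts first, directly on the starting vector. This is how
  \<open>T_poly_hecke_vec_adjacent\<close> moves a letter from the left end to a place where it
  annihilates.\<close>

lemma foldr_reduced_word_right:
  assumes t: "braid_ops n t" and w: "w permutes {1..n}" and j: "j \<in> {1..<n}"
    and up: "w j < w (Suc j)"
  shows "foldr t (reduced_word n (w \<circ> sw j)) x = foldr t (reduced_word n w) (t j x)"
proof -
  have wp: "word_perm (reduced_word n w @ [j]) = w \<circ> sw j"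
    using reduced_word[OF w] by (simp add: word_perm_append)
  have "reduced n (reduced_word n w @ [j])"
    using reduced_word[OF w] j perm_len_right_up[OF w j up] wp by (simp add: reduced_def)
  from foldr_reduced_word[OF t this, of x] show ?thesis using wp by simp
qed


section \<open>Descents, parabolic subgroups and the regular 0-Hecke module\<close>

definition desc :: "nat \<Rightarrow> (nat \<Rightarrow> nat) \<Rightarrow> nat set" where
  "desc n w = {j \<in> {1..<n}. w (Suc j) < w j}"

text \<open>Without a descent in between, w would increase from position p to position q.\<close>

lemma inversion_imp_desc:
  assumes "1 \<le> p" "p < q" "q \<le> n" "w q < w p"
  shows "\<exists>j\<in>desc n w. p \<le> j \<and> j < q"
  using assms
proof (induction q)
  case (Suc q)
  show ?case
  proof (cases "w (Suc q) < w q")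
    case True then show ?thesis using Suc.prems by (intro bexI[of _ q]) (auto simp: desc_def)
  next
    case False
    then have "p < q" "w q < w p" using Suc.prems by (auto simp: less_Suc_eq)
    then show ?thesis using Suc.IH Suc.prems by force
  qed
qed simp

lemma desc_subset_of_inversions:
  "inversions n v \<subseteq> inversions n w \<Longrightarrow> desc n v \<subseteq> desc n w"
  by (auto simp: desc_def inversions_def)

text \<open>When i and i+1 occupy neighbouring positions, exchanging the two values is the same as
  exchanging the two positions, so a left factor turns into a right one.\<close>

lemma desc_sw_adjacent:
  assumes w: "w permutes {1..n}" and i: "i \<in> {1..<n}" and a: "inv w (Suc i) = Suc (inv w i)"
  shows "sw i \<circ> w = w \<circ> sw (inv w i)" "inv w i \<in> {1..<n}" "w (inv w i) < w (Suc (inv w i))"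
proof -
  have wi: "w (inv w k) = k" "inv w (w k) = k" for k using w by (simp_all add: permutes_inverses)
  show "sw i \<circ> w = w \<circ> sw (inv w i)"
  proof (rule ext)
    fix k
    consider "k = inv w i" | "k = inv w (Suc i)" | "w k \<noteq> i" "w k \<noteq> Suc i" using wi by metis
    then show "(sw i \<circ> w) k = (w \<circ> sw (inv w i)) k"
    proof cases
      case 1 then show ?thesis using wi a by (metis comp_apply sw_simps(1))
    next
      case 2 then show ?thesis using wi a by (metis comp_apply sw_simps(2))
    next
      case 3
      then have "k \<noteq> inv w i" "k \<noteq> Suc (inv w i)" using wi a by metis+
      then show ?thesis using 3 by simp
    qed
  qed
  show "w (inv w i) < w (Suc (inv w i))" using wi a by (metis lessI)
  show "inv w i \<in> {1..<n}"
    using inv_permutes_in[OF w, of i] inv_permutes_in[OF w, of "Suc i"] i a by auto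
qed

lemma desc_sw_nonadjacent:
  assumes w: "w permutes {1..n}" and i: "i \<in> {1..<n}"
    and a: "inv w (Suc i) \<noteq> Suc (inv w i)" "inv w i \<noteq> Suc (inv w (Suc i))"
  shows "desc n (sw i \<circ> w) = desc n w"
proof -
  have wi: "w (inv w k) = k" "inv w (w k) = k" for k using w by (simp_all add: permutes_inverses)
  have "sw i (w (Suc j)) < sw i (w j) \<longleftrightarrow> w (Suc j) < w j" for j
  proof -
    have "w (Suc j) \<noteq> w j" using wi by (metis n_not_Suc_n)
    moreover have "\<not> (w j = i \<and> w (Suc j) = Suc i)" "\<not> (w j = Suc i \<and> w (Suc j) = i)"
      using a wi by metis+
    ultimately show ?thesis by (auto simp: sw_def)
  qed
  then show ?thesis by (simp add: desc_def)
qed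

text \<open>The entry right after i is neither i nor i+1. If it is smaller than i, there is a
  descent at once; if it is larger than i+1, the word must come down before it reaches i+1.\<close>

lemma ex_desc_between:
  assumes w: "w permutes {1..n}" and i: "i \<in> {1..<n}"
    and up: "inv w i < inv w (Suc i)" and a: "inv w (Suc i) \<noteq> Suc (inv w i)"
  shows "\<exists>j\<in>desc n w. inv w i \<le> j \<and> j < inv w (Suc i)"
proof -
  have wi: "w (inv w k) = k" "inv w (w k) = k" for k using w by (simp_all add: permutes_inverses)
  have r: "1 \<le> inv w i" "inv w (Suc i) \<le> n"
    using inv_permutes_in[OF w, of i] inv_permutes_in[OF w, of "Suc i"] i by auto
  let ?m = "Suc (inv w i)"
  have "w ?m \<noteq> i" using wi by (metis n_not_Suc_n)
  moreover have "w ?m \<noteq> Suc i" using wi a by metis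
  ultimately consider "w ?m < i" | "w ?m > Suc i" by linarith
  then show ?thesis
  proof cases
    case 1
    have "\<exists>j\<in>desc n w. inv w i \<le> j \<and> j < ?m"
      by (rule inversion_imp_desc) (use r up a wi 1 in auto)
    then show ?thesis using up by force
  next
    case 2
    have "\<exists>j\<in>desc n w. ?m \<le> j \<and> j < inv w (Suc i)"
      by (rule inversion_imp_desc) (use r up a wi 2 in auto)
    then show ?thesis by (meson Suc_leD)
  qed
qed

text \<open>Constant on the blocks into which D cuts the positions, and strictly smaller on each
  later block. The same number is the exponent of \<open>x_p\<close> in the product of
  \<open>x_1 ... x_i\<close> over i in D, so it serves as a label of cosets and as an
  exponent.\<close>

definition wt :: "nat set \<Rightarrow> nat \<Rightarrow> nat" where
  "wt D p = card {i \<in> D. p \<le> i}"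

lemma wt_split:
  assumes "finite D" "p \<le> q"
  shows "wt D p = wt D q + card {i \<in> D. p \<le> i \<and> i < q}"
proof -
  have "{i \<in> D. p \<le> i} = {i \<in> D. q \<le> i} \<union> {i \<in> D. p \<le> i \<and> i < q}" using assms(2) by auto
  then show ?thesis unfolding wt_def using assms(1) by (simp add: card_Un_disjoint disjoint_iff)
qed

lemma wt_antimono: "finite D \<Longrightarrow> p \<le> q \<Longrightarrow> wt D q \<le> wt D p"
  using wt_split by fastforce

lemma wt_less_imp: "finite D \<Longrightarrow> wt D q < wt D p \<Longrightarrow> p < q"
  using wt_antimono by (metis linorder_not_le)

lemma wt_less: "finite D \<Longrightarrow> j \<in> D \<Longrightarrow> p \<le> j \<Longrightarrow> j < q \<Longrightarrow> wt D q < wt D p"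
  using wt_split[of D p q] by (auto simp: card_gt_0_iff)

lemma wt_Suc: "finite D \<Longrightarrow> wt D p = wt D (Suc p) + (if p \<in> D then 1 else 0)"
proof -
  assume "finite D"
  moreover have "{i \<in> D. p \<le> i \<and> i < Suc p} = (if p \<in> D then {p} else {})"
    by (auto simp: less_Suc_eq)
  ultimately show ?thesis using wt_split[of D p "Suc p"] by auto
qed

lemma wt_sw: "finite D \<Longrightarrow> i \<notin> D \<Longrightarrow> wt D (sw i k) = wt D k"
  using wt_Suc[of D i] by (cases "k = i"; cases "k = Suc i") auto

text \<open>The pair created by the new letter is an inversion of the longer permutation, hence
  straddles one of its descents, and that descent lies in D. Thus every letter of a reduced word
  meets two positions of different weight, the case in which \<open>T_hcoset_up\<close> and
  \<open>T_poly_lead\<close> apply.\<close>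

lemma reduced_Cons_wt:
  assumes r: "reduced n (i # ws)" and D: "desc n (word_perm (i # ws)) \<subseteq> D" "finite D"
  shows "desc n (word_perm ws) \<subseteq> D"
    and "wt D (inv (word_perm ws) (Suc i)) < wt D (inv (word_perm ws) i)"
proof -
  let ?w = "word_perm ws"
  have i: "i \<in> {1..<n}" and up: "inv ?w i < inv ?w (Suc i)" and "reduced n ws"
    using r by (simp_all add: reduced_Cons_iff)
  then have w: "?w permutes {1..n}" by (simp add: reduced_def word_perm_permutes)
  have inv: "inversions n (word_perm (i # ws)) = insert (inv ?w i, inv ?w (Suc i)) (inversions n ?w)"
    using inversions_sw[OF w i up] by simp
  then show "desc n ?w \<subseteq> D"
    using desc_subset_of_inversions[of n ?w "word_perm (i # ws)"] D by auto
  have "(inv ?w i, inv ?w (Suc i)) \<in> inversions n (word_perm (i # ws))" using inv by simp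
  then obtain j where "j \<in> desc n (word_perm (i # ws))" "inv ?w i \<le> j" "j < inv ?w (Suc i)"
    using inversion_imp_desc unfolding inversions_def by blast
  then show "wt D (inv ?w (Suc i)) < wt D (inv ?w i)" using D wt_less by blast
qed

text \<open>The stable sort of the indices: \<open>w p\<close> is the index in place p when values
  of m decrease and ties are listed by increasing index.\<close>

definition sorts :: "nat \<Rightarrow> (nat \<Rightarrow> nat) \<Rightarrow> (nat \<Rightarrow> nat) \<Rightarrow> bool" where
  "sorts n m w \<longleftrightarrow> (\<forall>p\<in>{1..<n}. m (w (Suc p)) < m (w p) \<or> m (w p) = m (w (Suc p)) \<and> w p < w (Suc p))"

text \<open>Both permutations list the indices along the strict linear order \<open>L\<close>, so
  \<open>inv v \<circ> w\<close> has no descent and must be the identity.\<close>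

lemma sorts_unique:
  assumes w: "w permutes {1..n}" and v: "v permutes {1..n}" and s: "sorts n m w" "sorts n m v"
  shows "w = v"
proof -
  define L where "L a b \<longleftrightarrow> m b < m a \<or> m a = m b \<and> a < b" for a b
  have v_mono: "L (v p) (v q)" if "1 \<le> p" "p < q" "q \<le> n" for p q
    using that
  proof (induction q)
    case (Suc q)
    have "L (v q) (v (Suc q))" using s(2) Suc.prems by (auto simp: sorts_def L_def)
    moreover have "p = q \<or> L (v p) (v q)" using Suc by (auto simp: less_Suc_eq)
    ultimately show ?case by (auto simp: L_def)
  qed simp
  have vi: "v (inv v k) = k" "inv v (v k) = k" for k using v by (simp_all add: permutes_inverses)
  have perm: "inv v \<circ> w permutes {1..n}" by (intro permutes_compose w permutes_inv v)
  have "inv v \<circ> w = id"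
  proof (rule permutes_increasing_id[OF perm])
    fix p assume p: "p \<in> {1..<n}"
    have r: "(inv v \<circ> w) p \<in> {1..n}" "(inv v \<circ> w) (Suc p) \<in> {1..n}"
      using permutes_in_image[OF perm, of p] permutes_in_image[OF perm, of "Suc p"] p by auto
    have l: "L (w p) (w (Suc p))" using s(1) p by (auto simp: sorts_def L_def)
    have "\<not> (inv v \<circ> w) (Suc p) < (inv v \<circ> w) p"
    proof
      assume "(inv v \<circ> w) (Suc p) < (inv v \<circ> w) p"
      then have "L (w (Suc p)) (w p)" using v_mono r vi by (metis atLeastAtMost_iff comp_apply)
      then show False using l by (auto simp: L_def)
    qed
    moreover have "(inv v \<circ> w) (Suc p) \<noteq> (inv v \<circ> w) p"
      using l vi by (metis L_def comp_apply less_irrefl)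
    ultimately show "(inv v \<circ> w) p < (inv v \<circ> w) (Suc p)" by linarith
  qed
  then have "inv v (w k) = k" for k by (metis comp_apply id_apply)
  then show ?thesis using vi by (metis ext)
qed

text \<open>Recovers w from the rearrangement of a profile \<rho> that drops at least at the
  descents of w: ties of \<rho> then occur only where w increases. Injectivity rests on this for the
  coset functions as well as for the leading exponents.\<close>

lemma sorts_comp_inv:
  assumes w: "w permutes {1..n}"
    and le: "\<And>p. p \<in> {1..<n} \<Longrightarrow> \<rho> (Suc p) \<le> \<rho> p"
    and less: "\<And>p. p \<in> desc n w \<Longrightarrow> \<rho> (Suc p) < \<rho> p"
  shows "sorts n (\<lambda>k. \<rho> (inv w k)) w"
  unfolding sorts_def
proof
  fix p assume p: "p \<in> {1..<n}"
  have wi: "inv w (w k) = k" for k using w by (simp add: permutes_inverses)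
  have "w p \<noteq> w (Suc p)" using wi by (metis n_not_Suc_n)
  then consider "w (Suc p) < w p" | "w p < w (Suc p)" by linarith
  then show "\<rho> (inv w (w (Suc p))) < \<rho> (inv w (w p)) \<or>
      \<rho> (inv w (w p)) = \<rho> (inv w (w (Suc p))) \<and> w p < w (Suc p)"
    by cases (use le[OF p] less[of p] p in \<open>auto simp: wi desc_def\<close>)
qed

section \<open>Parabolic subgroups and their longest elements\<close>

lemma parabolic_Nil: "id \<in> parabolic J"
  by (auto simp: parabolic_def intro!: exI[of _ "[]"])

lemma parabolic_sw_comp: "u \<in> parabolic J \<Longrightarrow> j \<in> J \<Longrightarrow> sw j \<circ> u \<in> parabolic J"
  unfolding parabolic_def by (clarsimp, rule_tac x = "j # ws" in exI) simp

lemma parabolic_comp_sw: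
  assumes "u \<in> parabolic J" "j \<in> J"
  shows "u \<circ> sw j \<in> parabolic J"
proof -
  obtain ws where "set ws \<subseteq> J" "u = word_perm ws" using assms(1) by (auto simp: parabolic_def)
  then show ?thesis using assms(2) unfolding parabolic_def
    by (auto simp: word_perm_append intro!: exI[of _ "ws @ [j]"])
qed

lemma parabolic_permutes: "J \<subseteq> {1..<n} \<Longrightarrow> u \<in> parabolic J \<Longrightarrow> u permutes {1..n}"
  unfolding parabolic_def by (auto intro: word_perm_permutes)

lemma parabolic_wt:
  assumes "finite D" "J \<inter> D = {}" "u \<in> parabolic J"
  shows "wt D (u k) = wt D k"
proof -
  have "set ws \<subseteq> J \<Longrightarrow> wt D (word_perm ws k) = wt D k" for ws
    using assms(1,2) by (induction ws) (auto simp: wt_sw disjoint_iff)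
  then show ?thesis using assms(3) by (auto simp: parabolic_def)
qed

text \<open>Pairs of positions in one block of the parabolic subgroup, which is the largest possible
  inversion set inside it.\<close>

definition block_pairs :: "nat \<Rightarrow> nat set \<Rightarrow> (nat \<times> nat) set" where
  "block_pairs n J = {(p, q). 1 \<le> p \<and> p < q \<and> q \<le> n \<and> {p..<q} \<subseteq> J}"

text \<open>Elements of the subgroup preserve the weight for the complement of J, and two positions
  separated by a member of that complement have different weights, hence keep their order.\<close>

lemma inversions_parabolic:
  assumes J: "J \<subseteq> {1..<n}" and u: "u \<in> parabolic J"
  shows "inversions n u \<subseteq> block_pairs n J"
proof clarify
  fix p q assume pq: "(p, q) \<in> inversions n u"
  let ?D = "{1..<n} - J"
  have wt: "wt ?D (u k) = wt ?D k" for k by (rule parabolic_wt[OF _ _ u]) auto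
  have "{p..<q} \<subseteq> J"
  proof
    fix j assume "j \<in> {p..<q}"
    show "j \<in> J"
    proof (rule ccontr)
      assume "j \<notin> J"
      then have "wt ?D q < wt ?D p"
        using pq \<open>j \<in> {p..<q}\<close> by (intro wt_less[of _ j]) (auto simp: inversions_def)
      then have "u p < u q" using wt wt_less_imp[of ?D "u q" "u p"] by simp
      then show False using pq by (simp add: inversions_def)
    qed
  qed
  then show "(p, q) \<in> block_pairs n J" using pq by (simp add: block_pairs_def inversions_def)
qed

lemma block_pairs_subset_inversions:
  assumes "J \<subseteq> desc n w"
  shows "block_pairs n J \<subseteq> inversions n w"
proof clarify
  fix p q assume pq: "(p, q) \<in> block_pairs n J"
  have "p < q \<Longrightarrow> {p..<q} \<subseteq> J \<Longrightarrow> w q < w p"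
  proof (induction q)
    case (Suc q)
    then have "q \<in> {p..<Suc q}" by simp
    then have "q \<in> desc n w" using Suc.prems assms by blast
    then have "w (Suc q) < w q" by (simp add: desc_def)
    moreover have "{p..<q} \<subseteq> {p..<Suc q}" by auto
    then have "p = q \<or> w q < w p" using Suc by (meson less_SucE order_trans)
    ultimately show ?case by auto
  qed simp
  then show "(p, q) \<in> inversions n w" using pq by (auto simp: block_pairs_def inversions_def)
qed

text \<open>Lengths are bounded, so a maximum exists. At a maximum every j in J is a descent, since
  otherwise \<open>w \<circ> sw j\<close> would be longer; hence its inversions are all block pairs.
  Two maxima then share their inversion set and coincide, which justifies the definite description
  in \<open>longest\<close>.\<close>

lemma longest:
  assumes J: "J \<subseteq> {1..<n}"
  shows longest_in_parabolic: "longest n J \<in> parabolic J"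
    and inversions_longest: "inversions n (longest n J) = block_pairs n J"
    and longest_max: "\<And>u. u \<in> parabolic J \<Longrightarrow> perm_len n u \<le> perm_len n (longest n J)"
proof -
  define P where "P w \<longleftrightarrow> w \<in> parabolic J \<and> (\<forall>u\<in>parabolic J. perm_len n u \<le> perm_len n w)" for w
  have bound: "perm_len n u < Suc (card ({1..n} \<times> {1..n}))" for u
    unfolding perm_len_inversions less_Suc_eq_le
    by (rule card_mono) (auto simp: inversions_def)
  have ex: "\<exists>w. P w"
    unfolding P_def using ex_has_greatest_nat[of "\<lambda>u. u \<in> parabolic J" id "perm_len n"]
    parabolic_Nil bound by blast
  have inv: "inversions n w = block_pairs n J" if "P w" for w
  proof
    have w: "w permutes {1..n}" using that J by (auto simp: P_def intro: parabolic_permutes)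
    show "inversions n w \<subseteq> block_pairs n J"
      using that J by (intro inversions_parabolic) (auto simp: P_def)
    show "block_pairs n J \<subseteq> inversions n w"
    proof (rule block_pairs_subset_inversions, rule subsetI)
      fix j assume j: "j \<in> J"
      then have jn: "j \<in> {1..<n}" using J by auto
      have "\<not> w j < w (Suc j)"
        using perm_len_right_up[OF w jn] parabolic_comp_sw[of w J j] that j
        unfolding P_def by (metis Suc_n_not_le_n)
      moreover have "w j \<noteq> w (Suc j)" using permutes_inverses(2)[OF w] by (metis n_not_Suc_n)
      ultimately show "j \<in> desc n w" using jn by (auto simp: desc_def)
    qed
  qed
  have uniq: "w = v" if "P w" "P v" for w v
    using that inv J by (intro inversions_inject[of w n v]) (auto simp: P_def intro: parabolic_permutes)
  have "P (longest n J)"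
    unfolding longest_def P_def[symmetric] using ex uniq by (metis theI)
  then show "longest n J \<in> parabolic J" "inversions n (longest n J) = block_pairs n J"
    "\<And>u. u \<in> parabolic J \<Longrightarrow> perm_len n u \<le> perm_len n (longest n J)"
    using inv by (auto simp: P_def)
qed

lemma desc_longest:
  assumes J: "J \<subseteq> {1..<n}"
  shows "desc n (longest n J) = J"
proof -
  have "{j..<Suc j} = {j}" for j :: nat by auto
  then have 1: "(j, Suc j) \<in> block_pairs n J \<longleftrightarrow> j \<in> {1..<n} \<and> j \<in> J" for j
    by (simp add: block_pairs_def Suc_le_eq)
  have "desc n (longest n J) = {j. (j, Suc j) \<in> inversions n (longest n J)}"
    by (auto simp: desc_def inversions_def)
  also have "\<dots> = {j. j \<in> {1..<n} \<and> j \<in> J}"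
    by (simp only: inversions_longest[OF J] 1)
  also have "\<dots> = J" using J by blast
  finally show ?thesis .
qed

text \<open>Equal weights of the positions of every value mean that \<open>inv w \<circ> u\<close>
  moves positions only within blocks, so the support is the left coset of w modulo the parabolic
  subgroup complementary to D.\<close>

definition hcoset :: "nat \<Rightarrow> nat set \<Rightarrow> (nat \<Rightarrow> nat) \<Rightarrow> ('a::field) hecke" where
  "hcoset n D w =
    (\<lambda>u. if u permutes {1..n} \<and> (\<forall>k. wt D (inv u k) = wt D (inv w k)) then 1 else 0)"


lemma T_hecke_apply:
  assumes "i \<in> {1..<n}"
  shows "T_hecke n i f u =
    (if u permutes {1..n} \<and> inv u (Suc i) < inv u i then f (sw i \<circ> u) - f u else 0)"
  using assms by (auto simp: T_hecke_def perm_len_sw_less_iff)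

lemma all_sw_iff: "(\<forall>k. P (sw i k)) \<longleftrightarrow> (\<forall>k. P k)"
  by (metis sw_sw)

text \<open>\<open>T_hecke n i\<close> looks only at those u in which i+1 stands left of i, and
  subtracts there the value at u from the value at \<open>sw i \<circ> u\<close>. If the two
  positions in w have different weights, this order is the same throughout the coset and opposite in
  the coset of \<open>sw i \<circ> w\<close>, so one of the two terms vanishes. If the weights
  agree, the coset is stable under \<open>sw i\<close> and the terms cancel.\<close>

lemma
  assumes w: "w permutes {1..n}" and i: "i \<in> {1..<n}" and D: "finite D"
  shows T_hcoset_up: "wt D (inv w (Suc i)) < wt D (inv w i) \<Longrightarrow>
      T_hecke n i (hcoset n D w) = (hcoset n D (sw i \<circ> w) :: 'a::field hecke)"
    and T_hcoset_eq: "wt D (inv w (Suc i)) = wt D (inv w i) \<Longrightarrow>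
      T_hecke n i (hcoset n D w) = (\<lambda>u. 0 :: 'a)"
    and T_hcoset_down: "wt D (inv w i) < wt D (inv w (Suc i)) \<Longrightarrow>
      T_hecke n i (hcoset n D w) = (\<lambda>u. - (hcoset n D w u :: 'a))"
proof -
  define X where "X u \<longleftrightarrow> (\<forall>k. wt D (inv u k) = wt D (inv w (sw i k)))" for u
  define Y where "Y u \<longleftrightarrow> (\<forall>k. wt D (inv u k) = wt D (inv w k))" for u
  have E1: "hcoset n D w = (\<lambda>u. if u permutes {1..n} \<and> Y u then 1 else (0::'a))"
    by (simp add: hcoset_def Y_def)
  have E2: "hcoset n D (sw i \<circ> w) = (\<lambda>u. if u permutes {1..n} \<and> X u then 1 else (0::'a))"
    by (simp add: hcoset_def X_def inv_sw_comp_apply[OF w])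
  have Ysw: "Y (sw i \<circ> u) \<longleftrightarrow> X u" if "u permutes {1..n}" for u
    unfolding X_def Y_def inv_sw_comp_apply[OF that]
    by (subst all_sw_iff[symmetric, of _ i]) simp
  have T: "T_hecke n i (hcoset n D w) u =
      (if u permutes {1..n} \<and> inv u (Suc i) < inv u i
       then (if X u then 1 else 0) - (if Y u then 1 else (0::'a)) else 0)" for u
    using sw_comp_permutes[OF i, of u] i by (simp add: T_hecke_apply E1 Ysw)
  have Xe: "wt D (inv u i) = wt D (inv w (Suc i))" "wt D (inv u (Suc i)) = wt D (inv w i)" if "X u" for u
    using that unfolding X_def by (metis sw_simps(1), metis sw_simps(2))
  have Ye: "wt D (inv u i) = wt D (inv w i)" "wt D (inv u (Suc i)) = wt D (inv w (Suc i))" if "Y u" for u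
    using that unfolding Y_def by auto
  note wl = wt_less_imp[OF D]
  {
    assume l: "wt D (inv w (Suc i)) < wt D (inv w i)"
    have "X u \<Longrightarrow> inv u (Suc i) < inv u i" for u using wl Xe l by metis
    moreover have "Y u \<Longrightarrow> \<not> inv u (Suc i) < inv u i" for u using wl Ye l by (metis less_not_sym)
    ultimately show "T_hecke n i (hcoset n D w) = (hcoset n D (sw i \<circ> w) :: 'a hecke)"
      by (intro ext) (auto simp: T E2)
  next
    assume l: "wt D (inv w (Suc i)) = wt D (inv w i)"
    then have "wt D (inv w (sw i k)) = wt D (inv w k)" for k
      by (cases "k = i"; cases "k = Suc i") auto
    then have "X u \<longleftrightarrow> Y u" for u by (simp add: X_def Y_def)
    then show "T_hecke n i (hcoset n D w) = (\<lambda>u. 0 :: 'a)"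
      by (intro ext) (simp add: T)
  next
    assume l: "wt D (inv w i) < wt D (inv w (Suc i))"
    have "X u \<Longrightarrow> \<not> inv u (Suc i) < inv u i" for u using wl Xe l by (metis less_not_sym)
    moreover have "Y u \<Longrightarrow> inv u (Suc i) < inv u i" for u using wl Ye l by metis
    ultimately show "T_hecke n i (hcoset n D w) = (\<lambda>u. - (hcoset n D w u :: 'a))"
      by (intro ext) (unfold T, auto simp: E1)
  }
qed

lemma foldr_T_hcoset:
  assumes "finite D"
  shows "reduced n ws \<Longrightarrow> desc n (word_perm ws) \<subseteq> D \<Longrightarrow>
    foldr (T_hecke n) ws (hcoset n D id) = (hcoset n D (word_perm ws) :: 'a::field hecke)"
proof (induction ws)
  case (Cons i ws)
  note d = reduced_Cons_wt[OF Cons.prems assms]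
  have r: "reduced n ws" and i: "i \<in> {1..<n}" using Cons.prems(1) by (auto simp: reduced_Cons_iff)
  then have w: "word_perm ws permutes {1..n}" by (simp add: reduced_def word_perm_permutes)
  have "foldr (T_hecke n) (i # ws) (hcoset n D id) =
      T_hecke n i (foldr (T_hecke n) ws (hcoset n D id :: 'a hecke))"
    by (simp only: foldr.simps comp_apply)
  also have "\<dots> = hcoset n D (sw i \<circ> word_perm ws)"
    using T_hcoset_up[OF w i assms d(2)] by (simp only: Cons.IH[OF r d(1)])
  finally show ?case by (simp only: word_perm_Cons)
qed simp

section \<open>The operators T_i + 1 and the generator of P_D\<close>

definition T'_hecke :: "nat \<Rightarrow> nat \<Rightarrow> ('a::field) hecke \<Rightarrow> 'a hecke" where
  "T'_hecke n i x = (\<lambda>u. T_hecke n i x u + x u)"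

lemma Tw'_hecke_foldr: "Tw'_hecke n w v = foldr (T'_hecke n) (reduced_word n w) v"
  by (simp add: Tw'_hecke_def T'_hecke_def[abs_def])

lemma T'_hecke_apply:
  assumes "i \<in> {1..<n}"
  shows "T'_hecke n i f u =
    (if u permutes {1..n} \<and> inv u (Suc i) < inv u i then f (sw i \<circ> u) else f u)"
  using assms by (simp add: T'_hecke_def T_hecke_apply)

text \<open>Both sides evaluate x at the shortest element that can be reached from u by left
  multiplication with \<open>sw i\<close> and \<open>sw (Suc i)\<close>. The six cases are the
  relative orders of the positions of i, i+1 and i+2.\<close>

lemma braid_ops_T'_hecke: "braid_ops n (T'_hecke n :: nat \<Rightarrow> ('a::field) hecke \<Rightarrow> 'a hecke)"
  unfolding braid_ops_def
proof (intro conjI ballI allI impI)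
  fix i j and x :: "'a hecke"
  assume i: "i \<in> {1..<n}" and j: "j \<in> {1..<n}" and ij: "Suc i < j"
  show "T'_hecke n i (T'_hecke n j x) = T'_hecke n j (T'_hecke n i x)"
  proof (rule ext)
    fix u
    show "T'_hecke n i (T'_hecke n j x) u = T'_hecke n j (T'_hecke n i x) u"
    proof (cases "u permutes {1..n}")
      case True
      have c: "sw j \<circ> (sw i \<circ> u) = sw i \<circ> (sw j \<circ> u)" using ij by (auto simp: sw_def)
      show ?thesis
        using True ij i j by (simp add: T'_hecke_apply sw_comp_permutes inv_sw_comp_apply[OF True] c
            del: atLeastLessThan_iff)
    qed (use i j in \<open>simp add: T'_hecke_apply\<close>)
  qed
next
  fix i and x :: "'a hecke"
  assume i: "i \<in> {1..<n}" and "Suc i < n"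
  then have j: "Suc i \<in> {1..<n}" by auto
  show "T'_hecke n i (T'_hecke n (Suc i) (T'_hecke n i x)) =
      T'_hecke n (Suc i) (T'_hecke n i (T'_hecke n (Suc i) x))"
  proof (rule ext)
    fix u
    show "T'_hecke n i (T'_hecke n (Suc i) (T'_hecke n i x)) u =
        T'_hecke n (Suc i) (T'_hecke n i (T'_hecke n (Suc i) x)) u"
    proof (cases "u permutes {1..n}")
      case True
      have c: "sw (Suc i) \<circ> (sw i \<circ> (sw (Suc i) \<circ> u)) = sw i \<circ> (sw (Suc i) \<circ> (sw i \<circ> u))"
        by (auto simp: sw_def)
      have inv2: "inv (sw k \<circ> (sw l \<circ> u)) m = inv u (sw l (sw k m))"
        if "l \<in> {1..<n}" for k l m
        using inv_sw_comp_apply[OF sw_comp_permutes[OF that True]] inv_sw_comp_apply[OF True] by simp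
      have ne: "inv u i \<noteq> inv u (Suc i)" "inv u (Suc i) \<noteq> inv u (Suc (Suc i))"
        "inv u i \<noteq> inv u (Suc (Suc i))"
        by (rule inv_permutes_neq[OF True]; simp)+
      consider "inv u i < inv u (Suc i)" "inv u (Suc i) < inv u (Suc (Suc i))"
        | "inv u i < inv u (Suc (Suc i))" "inv u (Suc (Suc i)) < inv u (Suc i)"
        | "inv u (Suc i) < inv u i" "inv u i < inv u (Suc (Suc i))"
        | "inv u (Suc i) < inv u (Suc (Suc i))" "inv u (Suc (Suc i)) < inv u i"
        | "inv u (Suc (Suc i)) < inv u i" "inv u i < inv u (Suc i)"
        | "inv u (Suc (Suc i)) < inv u (Suc i)" "inv u (Suc i) < inv u i"
        using ne by linarith
      then show ?thesis
        by cases (use True i j in \<open>simp_all add: T'_hecke_apply sw_comp_permutes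
          inv_sw_comp_apply[OF True] inv2 c sw_def[of i "Suc (Suc i)"] sw_def[of "Suc i" i]
          del: atLeastLessThan_iff\<close>)
    qed (use i j in \<open>simp add: T'_hecke_apply\<close>)
  qed
qed

lemma wt_fixed_left_descent:
  assumes "finite D" and u: "\<And>k. wt D (inv u k) = wt D k" and "inv u (Suc i) < inv u i"
  shows "i \<notin> D"
proof
  assume "i \<in> D"
  then have "wt D (Suc i) < wt D i" using assms(1) by (intro wt_less[of _ i]) auto
  then show False using u wt_less_imp[OF assms(1), of "inv u (Suc i)" "inv u i"] assms(3) by simp
qed

text \<open>\<open>reduced_word\<close> picks letters from the whole of \<open>{1..<n}\<close>. This
  confines them to the parabolic subgroup: by \<open>wt_fixed_left_descent\<close> the first letter
  is not in D, and removing it keeps the weights fixed.\<close>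

lemma reduced_wt_fixed_subset:
  assumes "finite D"
  shows "reduced n ws \<Longrightarrow> (\<And>k. wt D (inv (word_perm ws) k) = wt D k) \<Longrightarrow> set ws \<inter> D = {}"
proof (induction ws)
  case (Cons i ws)
  have i: "i \<notin> D"
    using wt_fixed_left_descent[OF assms Cons.prems(2)] reduced_Cons_descent[OF Cons.prems(1)] by blast
  have r: "reduced n ws" using Cons.prems(1) by (simp add: reduced_Cons_iff)
  then have w: "word_perm ws permutes {1..n}" by (simp add: reduced_def word_perm_permutes)
  have "wt D (inv (word_perm ws) k) = wt D k" for k
    using Cons.prems(2)[of "sw i k"] unfolding word_perm_Cons inv_sw_comp_apply[OF w] sw_sw
    by (simp add: wt_sw[OF assms i])
  then show ?case using Cons.IH r i by auto
qed simp

text \<open>\<open>T'\<^sub>i\<close> replaces the value at \<open>u\<close> by that at the shorter of \<open>u\<close>, \<open>s\<^sub>i u\<close>; hence an element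
  fixed by all \<open>T'\<^sub>j\<close> with \<open>j \<notin> D\<close> is constant on the parabolic subgroup.\<close>
lemma Tw'_hecke_longest:
  assumes D: "D \<subseteq> {1..<n}"
  shows "Tw'_hecke n (longest n ({1..<n} - D)) hecke_one = (hcoset n D id :: 'a::field hecke)"
proof -
  define J where "J = {1..<n} - D"
  define w where "w = longest n J"
  define v where "v = foldr (T'_hecke n) (reduced_word n w) (hecke_one :: 'a hecke)"
  have fin: "finite D" using D finite_subset by blast
  have J: "J \<subseteq> {1..<n}" "J \<inter> D = {}" by (auto simp: J_def)
  have wJ: "w \<in> parabolic J" unfolding w_def by (rule longest_in_parabolic[OF J(1)])
  then have w: "w permutes {1..n}" by (rule parabolic_permutes[OF J(1)])
  note rw = reduced_word[OF w]
  have wfix: "wt D (inv w k) = wt D k" for k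
    using parabolic_wt[OF fin J(2) wJ, of "inv w k"] permutes_inverses(1)[OF w] by simp
  have letters: "set (reduced_word n w) \<subseteq> J"
    using reduced_wt_fixed_subset[OF fin rw(1)] wfix rw unfolding reduced_def J_def by auto
  have v_id: "v id = 1"
  proof -
    have "set ws \<subseteq> {1..<n} \<Longrightarrow> foldr (T'_hecke n) ws (hecke_one :: 'a hecke) id = 1" for ws
      by (induction ws) (auto simp: T'_hecke_apply hecke_one_def)
    then show ?thesis using letters J(1) unfolding v_def by blast
  qed
  have v_0: "v u = 0" if "\<not> (u permutes {1..n} \<and> (\<forall>k. wt D (inv u k) = wt D k))" for u
  proof -
    have "set ws \<subseteq> J \<Longrightarrow> \<not> (u permutes {1..n} \<and> (\<forall>k. wt D (inv u k) = wt D k)) \<Longrightarrow>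
        foldr (T'_hecke n) ws (hecke_one :: 'a hecke) u = 0" for ws u
    proof (induction ws arbitrary: u)
      case Nil then show ?case by (auto simp: hecke_one_def permutes_id)
    next
      case (Cons i ws)
      have i: "i \<in> {1..<n}" "i \<notin> D" using Cons.prems(1) J by auto
      have "\<not> (\<forall>k. wt D (inv (sw i \<circ> u) k) = wt D k)" if "u permutes {1..n}"
        using Cons.prems(2) that wt_sw[OF fin i(2)] unfolding inv_sw_comp_apply[OF that]
        by (metis sw_sw)
      then show ?case using Cons i by (simp add: T'_hecke_apply del: atLeastLessThan_iff)
    qed
    then show ?thesis using that letters unfolding v_def by blast
  qed
  have v_sw: "v (sw j \<circ> u) = v u"
    if j: "j \<in> J" and u: "u permutes {1..n}" and d: "inv u (Suc j) < inv u j" for j u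
  proof -
    have jn: "j \<in> {1..<n}" using j J by auto
    have "\<not> inv w j < inv w (Suc j)"
      using longest_max[OF J(1) parabolic_sw_comp[OF wJ j]] perm_len_sw_up[OF w jn]
      unfolding w_def[symmetric] by auto
    then have "inv w (Suc j) < inv w j" using inv_permutes_neq[OF w, of j "Suc j"] by auto
    \<comment> \<open>By maximality j is a left descent of the longest element, so the word may be
      taken to start with j. Being in the image of \<open>T'_hecke n j\<close>, v cannot distinguish
      u from \<open>sw j \<circ> u\<close>.\<close>
    then have "v = T'_hecke n j (foldr (T'_hecke n) (reduced_word n (sw j \<circ> w)) hecke_one)"
      unfolding v_def
      using foldr_reduced_word_left[OF braid_ops_T'_hecke sw_comp_permutes[OF jn w] jn]
      by (simp add: inv_sw_comp_apply[OF w])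
    then obtain y where y: "v = T'_hecke n j y" by blast
    show ?thesis
      using u d sw_comp_permutes[OF jn u]
      by (simp add: y T'_hecke_apply[OF jn] inv_sw_comp_apply[OF u])
  qed
  have v_1: "u permutes {1..n} \<Longrightarrow> (\<forall>k. wt D (inv u k) = wt D k) \<Longrightarrow> v u = 1" for u
  proof (induction "perm_len n u" arbitrary: u rule: less_induct)
    case less
    show ?case
    proof (cases "u = id")
      case True then show ?thesis using v_id by simp
    next
      case False
      then obtain i where i: "i \<in> {1..<n}" and d: "inv u (Suc i) < inv u i"
        using ex_left_descent less.prems(1) by blast
      have iD: "i \<notin> D" using wt_fixed_left_descent[OF fin _ d] less.prems(2) by blast
      have "v (sw i \<circ> u) = 1"
        using less.hyps[of "sw i \<circ> u"] perm_len_sw_down[OF less.prems(1) i d]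
          sw_comp_permutes[OF i less.prems(1)] less.prems(2) wt_sw[OF fin iD]
        by (simp add: inv_sw_comp_apply[OF less.prems(1)])
      then show ?thesis using v_sw[OF _ less.prems(1) d] i iD by (simp add: J_def)
    qed
  qed
  have "v = hcoset n D id"
    using v_0 v_1 by (intro ext) (auto simp: hcoset_def)
  then show ?thesis by (simp add: Tw'_hecke_foldr v_def w_def J_def)
qed

lemma proj_gen_eq:
  assumes D: "D \<subseteq> {1..<n}"
  shows "proj_gen n D = (hcoset n D (longest n D) :: 'a::field hecke)"
proof -
  have fin: "finite D" using D finite_subset by blast
  have w: "longest n D permutes {1..n}"
    by (rule parabolic_permutes[OF D longest_in_parabolic[OF D]])
  show ?thesis
    using foldr_T_hcoset[OF fin, of n "reduced_word n (longest n D)"] reduced_word[OF w]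
    by (simp add: proj_gen_def Tw_hecke_def Tw'_hecke_longest[OF D] desc_longest[OF D])
qed

section \<open>The coset basis of P_D\<close>

definition desc_class :: "nat \<Rightarrow> nat set \<Rightarrow> (nat \<Rightarrow> nat) set" where
  "desc_class n D = {w. w permutes {1..n} \<and> desc n w = D}"

lemma desc_classD: "w \<in> desc_class n D \<Longrightarrow> w permutes {1..n}" "w \<in> desc_class n D \<Longrightarrow> desc n w = D"
  by (auto simp: desc_class_def)

lemma finite_desc_class [simp]: "finite (desc_class n D)"
  by (rule finite_subset[OF _ finite_permutations[of "{1..n}"]]) (auto simp: desc_class_def)

lemma finite_desc: "finite (desc n w)"
  by (simp add: desc_def)

text \<open>A member of the class increases inside every block, hence is the sorted, that is
  shortest, representative of its coset. Values at members of the class therefore read off the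
  coefficients of a combination of these functions.\<close>

lemma hcoset_eval:
  assumes w: "w \<in> desc_class n D" and v: "v \<in> desc_class n D"
  shows "hcoset n D w v = (if v = w then 1 else 0 :: 'a::field)"
proof -
  note p = desc_classD[OF w] desc_classD[OF v]
  have fin: "finite D" using p finite_desc by metis
  have s: "sorts n (\<lambda>k. wt D (inv w k)) w" "sorts n (\<lambda>k. wt D (inv v k)) v"
    by (rule sorts_comp_inv; use p fin in \<open>auto intro: wt_antimono wt_less\<close>)+
  have "v = w" if "\<forall>k. wt D (inv v k) = wt D (inv w k)"
    using s that sorts_unique[OF p(3,1)] by simp
  then show ?thesis using p by (auto simp: hcoset_def)
qed

text \<open>Turns the relative position of i and i+1 in w into the comparison of weights on which
  the rules for \<open>hcoset\<close> depend. In the last case the new permutation stays in the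
  class, which closes the span under the action.\<close>

lemma
  assumes w: "w \<in> desc_class n D" and i: "i \<in> {1..<n}"
  shows desc_class_down: "inv w (Suc i) < inv w i \<Longrightarrow> wt D (inv w i) < wt D (inv w (Suc i))"
    and desc_class_adjacent: "inv w (Suc i) = Suc (inv w i) \<Longrightarrow>
      inv w i \<notin> D \<and> wt D (inv w (Suc i)) = wt D (inv w i)"
    and desc_class_up: "inv w i < inv w (Suc i) \<Longrightarrow> inv w (Suc i) \<noteq> Suc (inv w i) \<Longrightarrow>
      sw i \<circ> w \<in> desc_class n D \<and> wt D (inv w (Suc i)) < wt D (inv w i)"
proof -
  note p = desc_classD[OF w]
  have fin: "finite D" using p finite_desc by metis
  have wi: "w (inv w k) = k" for k using permutes_inverses(1)[OF p(1)] .
  have r: "inv w i \<in> {1..n}" "inv w (Suc i) \<in> {1..n}"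
    using inv_permutes_in[OF p(1), of i] inv_permutes_in[OF p(1), of "Suc i"] i by auto
  {
    assume d: "inv w (Suc i) < inv w i"
    have "\<exists>j\<in>desc n w. inv w (Suc i) \<le> j \<and> j < inv w i"
      by (rule inversion_imp_desc) (use r d wi in auto)
    then show "wt D (inv w i) < wt D (inv w (Suc i))" using p(2) wt_less[OF fin] by blast
  next
    assume a: "inv w (Suc i) = Suc (inv w i)"
    have "inv w i \<notin> D" using desc_sw_adjacent(3)[OF p(1) i a] p(2) by (auto simp: desc_def)
    then show "inv w i \<notin> D \<and> wt D (inv w (Suc i)) = wt D (inv w i)"
      using wt_Suc[OF fin, of "inv w i"] a by simp
  next
    assume u: "inv w i < inv w (Suc i)" and a: "inv w (Suc i) \<noteq> Suc (inv w i)"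
    have "desc n (sw i \<circ> w) = D" using desc_sw_nonadjacent[OF p(1) i a] u p(2) by simp
    moreover have "wt D (inv w (Suc i)) < wt D (inv w i)"
      using ex_desc_between[OF p(1) i u a] p(2) wt_less[OF fin] by blast
    ultimately show "sw i \<circ> w \<in> desc_class n D \<and> wt D (inv w (Suc i)) < wt D (inv w i)"
      using sw_comp_permutes[OF i p(1)] by (simp add: desc_class_def)
  }
qed

lemma T_hecke_sum:
  "T_hecke n i (\<lambda>u. \<Sum>w\<in>W. a w * F w u) = (\<lambda>u. \<Sum>w\<in>W. a w * T_hecke n i (F w) u)"
  by (rule ext) (auto simp: T_hecke_def sum_subtractf right_diff_distrib)

abbreviation coset_comb :: "nat \<Rightarrow> nat set \<Rightarrow> ((nat \<Rightarrow> nat) \<Rightarrow> 'a) \<Rightarrow> ('a::field) hecke" where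
  "coset_comb n D a u \<equiv> (\<Sum>w\<in>desc_class n D. a w * hcoset n D w u)"

definition proj_span :: "nat \<Rightarrow> nat set \<Rightarrow> ('a::field) hecke set" where
  "proj_span n D = {\<lambda>u. coset_comb n D a u | a. True}"

lemma proj_spanI: "(\<lambda>u. coset_comb n D a u) \<in> proj_span n D"
  by (auto simp: proj_span_def)

lemma proj_span_add:
  assumes "x \<in> proj_span n D" "y \<in> proj_span n D"
  shows "(\<lambda>u. x u + y u) \<in> proj_span n D"
proof -
  obtain a b where "x = (\<lambda>u. coset_comb n D a u)"
    "y = (\<lambda>u. coset_comb n D b u)"
    using assms by (auto simp: proj_span_def)
  then have "(\<lambda>u. x u + y u) = (\<lambda>u. \<Sum>w\<in>desc_class n D. (a w + b w) * hcoset n D w u)"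
    by (simp add: sum.distrib distrib_right)
  then show ?thesis using proj_spanI[of "\<lambda>w. a w + b w" n D] by (simp only:)
qed

lemma proj_span_scale:
  assumes "x \<in> proj_span n D"
  shows "(\<lambda>u. c * x u) \<in> proj_span n D"
proof -
  obtain a where "x = (\<lambda>u. coset_comb n D a u)"
    using assms by (auto simp: proj_span_def)
  then have "(\<lambda>u. c * x u) = (\<lambda>u. \<Sum>w\<in>desc_class n D. (c * a w) * hcoset n D w u)"
    by (simp add: sum_distrib_left mult.assoc)
  then show ?thesis using proj_spanI[of "\<lambda>w. c * a w" n D] by (simp only:)
qed

lemma proj_span_0: "(\<lambda>u. 0) \<in> proj_span n D"
  using proj_spanI[of "\<lambda>w. 0" n D] by simp

lemma lincomb_closed:
  fixes S :: "('a::field) hecke set"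
  assumes "(\<lambda>_. 0) \<in> S" "\<And>x y. x \<in> S \<Longrightarrow> y \<in> S \<Longrightarrow> (\<lambda>u. x u + y u) \<in> S"
    "\<And>c x. x \<in> S \<Longrightarrow> (\<lambda>u. c * x u) \<in> S" "finite W" "\<And>w. w \<in> W \<Longrightarrow> F w \<in> S"
  shows "(\<lambda>u. \<Sum>w\<in>W. a w * F w u) \<in> S"
  using assms(4,5)
proof (induction W rule: finite_induct)
  case (insert w W)
  have "(\<lambda>u. a w * F w u + (\<Sum>w\<in>W. a w * F w u)) \<in> S"
    by (rule assms(2)[OF assms(3)]) (use insert in auto)
  then show ?case using insert.hyps by simp
qed (simp add: assms(1))

lemma hcoset_in_proj_span:
  assumes "w \<in> desc_class n D"
  shows "hcoset n D w \<in> (proj_span n D :: 'a::field hecke set)"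
proof -
  have eq: "(\<lambda>u. \<Sum>v\<in>desc_class n D. (if v = w then 1 else 0) * hcoset n D v u) =
      (hcoset n D w :: 'a hecke)"
    using assms by (auto simp: if_distrib[of "\<lambda>x. x * _"] cong: if_cong)
  show ?thesis by (subst eq[symmetric]) (rule proj_spanI)
qed

lemma T_hcoset_in_proj_span:
  assumes w: "w \<in> desc_class n D" and i: "i \<in> {1..<n}"
  shows "T_hecke n i (hcoset n D w) \<in> (proj_span n D :: 'a::field hecke set)"
proof -
  note p = desc_classD[OF w]
  have fin: "finite D" using p finite_desc by metis
  have "inv w i \<noteq> inv w (Suc i)" by (rule inv_permutes_neq[OF p(1)]) simp
  then consider "inv w (Suc i) < inv w i" | "inv w (Suc i) = Suc (inv w i)"
    | "inv w i < inv w (Suc i)" "inv w (Suc i) \<noteq> Suc (inv w i)" by linarith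
  then show ?thesis
  proof cases
    case 1
    then show ?thesis
      using T_hcoset_down[OF p(1) i fin, where 'a = 'a] desc_class_down[OF w i]
        proj_span_scale[OF hcoset_in_proj_span[OF w], of "-1 :: 'a"] by simp
  next
    case 2
    then show ?thesis
      using T_hcoset_eq[OF p(1) i fin, where 'a = 'a] desc_class_adjacent[OF w i] proj_span_0
      by metis
  next
    case 3
    then show ?thesis
      using T_hcoset_up[OF p(1) i fin, where 'a = 'a] desc_class_up[OF w i]
        hcoset_in_proj_span by metis
  qed
qed

text \<open>The span is one of the submodules that are intersected. Conversely every submodule
  containing the generator contains the function of each w in the class, by induction on the length:
  above the longest element of the parabolic subgroup of D one can always descend by a letter that
  keeps the descent set, and then return by \<open>T_hcoset_up\<close>.\<close>

lemma proj_mod_eq: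
  assumes D: "D \<subseteq> {1..<n}"
  shows "proj_mod n D = (proj_span n D :: 'a::field hecke set)"
proof
  have fin: "finite D" using D finite_subset by blast
  define w0 where "w0 = longest n D"
  have w0: "w0 permutes {1..n}"
    unfolding w0_def by (rule parabolic_permutes[OF D longest_in_parabolic[OF D]])
  have w0D: "w0 \<in> desc_class n D" using w0 desc_longest[OF D] by (simp add: desc_class_def w0_def)
  have gen: "proj_gen n D = (hcoset n D w0 :: 'a hecke)"
    unfolding w0_def by (rule proj_gen_eq[OF D])
  have "proj_span n D \<subseteq> (hecke_space n :: 'a hecke set)"
    by (auto simp: proj_span_def hecke_space_def hcoset_def)
  moreover have "proj_gen n D \<in> (proj_span n D :: 'a hecke set)"
    unfolding gen by (rule hcoset_in_proj_span[OF w0D])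
  moreover have "T_hecke n i x \<in> proj_span n D" if "i \<in> {1..<n}" "x \<in> proj_span n D"
    for i and x :: "'a hecke"
  proof -
    obtain a where "x = (\<lambda>u. coset_comb n D a u)"
      using \<open>x \<in> proj_span n D\<close> by (auto simp: proj_span_def)
    then have "T_hecke n i x = (\<lambda>u. \<Sum>w\<in>desc_class n D. a w * T_hecke n i (hcoset n D w) u)"
      by (simp only: T_hecke_sum)
    then show ?thesis
      using that(1) by (simp only:)
        (intro lincomb_closed proj_span_0 proj_span_add proj_span_scale finite_desc_class
          T_hcoset_in_proj_span)
  qed
  ultimately show "proj_mod n D \<subseteq> (proj_span n D :: 'a hecke set)"
    unfolding proj_mod_def
    by (intro Inter_lower) (simp add: proj_span_0 proj_span_add proj_span_scale del: atLeastLessThan_iff)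
  show "(proj_span n D :: 'a hecke set) \<subseteq> proj_mod n D"
    unfolding proj_mod_def
  proof (intro Inter_greatest, elim CollectE conjE)
    fix S :: "'a hecke set"
    assume S: "proj_gen n D \<in> S" "(\<lambda>_. 0) \<in> S" "\<forall>x\<in>S. \<forall>y\<in>S. (\<lambda>u. x u + y u) \<in> S"
      "\<forall>c. \<forall>x\<in>S. (\<lambda>u. c * x u) \<in> S" "\<forall>i\<in>{1..<n}. \<forall>x\<in>S. T_hecke n i x \<in> S"
    have "w \<in> desc_class n D \<Longrightarrow> hcoset n D w \<in> S" for w
    proof (induction "perm_len n w" arbitrary: w rule: less_induct)
      case less
      note w = less.prems
      note p = desc_classD[OF w]
      show ?case
      proof (cases "w = w0")
        case True then show ?thesis using S(1) gen by simp
      next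
        case False
        have sub: "inversions n w0 \<subseteq> inversions n w"
          unfolding w0_def inversions_longest[OF D]
          by (rule block_pairs_subset_inversions) (simp add: p)
        obtain i where i: "i \<in> {1..<n}" and d: "inv w (Suc i) < inv w i"
          and out: "(inv w (Suc i), inv w i) \<notin> inversions n w0"
          using ex_left_descent_outside[OF w0 p(1) sub False] by blast
        have r: "inv w i \<in> {1..n}" "inv w (Suc i) \<in> {1..n}"
          using inv_permutes_in[OF p(1), of i] inv_permutes_in[OF p(1), of "Suc i"] i by auto
        \<comment> \<open>If the two positions were neighbours they would form a descent of w, hence
          of \<open>w0\<close>, which has the same descent set. But this pair was chosen outside the
          inversions of \<open>w0\<close>.\<close>
        have ne: "inv w i \<noteq> Suc (inv w (Suc i))"
        proof
          assume a: "inv w i = Suc (inv w (Suc i))"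
          have "w (Suc (inv w (Suc i))) = i" "w (inv w (Suc i)) = Suc i"
            using permutes_inverses(1)[OF p(1)] a by metis+
          then have "inv w (Suc i) \<in> desc n w"
            using r unfolding a by (simp add: desc_def)
          then have "inv w (Suc i) \<in> desc n w0" using p desc_classD[OF w0D] by simp
          then have "(inv w (Suc i), inv w i) \<in> inversions n w0"
            using r a by (simp add: desc_def inversions_def)
          then show False using out by simp
        qed
        define v where "v = sw i \<circ> w"
        have v: "v \<in> desc_class n D"
          using desc_sw_nonadjacent[OF p(1) i] ne d p sw_comp_permutes[OF i p(1)]
          by (simp add: v_def desc_class_def)
        have vi: "inv v k = inv w (sw i k)" for k
          unfolding v_def by (rule inv_sw_comp_apply[OF p(1)])
        have "hcoset n D v \<in> S"
          by (rule less.hyps[OF _ v]) (simp add: perm_len_sw_down[OF p(1) i d] v_def)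
        then have "T_hecke n i (hcoset n D v) \<in> S" using S(5) i by blast
        moreover have "wt D (inv v (Suc i)) < wt D (inv v i)"
          using desc_class_up[OF v i] d ne by (simp add: vi)
        ultimately show ?thesis
          using T_hcoset_up[OF desc_classD(1)[OF v] i fin, where 'a = 'a] by (simp add: v_def)
      qed
    qed
    then show "proj_span n D \<subseteq> S"
      using S lincomb_closed[of S "desc_class n D" "hcoset n D"]
      by (auto simp: proj_span_def)
  qed
qed

section \<open>Demazure operators on polynomials\<close>

abbreviation lookup where "lookup \<equiv> Poly_Mapping.lookup"
abbreviation keys where "keys \<equiv> Poly_Mapping.keys"
abbreviation swap_exp :: "nat \<Rightarrow> (nat \<Rightarrow>\<^sub>0 nat) \<Rightarrow> (nat \<Rightarrow>\<^sub>0 nat)" where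
  "swap_exp i \<equiv> Poly_Mapping.map_key (sw i)"

abbreviation xp :: "(nat \<Rightarrow>\<^sub>0 nat) \<Rightarrow> ('a::field) mpoly" where
  "xp m \<equiv> Poly_Mapping.single m 1"

lemma lookup_const_mult: "lookup (const c * f) m = c * lookup f m"
  unfolding const_def by (simp flip: mult_map_scale_conv_mult add: Poly_Mapping.map.rep_eq when_def)

lemma keys_const_mult: "keys (const c * f) \<subseteq> keys f"
  by (auto simp: in_keys_iff lookup_const_mult)

lemma const_mult_xp: "const c * xp m = Poly_Mapping.single m c"
  by (simp add: const_def mult_single)

lemma poly_sum_xp:
  "f = (\<Sum>m\<in>keys f. const (lookup f m) * xp m)"
proof (rule poly_mapping_eqI)
  fix k
  have "lookup (const (lookup f m) * xp m) k =
      (if k = m then lookup f m else 0)" for m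
    by (simp add: const_mult_xp lookup_single when_def)
  then show "lookup f k =
      lookup (\<Sum>m\<in>keys f. const (lookup f m) * xp m) k"
    by (simp add: lookup_sum in_keys_iff)
qed

lemma poly_induct [case_names zero add monomial]:
  assumes "P 0" "\<And>f g. P f \<Longrightarrow> P g \<Longrightarrow> P (f + g)" "\<And>c m. P (const c * xp m)"
  shows "P f"
proof -
  have "P (\<Sum>m\<in>M. const (c m) * xp m)" if "finite M" for M c
    using that by (induction M rule: finite_induct) (auto intro: assms)
  then show ?thesis by (subst poly_sum_xp) simp
qed

lemma lookup_map_key_sw: "lookup (swap_exp i m) k = lookup m (sw i k)"
proof -
  have "inj (sw i)" by (rule inj_on_inverseI[of _ "sw i"]) simp
  then show ?thesis by (simp add: map_key.rep_eq)
qed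

lemma map_key_sw_sw [simp]: "swap_exp i (swap_exp i m) = m"
  by (rule poly_mapping_eqI) (simp add: lookup_map_key_sw)

lemma inj_map_key_sw: "inj (swap_exp i)"
  by (rule inj_on_inverseI[of _ "swap_exp i"]) simp

lemma map_key_sw_add: "swap_exp i (m + m') =
    swap_exp i m + swap_exp i m'"
  by (rule poly_mapping_eqI) (simp add: lookup_map_key_sw lookup_add)

lemma lookup_swap_poly:
  "lookup (swap_poly i f) m = lookup f (swap_exp i m)"
  by (simp add: swap_poly_def map_key.rep_eq inj_map_key_sw)

lemma swap_poly_add: "swap_poly i (f + g) = swap_poly i f + swap_poly i g"
  by (rule poly_mapping_eqI) (simp add: lookup_swap_poly lookup_add)

lemma swap_poly_minus: "swap_poly i (f - g) = swap_poly i f - swap_poly i g"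
  by (rule poly_mapping_eqI) (simp add: lookup_swap_poly lookup_minus)

lemma swap_poly_0 [simp]: "swap_poly i 0 = 0"
  by (rule poly_mapping_eqI) (simp add: lookup_swap_poly)

lemma swap_poly_swap [simp]: "swap_poly i (swap_poly i f) = f"
  by (rule poly_mapping_eqI) (simp add: lookup_swap_poly)

lemma swap_poly_single:
  "swap_poly i (Poly_Mapping.single m c) = Poly_Mapping.single (swap_exp i m) c"
proof (rule poly_mapping_eqI)
  fix k
  have "m = swap_exp i k \<longleftrightarrow> swap_exp i m = k"
    by (metis map_key_sw_sw)
  then show "lookup (swap_poly i (Poly_Mapping.single m c)) k =
      lookup (Poly_Mapping.single (swap_exp i m) c) k"
    by (simp add: lookup_swap_poly lookup_single)
qed

lemma swap_poly_mult: "swap_poly i (f * g) = swap_poly i f * swap_poly i g"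
proof (induction f rule: poly_induct)
  case (monomial c m)
  show ?case
    by (induction g rule: poly_induct)
       (simp_all add: const_mult_xp mult_single swap_poly_single swap_poly_add map_key_sw_add
          distrib_left)
qed (simp_all add: swap_poly_add distrib_right)

lemma swap_poly_const [simp]: "swap_poly i (const c) = const c"
proof -
  have "swap_exp i (0 :: nat \<Rightarrow>\<^sub>0 nat) = 0"
    by (rule poly_mapping_eqI) (simp add: lookup_map_key_sw)
  then show ?thesis by (simp only: const_def swap_poly_single)
qed

lemma swap_poly_var: "swap_poly i (var j) = var (sw i j)"
proof -
  have "swap_exp i (Poly_Mapping.single j 1) = Poly_Mapping.single (sw i j) (1::nat)"
  proof (rule poly_mapping_eqI)
    fix k
    have "j = sw i k \<longleftrightarrow> sw i j = k" by (metis sw_sw)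
    then show "lookup (swap_exp i (Poly_Mapping.single j 1)) k =
        lookup (Poly_Mapping.single (sw i j) (1::nat)) k"
      by (simp add: lookup_map_key_sw lookup_single)
  qed
  then show ?thesis by (simp add: var_def swap_poly_single)
qed

lemma var_inject: "var i = (var j :: 'a::field mpoly) \<longleftrightarrow> i = j"
proof
  assume "var i = (var j :: 'a mpoly)"
  then have "keys (var i :: 'a mpoly) = keys (var j :: 'a mpoly)" by simp
  then have "Poly_Mapping.single i (1::nat) = Poly_Mapping.single j 1" by (simp add: var_def)
  then have "keys (Poly_Mapping.single i (1::nat)) = keys (Poly_Mapping.single j (1::nat))" by simp
  then show "i = j" by simp
qed simp

lemma var_diff_nonzero: "var i - (var (Suc i) :: 'a::field mpoly) \<noteq> 0"
  by (simp add: var_inject)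

text \<open>Resolves the definite description in \<open>pi_op\<close>: after subtracting f the
  defining equation has this form, and the quotient is unique by cancellation. Most later identities
  for \<open>T_poly\<close> are obtained by multiplying with
  \<open>var i - var (Suc i)\<close>.\<close>

lemma T_poly_eqI:
  fixes f g :: "('a::field) mpoly"
  assumes "(var i - var (Suc i)) * g = var (Suc i) * (f - swap_poly i f)"
  shows "T_poly i f = g"
proof -
  have "pi_op i f = f + g"
    unfolding pi_op_def
  proof (rule the_equality)
    show "(var i - var (Suc i)) * (f + g) = var i * f - var (Suc i) * swap_poly i f"
      using assms by algebra
    fix h assume "(var i - var (Suc i)) * h = var i * f - var (Suc i) * swap_poly i f"
    then have "(var i - var (Suc i)) * h = (var i - var (Suc i)) * (f + g)"
      using assms by algebra
    then show "h = f + g" using var_diff_nonzero[of i, where 'a = 'a] by simp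
  qed
  then show ?thesis by (simp add: T_poly_def)
qed

definition exp_upd :: "(nat \<Rightarrow>\<^sub>0 nat) \<Rightarrow> nat \<Rightarrow> nat \<Rightarrow> nat \<Rightarrow> (nat \<Rightarrow>\<^sub>0 nat)" where
  "exp_upd m i a b = Poly_Mapping.update i a (Poly_Mapping.update (Suc i) b m)"

lemma lookup_exp_upd:
  "lookup (exp_upd m i a b) k =
    (if k = i then a else if k = Suc i then b else lookup m k)"
  by (auto simp: exp_upd_def lookup_update)

lemma var_mult_exp_upd:
  "var i * xp (exp_upd m i a b) = xp (exp_upd m i (Suc a) b)"
  "var (Suc i) * xp (exp_upd m i a b) = xp (exp_upd m i a (Suc b))"
proof -
  have "Poly_Mapping.single i 1 + exp_upd m i a b = exp_upd m i (Suc a) b"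
    "Poly_Mapping.single (Suc i) 1 + exp_upd m i a b = exp_upd m i a (Suc b)"
    by (rule poly_mapping_eqI; simp add: lookup_add lookup_single lookup_exp_upd when_def)+
  then show "var i * xp (exp_upd m i a b) = xp (exp_upd m i (Suc a) b)"
    "var (Suc i) * xp (exp_upd m i a b) = xp (exp_upd m i a (Suc b))"
    by (simp_all add: var_def mult_single)
qed

lemma exp_upd_same [simp]: "exp_upd m i (lookup m i) (lookup m (Suc i)) = m"
  by (rule poly_mapping_eqI) (simp add: lookup_exp_upd)

lemma map_key_sw_exp_upd:
  "swap_exp i m = exp_upd m i (lookup m (Suc i)) (lookup m i)"
  by (rule poly_mapping_eqI) (simp add: lookup_exp_upd lookup_map_key_sw)

text \<open>A telescoping geometric sum along the segment from m to its swap. Here the sum contains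
  the swapped exponent and omits m itself; in the companion case \<open>a < b\<close> it contains m
  and omits the swapped one. This asymmetry lets \<open>T_poly\<close> move the leading
  monomial.\<close>

lemma var_diff_mult_sum_ge:
  assumes a: "a = lookup m i" and b: "b = lookup m (Suc i)" and "b \<le> a"
  shows "(var i - var (Suc i)) * (\<Sum>k<a - b. xp (exp_upd m i (a - Suc k) (b + Suc k))) =
      var (Suc i) * (xp m - swap_poly i (xp m) :: 'a::field mpoly)"
proof -
  define H where "H k = (xp (exp_upd m i (a - k) (b + Suc k)) :: 'a mpoly)" for k
  have "var i * xp (exp_upd m i (a - Suc k) (b + Suc k)) = H k"
    "var (Suc i) * xp (exp_upd m i (a - Suc k) (b + Suc k)) = H (Suc k)" if "k < a - b" for k
    using that by (simp_all add: H_def var_mult_exp_upd Suc_diff_Suc)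
  then have "(var i - var (Suc i)) * (\<Sum>k<a - b. xp (exp_upd m i (a - Suc k) (b + Suc k))) =
      (\<Sum>k<a - b. H k - H (Suc k))"
    by (simp add: sum_distrib_left left_diff_distrib)
  also have "\<dots> = H 0 - H (a - b)" by (rule sum_lessThan_telescope')
  also have "\<dots> = var (Suc i) * (xp (exp_upd m i a b) - xp (exp_upd m i b a))"
    using assms(3) by (simp add: H_def right_diff_distrib var_mult_exp_upd)
  also have "\<dots> = var (Suc i) * (xp m - swap_poly i (xp m))"
    by (simp add: a b swap_poly_single map_key_sw_exp_upd)
  finally show ?thesis .
qed

lemma var_diff_mult_sum_less:
  assumes a: "a = lookup m i" and b: "b = lookup m (Suc i)" and "a < b"
  shows "(var i - var (Suc i)) * - (\<Sum>k<b - a. xp (exp_upd m i (a + k) (b - k))) =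
      var (Suc i) * (xp m - swap_poly i (xp m) :: 'a::field mpoly)"
proof -
  define H where "H k = (xp (exp_upd m i (a + k) (Suc b - k)) :: 'a mpoly)" for k
  have "var i * xp (exp_upd m i (a + k) (b - k)) = H (Suc k)"
    "var (Suc i) * xp (exp_upd m i (a + k) (b - k)) = H k" if "k < b - a" for k
    using that by (simp_all add: H_def var_mult_exp_upd Suc_diff_le)
  then have "(var i - var (Suc i)) * - (\<Sum>k<b - a. xp (exp_upd m i (a + k) (b - k))) =
      (\<Sum>k<b - a. H k - H (Suc k))"
    by (simp add: sum_distrib_left left_diff_distrib flip: sum_negf)
  also have "\<dots> = H 0 - H (b - a)" by (rule sum_lessThan_telescope')
  also have "\<dots> = var (Suc i) * (xp (exp_upd m i a b) - xp (exp_upd m i b a))"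
    using assms(3) by (simp add: H_def right_diff_distrib var_mult_exp_upd Suc_diff_le)
  also have "\<dots> = var (Suc i) * (xp m - swap_poly i (xp m))"
    by (simp add: a b swap_poly_single map_key_sw_exp_upd)
  finally show ?thesis .
qed

lemmas T_poly_xp_ge = T_poly_eqI[OF var_diff_mult_sum_ge]
lemmas T_poly_xp_less = T_poly_eqI[OF var_diff_mult_sum_less]

lemma var_diff_dvd: "(var i - var (Suc i)) dvd (var (Suc i) * (f - swap_poly i f) :: 'a::field mpoly)"
proof (induction f rule: poly_induct)
  case (add f g)
  then show ?case
    using dvd_add[OF add] by (simp add: swap_poly_add algebra_simps)
next
  case (monomial c m)
  have "(var i - var (Suc i)) dvd (var (Suc i) * (xp m - swap_poly i (xp m)) :: 'a mpoly)"
    by (cases "lookup m (Suc i) \<le> lookup m i")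
       (simp_all only: not_le flip: var_diff_mult_sum_ge[OF refl refl] var_diff_mult_sum_less[OF refl refl],
        simp_all)
  then have "(var i - var (Suc i)) dvd const c * (var (Suc i) * (xp m - swap_poly i (xp m)) :: 'a mpoly)"
    by (rule dvd_mult)
  then show ?case by (simp add: swap_poly_mult algebra_simps)
qed simp

lemma T_poly_mult_var_diff:
  "(var i - var (Suc i)) * T_poly i f = (var (Suc i) * (f - swap_poly i f) :: 'a::field mpoly)"
  using var_diff_dvd[of i f] T_poly_eqI[of i _ f] by (metis dvdE)

lemma T_poly_add: "T_poly i (f + g) = T_poly i f + T_poly i g"
  by (rule T_poly_eqI)
    (simp only: distrib_left T_poly_mult_var_diff swap_poly_add, simp add: algebra_simps)

lemma T_poly_mult_symmetric:
  assumes "swap_poly i g = g"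
  shows "T_poly i (f * g) = T_poly i f * g"
proof (rule T_poly_eqI)
  have "(var i - var (Suc i)) * (T_poly i f * g) = ((var i - var (Suc i)) * T_poly i f) * g"
    by (simp only: mult.assoc)
  also have "\<dots> = var (Suc i) * (f * g - swap_poly i (f * g))"
    by (simp only: T_poly_mult_var_diff swap_poly_mult assms) (simp add: algebra_simps)
  finally show "(var i - var (Suc i)) * (T_poly i f * g) = var (Suc i) * (f * g - swap_poly i (f * g))" .
qed

lemma T_poly_const_mult: "T_poly i (const c * f) = const c * T_poly i f"
  using T_poly_mult_symmetric[of i "const c" f] by (simp add: mult.commute)

lemma T_poly_0 [simp]: "T_poly i 0 = 0"
  by (rule T_poly_eqI) simp

lemma T_poly_uminus: "T_poly i (- f) = - T_poly i f"
  using T_poly_add[of i f "- f"] by (simp add: add_eq_0_iff)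

lemma T_poly_minus: "T_poly i (f - g) = T_poly i f - T_poly i g"
  using T_poly_add[of i f "- g"] by (simp add: T_poly_uminus)

lemma T_poly_sum: "T_poly i (\<Sum>x\<in>X. F x) = (\<Sum>x\<in>X. T_poly i (F x))"
  by (induction X rule: infinite_finite_induct) (auto simp: T_poly_add)

text \<open>Equivalent to the invariance of \<open>T_poly i f + f\<close>, which is
  \<open>pi_op i f\<close>, under the swap; the quadratic relation below is a consequence.\<close>

lemma swap_T_poly: "swap_poly i (T_poly i f) = T_poly i f + f - swap_poly i (f :: 'a::field mpoly)"
proof -
  let ?d = "var i - var (Suc i) :: 'a mpoly"
  have 1: "?d * T_poly i f = var (Suc i) * (f - swap_poly i f)" by (rule T_poly_mult_var_diff)
  have "swap_poly i (?d * T_poly i f) = swap_poly i (var (Suc i) * (f - swap_poly i f))"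
    by (simp only: 1)
  then have "?d * swap_poly i (T_poly i f) = var i * (f - swap_poly i f)"
    by (simp add: swap_poly_mult swap_poly_minus swap_poly_var algebra_simps)
  then have "?d * swap_poly i (T_poly i f) = ?d * (T_poly i f + f - swap_poly i f)"
    using 1 by (simp add: algebra_simps)
  then show ?thesis using var_diff_nonzero[of i, where 'a = 'a] by simp
qed

lemma T_poly_T_poly: "T_poly i (T_poly i f) = - T_poly i f"
proof (rule T_poly_eqI)
  have "var (Suc i) * (T_poly i f - swap_poly i (T_poly i f)) = - (var (Suc i) * (f - swap_poly i f))"
    by (simp add: swap_T_poly algebra_simps)
  then show "(var i - var (Suc i)) * - T_poly i f =
      var (Suc i) * (T_poly i f - swap_poly i (T_poly i f))"
    by (simp add: T_poly_mult_var_diff)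
qed

lemma swap_T_poly_far:
  assumes "Suc i < j \<or> Suc j < i"
  shows "swap_poly j (T_poly i f) = T_poly i (swap_poly j f)"
proof (rule T_poly_eqI[symmetric])
  have "swap_poly j (swap_poly i f) = swap_poly i (swap_poly j f)"
  proof (rule poly_mapping_eqI)
    fix k :: "nat \<Rightarrow>\<^sub>0 nat"
    have "sw j (sw i l) = sw i (sw j l)" for l using assms by (auto simp: sw_def)
    then have "swap_exp i (swap_exp j k) =
        swap_exp j (swap_exp i k)"
      by (intro poly_mapping_eqI) (simp add: lookup_map_key_sw)
    then show "lookup (swap_poly j (swap_poly i f)) k =
        lookup (swap_poly i (swap_poly j f)) k" by (simp add: lookup_swap_poly)
  qed
  moreover have "swap_poly j ((var i - var (Suc i)) * T_poly i f) =
      swap_poly j (var (Suc i) * (f - swap_poly i f))" by (simp only: T_poly_mult_var_diff)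
  moreover have "sw j i = i" "sw j (Suc i) = Suc i" using assms by (auto simp: sw_def)
  ultimately show "(var i - var (Suc i)) * swap_poly j (T_poly i f) =
      var (Suc i) * (swap_poly j f - swap_poly i (swap_poly j f))"
    by (simp add: swap_poly_mult swap_poly_minus swap_poly_var)
qed

lemma T_poly_comm:
  assumes "Suc i < j"
  shows "T_poly i (T_poly j f) = T_poly j (T_poly i f)"
proof (rule T_poly_eqI)
  have sym: "swap_poly j (var i - var (Suc i)) = var i - var (Suc i)"
    "swap_poly j (var (Suc i)) = var (Suc i)"
    using assms by (simp_all add: swap_poly_minus swap_poly_var)
  have "(var i - var (Suc i)) * T_poly j (T_poly i f) = T_poly j (T_poly i f * (var i - var (Suc i)))"
    by (simp only: T_poly_mult_symmetric[OF sym(1)] mult.commute)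
  also have "\<dots> = T_poly j ((f - swap_poly i f) * var (Suc i))"
    by (subst (1 2) mult.commute) (simp only: T_poly_mult_var_diff)
  also have "\<dots> = (T_poly j f - T_poly j (swap_poly i f)) * var (Suc i)"
    by (simp only: T_poly_mult_symmetric[OF sym(2)] T_poly_minus)
  also have "\<dots> = var (Suc i) * (T_poly j f - swap_poly i (T_poly j f))"
    using assms by (simp add: swap_T_poly_far mult.commute)
  finally show "(var i - var (Suc i)) * T_poly j (T_poly i f) =
      var (Suc i) * (T_poly j f - swap_poly i (T_poly j f))" .
qed

text \<open>Both sides equal \<open>x\<^sub>i\<^sub>+\<^sub>1 x\<^sub>i\<^sub>+\<^sub>2\<^sup>2 / \<Delta>\<close> times the alternating sum of the six images of \<open>f\<close>,
  where \<open>\<Delta>\<close> is the Vandermonde product in the three variables.\<close>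
lemma T_poly_braid:
  fixes f :: "('a::field) mpoly"
  shows "T_poly i (T_poly (Suc i) (T_poly i f)) = T_poly (Suc i) (T_poly i (T_poly (Suc i) f))"
proof -
  define a b c where "a = (var i :: 'a mpoly)" and "b = (var (Suc i) :: 'a mpoly)"
    and "c = (var (Suc (Suc i)) :: 'a mpoly)"
  define s t where "s = (swap_poly i :: 'a mpoly \<Rightarrow> 'a mpoly)" and "t = (swap_poly (Suc i) :: 'a mpoly \<Rightarrow> 'a mpoly)"
  have ne: "a - b \<noteq> 0" "b - c \<noteq> 0" "a - c \<noteq> 0" by (simp_all add: a_def b_def c_def var_inject)
  have sv: "s a = b" "s b = a" "s c = c" "t a = a" "t b = c" "t c = b"
    by (simp_all add: s_def t_def a_def b_def c_def swap_poly_var)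
  have sm: "s (x * y) = s x * s y" "s (x - y) = s x - s y" "t (x * y) = t x * t y" "t (x - y) = t x - t y"
    for x y by (simp_all add: s_def t_def swap_poly_mult swap_poly_minus)
  have ss: "s (s x) = x" "t (t x) = x" for x by (simp_all add: s_def t_def)
  have sts: "s (t (s f)) = t (s (t f))"
  proof (rule poly_mapping_eqI)
    fix k :: "nat \<Rightarrow>\<^sub>0 nat"
    have "swap_exp i (swap_exp (Suc i) (swap_exp i k)) =
        swap_exp (Suc i) (swap_exp i (swap_exp (Suc i) k))"
      by (intro poly_mapping_eqI) (simp add: lookup_map_key_sw, simp add: sw_def)
    then show "lookup (s (t (s f))) k = lookup (t (s (t f))) k"
      by (simp add: s_def t_def lookup_swap_poly)
  qed
  have X: "(a - b) * T_poly i g = b * (g - s g)" for g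
    unfolding a_def b_def s_def by (rule T_poly_mult_var_diff)
  have Y: "(b - c) * T_poly (Suc i) g = c * (g - t g)" for g
    unfolding b_def c_def t_def by (rule T_poly_mult_var_diff)
  let ?D = "(a - b) * (b - c) * (a - c)"
  define R where "R = b * c * c * (f - s f - t f + t (s f) + s (t f) - s (t (s f)))"
  have left: "?D * T_poly i (T_poly (Suc i) (T_poly i f)) = R"
  proof -
    define p where "p = T_poly i f"
    define q where "q = T_poly (Suc i) p"
    define r where "r = T_poly i q"
    have p: "(a - b) * p = b * (f - s f)" unfolding p_def by (rule X)
    have sp: "(a - b) * s p = a * (f - s f)"
    proof -
      have "s ((a - b) * p) = s (b * (f - s f))" using p by simp
      then show ?thesis by (simp add: sm sv ss algebra_simps)
    qed
    have tp: "(a - c) * t p = c * (t f - t (s f))"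
    proof -
      have "t ((a - b) * p) = t (b * (f - s f))" using p by simp
      then show ?thesis by (simp add: sm sv ss)
    qed
    have stp: "(b - c) * s (t p) = c * (s (t f) - s (t (s f)))"
    proof -
      have "s ((a - c) * t p) = s (c * (t f - t (s f)))" using tp by simp
      then show ?thesis by (simp add: sm sv ss)
    qed
    have q: "(b - c) * q = c * (p - t p)" unfolding q_def by (rule Y)
    have sq: "(a - c) * s q = c * (s p - s (t p))"
    proof -
      have "s ((b - c) * q) = s (c * (p - t p))" using q by simp
      then show ?thesis by (simp add: sm sv ss)
    qed
    have r: "(a - b) * r = b * (q - s q)" unfolding r_def by (rule X)
    have Dq: "?D * q = c * b * (a - c) * (f - s f) - c * c * (a - b) * (t f - t (s f))"
      using p tp q by algebra
    have Dsq: "?D * s q = c * a * (b - c) * (f - s f) - c * c * (a - b) * (s (t f) - s (t (s f)))"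
      using sp stp sq by algebra
    have "(a - b) * (?D * r) = (a - b) * R"
      unfolding R_def using r Dq Dsq by algebra
    then show ?thesis using ne by (simp add: r_def q_def p_def)
  qed
  have right: "?D * T_poly (Suc i) (T_poly i (T_poly (Suc i) f)) = R"
  proof -
    define p where "p = T_poly (Suc i) f"
    define q where "q = T_poly i p"
    define r where "r = T_poly (Suc i) q"
    have p: "(b - c) * p = c * (f - t f)" unfolding p_def by (rule Y)
    have tp: "(b - c) * t p = b * (f - t f)"
    proof -
      have "t ((b - c) * p) = t (c * (f - t f))" using p by simp
      then show ?thesis by (simp add: sm sv ss algebra_simps)
    qed
    have sp: "(a - c) * s p = c * (s f - s (t f))"
    proof -
      have "s ((b - c) * p) = s (c * (f - t f))" using p by simp
      then show ?thesis by (simp add: sm sv ss)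
    qed
    have tsp: "(a - b) * t (s p) = b * (t (s f) - s (t (s f)))"
    proof -
      have "t ((a - c) * s p) = t (c * (s f - s (t f)))" using sp by simp
      then show ?thesis by (simp add: sm sv ss sts)
    qed
    have q: "(a - b) * q = b * (p - s p)" unfolding q_def by (rule X)
    have tq: "(a - c) * t q = c * (t p - t (s p))"
    proof -
      have "t ((a - b) * q) = t (b * (p - s p))" using q by simp
      then show ?thesis by (simp add: sm sv ss)
    qed
    have r: "(b - c) * r = c * (q - t q)" unfolding r_def by (rule Y)
    have Dq: "?D * q = b * c * (a - c) * (f - t f) - b * c * (b - c) * (s f - s (t f))"
      using p sp q by algebra
    have Dtq: "?D * t q = c * b * (a - b) * (f - t f) - c * b * (b - c) * (t (s f) - s (t (s f)))"
      using tp tsp tq by algebra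
    have "(b - c) * (?D * r) = (b - c) * R"
      unfolding R_def using r Dq Dtq by algebra
    then show ?thesis using ne by (simp add: r_def q_def p_def)
  qed
  have "?D * T_poly i (T_poly (Suc i) (T_poly i f)) = ?D * T_poly (Suc i) (T_poly i (T_poly (Suc i) f))"
    using left right by simp
  then show ?thesis using ne by simp
qed

lemma braid_ops_T_poly: "braid_ops n T_poly"
  unfolding braid_ops_def using T_poly_comm T_poly_braid by blast

text \<open>The segment between m and its swap, ends included: an upper bound for the support of
  \<open>T_poly i\<close> on a monomial that treats both orders of the two exponents alike.\<close>

definition exp_seg :: "nat \<Rightarrow> (nat \<Rightarrow>\<^sub>0 nat) \<Rightarrow> (nat \<Rightarrow>\<^sub>0 nat) \<Rightarrow> bool" where
  "exp_seg i m m' \<longleftrightarrow> (\<exists>a b. m' = exp_upd m i a b \<and>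
     a + b = lookup m i + lookup m (Suc i) \<and>
     min (lookup m i) (lookup m (Suc i)) \<le> a \<and>
     a \<le> max (lookup m i) (lookup m (Suc i)))"

lemma keys_sum_xp: "m' \<in> keys (\<Sum>k\<in>K. xp (M k) :: 'a::field mpoly) \<Longrightarrow> \<exists>k\<in>K. m' = M k"
  using keys_sum[of "\<lambda>k. xp (M k)" K] by force

lemma keys_T_poly_xp:
  assumes "m' \<in> keys (T_poly i (xp m) :: 'a::field mpoly)"
  shows "exp_seg i m m'"
proof -
  define a b where "a = lookup m i" and "b = lookup m (Suc i)"
  show ?thesis
  proof (cases "b \<le> a")
    case True
    then obtain k where "k < a - b" "m' = exp_upd m i (a - Suc k) (b + Suc k)"
      using assms keys_sum_xp by (auto simp: T_poly_xp_ge[OF a_def b_def] dest!: keys_sum_xp)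
    then show ?thesis unfolding exp_seg_def a_def[symmetric] b_def[symmetric]
      by (intro exI[of _ "a - Suc k"] exI[of _ "b + Suc k"]) auto
  next
    case False
    then obtain k where "k < b - a" "m' = exp_upd m i (a + k) (b - k)"
      using assms keys_sum_xp by (auto simp: T_poly_xp_less[OF a_def b_def] dest!: keys_sum_xp)
    then show ?thesis unfolding exp_seg_def a_def[symmetric] b_def[symmetric]
      by (intro exI[of _ "a + k"] exI[of _ "b - k"]) auto
  qed
qed

lemma keys_T_poly:
  assumes "m' \<in> keys (T_poly i (f :: 'a::field mpoly))"
  shows "\<exists>m\<in>keys f. exp_seg i m m'"
proof -
  have "T_poly i f = (\<Sum>m\<in>keys f. const (lookup f m) * T_poly i (xp m))"
    by (subst poly_sum_xp[of f]) (simp only: T_poly_sum T_poly_const_mult)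
  then have "m' \<in> (\<Union>m\<in>keys f. keys (const (lookup f m) * T_poly i (xp m)))"
    using assms keys_sum by fastforce
  then show ?thesis using keys_const_mult keys_T_poly_xp by blast
qed

section \<open>Leading exponents\<close>

definition exp_sum :: "(nat \<Rightarrow>\<^sub>0 nat) \<Rightarrow> nat set \<Rightarrow> nat" where
  "exp_sum m S = (\<Sum>j\<in>S. lookup m j)"

definition exp_sq :: "nat \<Rightarrow> (nat \<Rightarrow>\<^sub>0 nat) \<Rightarrow> nat" where
  "exp_sq n m = (\<Sum>j\<in>{1..n}. (lookup m j)\<^sup>2)"

text \<open>The tie-breaker: it is additive in m and prefers small indices, in accordance with the
  stable sort in \<open>sorts\<close>.\<close>

definition exp_wt :: "nat \<Rightarrow> (nat \<Rightarrow>\<^sub>0 nat) \<Rightarrow> nat" where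
  "exp_wt n m = (\<Sum>j\<in>{1..n}. (n - j) * lookup m j)"

definition partial :: "(nat \<Rightarrow> nat) \<Rightarrow> nat \<Rightarrow> nat" where
  "partial \<rho> k = (\<Sum>p\<in>{1..k}. \<rho> p)"

text \<open>Majorization by the profile \<rho>. It bounds \<open>exp_sum m T\<close>, the quantity
  that decides how much the sum of squares grows on multiplying by the variables in T.\<close>

definition dominated :: "nat \<Rightarrow> (nat \<Rightarrow> nat) \<Rightarrow> (nat \<Rightarrow>\<^sub>0 nat) \<Rightarrow> bool" where
  "dominated n \<rho> m \<longleftrightarrow> (\<forall>S\<subseteq>{1..n}. exp_sum m S \<le> partial \<rho> (card S))"

lemma sum_two:
  fixes g :: "nat \<Rightarrow> nat"
  assumes "finite S" "i \<in> S" "Suc i \<in> S"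
  shows "sum g S = g i + g (Suc i) + sum g (S - {i, Suc i})"
proof -
  have "S = insert i (insert (Suc i) (S - {i, Suc i}))" using assms by auto
  then have "sum g S = sum g (insert i (insert (Suc i) (S - {i, Suc i})))" by simp
  also have "\<dots> = g i + g (Suc i) + sum g (S - {i, Suc i})" using assms(1) by simp
  finally show ?thesis .
qed

text \<open>Convexity: for a fixed sum the loss of squares is twice
  \<open>(a - x) * (y - a)\<close>, whose factors have the same sign when a lies between x and
  y.\<close>

lemma square_sum_seg:
  fixes a b x y :: nat
  assumes "a + b = x + y" "min x y \<le> a" "a \<le> max x y"
  shows "a\<^sup>2 + b\<^sup>2 \<le> x\<^sup>2 + y\<^sup>2" "a \<noteq> x \<Longrightarrow> a \<noteq> y \<Longrightarrow> a\<^sup>2 + b\<^sup>2 < x\<^sup>2 + y\<^sup>2"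
proof -
  have *: "(int x)\<^sup>2 + (int y)\<^sup>2 - ((int a)\<^sup>2 + (int b)\<^sup>2) = 2 * ((int a - int x) * (int y - int a))"
  proof -
    have "int b = int x + int y - int a" using assms(1) by linarith
    then show ?thesis by algebra
  qed
  have "0 \<le> (int a - int x) * (int y - int a)"
    using assms by (cases "x \<le> y") (auto simp: mult_nonneg_nonneg mult_nonpos_nonpos)
  then have "int (a\<^sup>2 + b\<^sup>2) \<le> int (x\<^sup>2 + y\<^sup>2)" using * by simp
  then show "a\<^sup>2 + b\<^sup>2 \<le> x\<^sup>2 + y\<^sup>2" by (simp only: of_nat_le_iff)
  assume "a \<noteq> x" "a \<noteq> y"
  then have "0 < (int a - int x) * (int y - int a)"
    using assms by (cases "x \<le> y") (auto simp: mult_pos_pos mult_neg_neg)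
  then have "int (a\<^sup>2 + b\<^sup>2) < int (x\<^sup>2 + y\<^sup>2)" using * by simp
  then show "a\<^sup>2 + b\<^sup>2 < x\<^sup>2 + y\<^sup>2" by (simp only: of_nat_less_iff)
qed

lemma exp_sq_exp_upd:
  assumes i: "i \<in> {1..<n}"
  shows "exp_sq n (exp_upd m i a b) + (lookup m i)\<^sup>2 + (lookup m (Suc i))\<^sup>2
    = exp_sq n m + a\<^sup>2 + b\<^sup>2"
proof -
  have "(\<Sum>j\<in>{1..n} - {i, Suc i}. (lookup (exp_upd m i a b) j)\<^sup>2) =
      (\<Sum>j\<in>{1..n} - {i, Suc i}. (lookup m j)\<^sup>2)"
    by (rule sum.cong) (auto simp: lookup_exp_upd)
  then show ?thesis
    using i unfolding exp_sq_def by (simp add: sum_two[of "{1..n}" i] lookup_exp_upd)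
qed

lemma exp_seg_sq:
  assumes i: "i \<in> {1..<n}" and s: "exp_seg i m m'"
  shows "exp_sq n m' \<le> exp_sq n m"
    and "lookup m' i \<noteq> lookup m i \<Longrightarrow>
      lookup m' i \<noteq> lookup m (Suc i) \<Longrightarrow> exp_sq n m' < exp_sq n m"
proof -
  let ?x = "lookup m i" and ?y = "lookup m (Suc i)"
  obtain a b where m': "m' = exp_upd m i a b" and ab: "a + b = ?x + ?y" "min ?x ?y \<le> a" "a \<le> max ?x ?y"
    using s by (auto simp: exp_seg_def)
  note sq = exp_sq_exp_upd[OF i, of m a b, folded m']
  show "exp_sq n m' \<le> exp_sq n m" using square_sum_seg(1)[OF ab] sq by linarith
  assume "lookup m' i \<noteq> ?x" "lookup m' i \<noteq> ?y"
  then show "exp_sq n m' < exp_sq n m"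
    using square_sum_seg(2)[OF ab] sq by (simp add: m' lookup_exp_upd)
qed

lemma exp_seg_keys:
  assumes "i \<in> {1..<n}" "exp_seg i m m'" "keys m \<subseteq> {1..n}"
  shows "keys m' \<subseteq> {1..n}"
proof
  fix k assume k: "k \<in> keys m'"
  obtain a b where "m' = exp_upd m i a b" using assms(2) by (auto simp: exp_seg_def)
  then have "k = i \<or> k = Suc i \<or> k \<in> keys m"
    using k by (auto simp: in_keys_iff lookup_exp_upd split: if_splits)
  then show "k \<in> {1..n}" using assms by auto
qed

text \<open>If S contains both or neither of i and i+1, the sum over S does not change. If it
  contains one of them, the new sum is at most the larger of the two old sums obtained by putting i
  or i+1 in that place, and these sets have the same size as S.\<close>

lemma exp_seg_dominated:
  assumes i: "i \<in> {1..<n}" and s: "exp_seg i m m'" and d: "dominated n \<rho> m"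
  shows "dominated n \<rho> m'"
  unfolding dominated_def
proof (intro allI impI)
  fix S assume S: "S \<subseteq> {1..n}"
  then have fin: "finite S" using finite_subset by blast
  let ?x = "lookup m i" and ?y = "lookup m (Suc i)"
  obtain a b where m': "m' = exp_upd m i a b" and ab: "a + b = ?x + ?y" "min ?x ?y \<le> a" "a \<le> max ?x ?y"
    using s by (auto simp: exp_seg_def)
  let ?R = "S - {i, Suc i}"
  have R: "exp_sum m' ?R = exp_sum m ?R"
    unfolding exp_sum_def by (rule sum.cong) (auto simp: m' lookup_exp_upd)
  have le: "exp_sum m' S \<le> exp_sum m ?R + max ?x ?y" and
    card: "card (insert i ?R) = card S" "card (insert (Suc i) ?R) = card S"
    if one: "(i \<in> S) \<noteq> (Suc i \<in> S)"
  proof -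
    consider "S = insert i ?R" | "S = insert (Suc i) ?R"
    proof (cases "i \<in> S")
      case True
      then have "S = insert i ?R" using one by blast
      then show ?thesis by (rule that)
    next
      case False
      then have "S = insert (Suc i) ?R" using one by blast
      then show ?thesis by (rule that)
    qed
    then have "exp_sum m' S \<le> exp_sum m ?R + max ?x ?y \<and>
        card (insert i ?R) = card S \<and> card (insert (Suc i) ?R) = card S"
    proof cases
      case 1
      have "exp_sum m' S = exp_sum m' (insert i ?R)" using 1 by simp
      also have "\<dots> = a + exp_sum m ?R"
        using fin R by (simp add: exp_sum_def m' lookup_exp_upd)
      finally have "exp_sum m' S = a + exp_sum m ?R" .
      moreover have "card S = card (insert i ?R)" using 1 by simp
      ultimately show ?thesis using ab(3) fin by simp
    next
      case 2
      have "exp_sum m' S = exp_sum m' (insert (Suc i) ?R)" using 2 by simp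
      also have "\<dots> = b + exp_sum m ?R"
        using fin R by (simp add: exp_sum_def m' lookup_exp_upd)
      finally have "exp_sum m' S = b + exp_sum m ?R" .
      moreover have "card S = card (insert (Suc i) ?R)" using 2 by simp
      moreover have "b \<le> max ?x ?y" using ab by linarith
      ultimately show ?thesis using fin by simp
    qed
    then show "exp_sum m' S \<le> exp_sum m ?R + max ?x ?y"
      "card (insert i ?R) = card S" "card (insert (Suc i) ?R) = card S" by auto
  qed
  show "exp_sum m' S \<le> partial \<rho> (card S)"
  proof (cases "(i \<in> S) = (Suc i \<in> S)")
    case True
    have "exp_sum m' S = exp_sum m S"
    proof (cases "i \<in> S")
      case True
      then have "Suc i \<in> S" using \<open>(i \<in> S) = (Suc i \<in> S)\<close> by simp
      then show ?thesis using R ab(1) True fin unfolding exp_sum_def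
        by (simp add: sum_two[of S i] m' lookup_exp_upd)
    next
      case False
      then have "?R = S" using \<open>(i \<in> S) = (Suc i \<in> S)\<close> by auto
      then show ?thesis using R by simp
    qed
    then show ?thesis using d S by (simp add: dominated_def)
  next
    case False
    note f = le[OF False] card[OF False]
    have sub: "insert i ?R \<subseteq> {1..n}" "insert (Suc i) ?R \<subseteq> {1..n}" using S i by auto
    have "exp_sum m (insert i ?R) \<le> partial \<rho> (card S)" "exp_sum m (insert (Suc i) ?R) \<le> partial \<rho> (card S)"
      using d sub f by (metis dominated_def)+
    then have "?x + exp_sum m ?R \<le> partial \<rho> (card S)" "?y + exp_sum m ?R \<le> partial \<rho> (card S)"
      using fin by (simp_all add: exp_sum_def)
    then show ?thesis using f(1) by linarith
  qed
qed

text \<open>The rearrangement of the profile \<rho> along w: the variable with index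
  \<open>w p\<close> receives the exponent \<open>\<rho> p\<close>, for p from 1 to n.\<close>

definition rexp :: "nat \<Rightarrow> (nat \<Rightarrow> nat) \<Rightarrow> (nat \<Rightarrow> nat) \<Rightarrow> (nat \<Rightarrow>\<^sub>0 nat)" where
  "rexp n \<rho> w = (\<Sum>k\<in>{1..n}. Poly_Mapping.single k (\<rho> (inv w k)))"

lemma lookup_rexp: "lookup (rexp n \<rho> w) k = (if k \<in> {1..n} then \<rho> (inv w k) else 0)"
  by (simp add: rexp_def lookup_sum lookup_single when_def del: atLeastAtMost_iff)

lemma keys_rexp: "keys (rexp n \<rho> w) \<subseteq> {1..n}"
  by (auto simp: in_keys_iff lookup_rexp split: if_splits)

lemma exp_sum_rexp:
  assumes w: "w permutes {1..n}" and S: "S \<subseteq> {1..n}"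
  shows "exp_sum (rexp n \<rho> w) S = (\<Sum>p\<in>inv w ` S. \<rho> p)"
proof -
  have "inj_on (inv w) S" using permutes_inj[OF permutes_inv[OF w]] inj_on_subset by blast
  moreover have "exp_sum (rexp n \<rho> w) S = (\<Sum>k\<in>S. \<rho> (inv w k))"
    unfolding exp_sum_def by (rule sum.cong) (use S in \<open>auto simp: lookup_rexp\<close>)
  ultimately show ?thesis by (simp add: sum.reindex)
qed

lemma exp_sq_rexp:
  assumes w: "w permutes {1..n}"
  shows "exp_sq n (rexp n \<rho> w) = (\<Sum>p\<in>{1..n}. (\<rho> p)\<^sup>2)"
proof -
  have "exp_sq n (rexp n \<rho> w) = (\<Sum>k\<in>{1..n}. (\<rho> (inv w k))\<^sup>2)"
    unfolding exp_sq_def by (rule sum.cong) (auto simp: lookup_rexp)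
  also have "\<dots> = (\<Sum>p\<in>{1..n}. (\<rho> p)\<^sup>2)"
    using sum.permute[OF permutes_inv[OF w], of "\<lambda>p. (\<rho> p)\<^sup>2"] by (simp add: comp_def)
  finally show ?thesis .
qed


lemma sum_le_of_pairwise_le:
  fixes g :: "'b \<Rightarrow> nat"
  assumes fin: "finite A" "finite B" and c: "card A = card B"
    and le: "\<And>a b. a \<in> A \<Longrightarrow> b \<in> B \<Longrightarrow> g b \<le> g a"
  shows "sum g B \<le> sum g A"
    and "a0 \<in> A \<Longrightarrow> b0 \<in> B \<Longrightarrow> g b0 < g a0 \<Longrightarrow> sum g B < sum g A"
proof -
  obtain f where f: "bij_betw f A B" using finite_same_card_bij[OF fin c] by blast
  then have fB: "f a \<in> B" if "a \<in> A" for a using that by (auto simp: bij_betw_def)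
  have eq: "sum g B = (\<Sum>a\<in>A. g (f a))" using sum.reindex_bij_betw[OF f, of g] by simp
  show "sum g B \<le> sum g A" unfolding eq by (rule sum_mono) (use le fB in auto)
  assume 0: "a0 \<in> A" "b0 \<in> B" "g b0 < g a0"
  obtain a1 where a1: "a1 \<in> A" "f a1 = b0" using f 0(2) by (auto simp: bij_betw_def)
  have "\<exists>a\<in>A. g (f a) < g a"
  proof (cases "g b0 < g a1")
    case True then show ?thesis using a1 by auto
  next
    case False
    then have "g a1 \<le> g b0" by simp
    then have "g (f a0) < g a0" using le[OF a1(1) fB[OF 0(1)]] 0(3) by simp
    then show ?thesis using 0(1) by auto
  qed
  then show "sum g B < sum g A" unfolding eq
    by (intro sum_strict_mono_ex1) (use fin le fB in auto)
qed

lemma card_Diff_eq: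
  assumes "finite A" "finite B" "card A = card B"
  shows "card (A - B) = card (B - A)"
proof -
  have "card (A - B) = card A - card (A \<inter> B)" using assms by (simp add: card_Diff_subset_Int)
  moreover have "card (B - A) = card B - card (A \<inter> B)"
    using assms by (simp add: card_Diff_subset_Int Int_commute)
  ultimately show ?thesis using assms by simp
qed

lemma sum_split_Int:
  fixes g :: "'b \<Rightarrow> nat"
  assumes "finite A"
  shows "sum g A = sum g (A - B) + sum g (A \<inter> B)"
  using sum.Int_Diff[OF assms, of g B] by simp

text \<open>An exchange between U and the initial segment of the same size. The equality case says
  that only elements with equal \<rho> were exchanged; \<open>compatible_set_weight\<close> needs
  this.\<close>

lemma
  fixes \<rho> :: "nat \<Rightarrow> nat"
  assumes \<rho>: "antimono \<rho>" and U: "finite U" "0 \<notin> U"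
  shows sum_le_partial: "sum \<rho> U \<le> partial \<rho> (card U)"
    and sum_eq_partial: "sum \<rho> U = partial \<rho> (card U) \<Longrightarrow> a \<in> {1..card U} - U \<Longrightarrow>
      b \<in> U - {1..card U} \<Longrightarrow> \<rho> a = \<rho> b"
proof -
  let ?I = "{1..card U}"
  have c: "card (?I - U) = card (U - ?I)" by (rule card_Diff_eq) (use U in auto)
  have lt: "a < b" if "a \<in> ?I - U" "b \<in> U - ?I" for a b
    using that U(2) by (cases "b = 0") auto
  have le: "\<rho> b \<le> \<rho> a" if "a \<in> ?I - U" "b \<in> U - ?I" for a b
    using lt[OF that] \<rho> by (auto simp: antimono_def)
  have s: "sum \<rho> U = sum \<rho> (U - ?I) + sum \<rho> (?I \<inter> U)" "sum \<rho> ?I = sum \<rho> (?I - U) + sum \<rho> (?I \<inter> U)"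
    using sum_split_Int[OF U(1), of \<rho> ?I] sum_split_Int[of ?I \<rho> U] by (auto simp: Int_commute)
  show "sum \<rho> U \<le> partial \<rho> (card U)"
    unfolding partial_def using sum_le_of_pairwise_le(1)[OF _ _ c, of \<rho>] le s U by simp
  assume eq: "sum \<rho> U = partial \<rho> (card U)" and ab: "a \<in> ?I - U" "b \<in> U - ?I"
  show "\<rho> a = \<rho> b"
  proof (rule ccontr)
    assume "\<rho> a \<noteq> \<rho> b"
    then have "\<rho> b < \<rho> a" using le[OF ab] by simp
    then have "sum \<rho> (U - ?I) < sum \<rho> (?I - U)"
      by (intro sum_le_of_pairwise_le(2)[OF _ _ c le ab]) (use U in auto)
    then show False using eq s unfolding partial_def by simp
  qed
qed

lemma antimono_wt: "finite D \<Longrightarrow> antimono (wt D)"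
  by (simp add: antimono_def wt_antimono)

lemma card_inv_image: "w permutes {1..n} \<Longrightarrow> card (inv w ` S) = card S"
  using permutes_inj[OF permutes_inv] by (metis card_image inj_on_subset subset_UNIV)

lemma dominated_rexp:
  assumes w: "w permutes {1..n}" and \<rho>: "antimono \<rho>"
  shows "dominated n \<rho> (rexp n \<rho> w)"
  unfolding dominated_def
proof (intro allI impI)
  fix S assume S: "S \<subseteq> {1..n}"
  have "0 \<notin> inv w ` S" using inv_permutes_in[OF w] S by fastforce
  then show "exp_sum (rexp n \<rho> w) S \<le> partial \<rho> (card S)"
    using sum_le_partial[OF \<rho>, of "inv w ` S"] S finite_subset[OF S]
    by (simp add: exp_sum_rexp[OF w S] card_inv_image[OF w])
qed

definition sq_low :: "nat \<Rightarrow> (nat \<Rightarrow> nat) \<Rightarrow> (nat \<Rightarrow>\<^sub>0 nat) \<Rightarrow> bool" where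
  "sq_low n \<rho> m \<longleftrightarrow> keys m \<subseteq> {1..n} \<and> dominated n \<rho> m \<and>
     exp_sq n m < (\<Sum>p\<in>{1..n}. (\<rho> p)\<^sup>2)"

text \<open>On the leading monomial \<open>T_poly i\<close> produces the swapped one with
  coefficient 1, as \<rho> drops strictly, together with interior points of the segment, which lose
  in the sum of squares. Lower terms cannot rise, because no point of a segment has a larger sum of
  squares than its ends.\<close>

lemma T_poly_lead:
  fixes f :: "('a::field) mpoly"
  assumes w: "w permutes {1..n}" and i: "i \<in> {1..<n}" and \<rho>: "antimono \<rho>"
    and less: "\<rho> (inv w (Suc i)) < \<rho> (inv w i)"
    and f: "\<And>m. m \<in> keys (f - xp (rexp n \<rho> w)) \<Longrightarrow> sq_low n \<rho> m"
    and m: "m \<in> keys (T_poly i f - xp (rexp n \<rho> (sw i \<circ> w)))"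
  shows "sq_low n \<rho> m"
proof -
  let ?m0 = "rexp n \<rho> w"
  define g where "g = f - xp ?m0"
  define a b where "a = lookup ?m0 i" and "b = lookup ?m0 (Suc i)"
  have ab: "a = \<rho> (inv w i)" "b = \<rho> (inv w (Suc i))" using i by (auto simp: a_def b_def lookup_rexp)
  \<comment> \<open>Splits the sum of \<open>Suc d\<close> monomials into its last one, the swapped
    monomial, and d interior ones.\<close>
  obtain d where d: "a = b + Suc d" using less ab less_imp_Suc_add[of b a] by auto
  have upd: "exp_upd ?m0 i b a = rexp n \<rho> (sw i \<circ> w)"
    using i by (intro poly_mapping_eqI)
      (auto simp: lookup_exp_upd lookup_rexp ab inv_sw_comp_apply[OF w] sw_def)
  have "T_poly i (xp ?m0) = (\<Sum>k<a - b. xp (exp_upd ?m0 i (a - Suc k) (b + Suc k)) :: 'a mpoly)"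
    by (rule T_poly_xp_ge[OF a_def b_def]) (use less ab in simp)
  also have "\<dots> = (\<Sum>k<d. xp (exp_upd ?m0 i (a - Suc k) (b + Suc k))) + xp (exp_upd ?m0 i b a)"
    by (simp add: d)
  finally have T: "T_poly i f - xp (rexp n \<rho> (sw i \<circ> w)) =
      (\<Sum>k<d. xp (exp_upd ?m0 i (a - Suc k) (b + Suc k))) + T_poly i g"
    using T_poly_add[of i "xp ?m0" g] by (simp add: g_def upd)
  then have "m \<in> keys (\<Sum>k<d. xp (exp_upd ?m0 i (a - Suc k) (b + Suc k)) :: 'a mpoly)
      \<or> m \<in> keys (T_poly i g)"
    using m Poly_Mapping.keys_add by fastforce
  then show ?thesis
  proof
    assume "m \<in> keys (\<Sum>k<d. xp (exp_upd ?m0 i (a - Suc k) (b + Suc k)) :: 'a mpoly)"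
    then obtain k where k: "k < d" and mk: "m = exp_upd ?m0 i (a - Suc k) (b + Suc k)"
      by (auto dest!: keys_sum_xp)
    have seg: "exp_seg i ?m0 m"
      unfolding exp_seg_def a_def[symmetric] b_def[symmetric] using k mk d
      by (intro exI[of _ "a - Suc k"] exI[of _ "b + Suc k"]) auto
    have "exp_sq n m < exp_sq n ?m0"
      by (rule exp_seg_sq(2)[OF i seg]) (use k d in \<open>simp_all add: mk lookup_exp_upd flip: a_def b_def\<close>)
    then show ?thesis
      using exp_seg_keys[OF i seg keys_rexp] exp_seg_dominated[OF i seg dominated_rexp[OF w \<rho>]]
      by (simp add: sq_low_def exp_sq_rexp[OF w])
  next
    assume "m \<in> keys (T_poly i g)"
    then obtain m1 where "m1 \<in> keys g" and seg: "exp_seg i m1 m" using keys_T_poly by blast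
    then have "sq_low n \<rho> m1" using f by (simp add: g_def)
    then show ?thesis
      using exp_seg_keys[OF i seg] exp_seg_dominated[OF i seg] exp_seg_sq(1)[OF i seg]
      by (auto simp: sq_low_def)
  qed
qed

lemma foldr_T_poly_lead:
  assumes D: "finite D"
  shows "reduced n ws \<Longrightarrow> desc n (word_perm ws) \<subseteq> D \<Longrightarrow>
    m \<in> keys (foldr T_poly ws (xp (rexp n (wt D) id)) -
        (xp (rexp n (wt D) (word_perm ws)) :: 'a::field mpoly)) \<Longrightarrow> sq_low n (wt D) m"
proof (induction ws arbitrary: m)
  case (Cons i ws)
  note d = reduced_Cons_wt[OF Cons.prems(1,2) D]
  have r: "reduced n ws" and i: "i \<in> {1..<n}" using Cons.prems(1) by (auto simp: reduced_Cons_iff)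
  then have w: "word_perm ws permutes {1..n}" by (simp add: reduced_def word_perm_permutes)
  have "m \<in> keys (T_poly i (foldr T_poly ws (xp (rexp n (wt D) id))) -
      (xp (rexp n (wt D) (word_perm (i # ws))) :: 'a mpoly))"
    using Cons.prems(3) by (simp only: foldr.simps comp_apply)
  then show ?case
    unfolding word_perm_Cons
    using T_poly_lead[OF w i antimono_wt[OF D] d(2) Cons.IH[OF r d(1)]] by blast
qed simp

section \<open>Multiplication by elementary symmetric polynomials\<close>

definition ind :: "nat set \<Rightarrow> (nat \<Rightarrow>\<^sub>0 nat)" where
  "ind T = (\<Sum>t\<in>T. Poly_Mapping.single t 1)"

lemma lookup_ind: "finite T \<Longrightarrow> lookup (ind T) k = (if k \<in> T then 1 else 0)"
  by (simp add: ind_def lookup_sum lookup_single when_def)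

lemma keys_ind: "finite T \<Longrightarrow> keys (ind T) = T"
  by (auto simp: in_keys_iff lookup_ind split: if_splits)

lemma prod_var: "finite T \<Longrightarrow> (\<Prod>t\<in>T. var t) = xp (ind T)"
  by (induction T rule: finite_induct) (simp_all add: ind_def var_def mult_single)

lemma elem_sym_ind:
  assumes "finite S"
  shows "elem_sym r S = (\<Sum>T\<in>{T. T \<subseteq> S \<and> card T = r}. xp (ind T))"
  unfolding elem_sym_def
  by (rule sum.cong[OF refl], rule prod_var) (use assms finite_subset in auto)

lemma keys_elem_sym:
  assumes "finite S" "m \<in> keys (elem_sym r S :: 'a::field mpoly)"
  shows "\<exists>T\<subseteq>S. card T = r \<and> m = ind T"
  using assms(2) unfolding elem_sym_ind[OF assms(1)] by (auto dest!: keys_sum_xp)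

lemma exp_sum_add: "exp_sum (m + m') S = exp_sum m S + exp_sum m' S"
  by (simp add: exp_sum_def lookup_add sum.distrib)

lemma exp_sum_ind:
  assumes "finite T" "finite S"
  shows "exp_sum (ind T) S = card (T \<inter> S)"
  using assms by (simp add: exp_sum_def lookup_ind Int_commute flip: sum.inter_restrict)

lemma exp_wt_add: "exp_wt n (m + m') = exp_wt n m + exp_wt n m'"
  by (simp add: exp_wt_def lookup_add distrib_left sum.distrib)

lemma exp_wt_ind:
  assumes "T \<subseteq> {1..n}"
  shows "exp_wt n (ind T) = (\<Sum>t\<in>T. n - t)"
proof -
  have fin: "finite T" using assms finite_subset by blast
  have "exp_wt n (ind T) = (\<Sum>j\<in>{1..n}. if j \<in> T then n - j else 0)"
    unfolding exp_wt_def by (rule sum.cong) (simp_all add: lookup_ind[OF fin])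
  also have "\<dots> = (\<Sum>j\<in>{1..n} \<inter> T. n - j)" by (simp add: sum.inter_restrict)
  also have "{1..n} \<inter> T = T" using assms by auto
  finally show ?thesis .
qed

text \<open>The cross term \<open>2 * exp_sum m T\<close> is where the failure of additivity sits.
  For dominated m it is largest when T collects the top exponents.\<close>

lemma exp_sq_add_ind:
  assumes "T \<subseteq> {1..n}"
  shows "exp_sq n (m + ind T) = exp_sq n m + 2 * exp_sum m T + card T"
proof -
  have fin: "finite T" using assms finite_subset by blast
  have "exp_sq n (m + ind T) =
      (\<Sum>j\<in>{1..n}. (lookup m j)\<^sup>2 + (if j \<in> T then 2 * lookup m j + 1 else 0))"
    unfolding exp_sq_def
    by (rule sum.cong) (simp_all add: lookup_add lookup_ind[OF fin] power2_eq_square algebra_simps)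
  also have "\<dots> = exp_sq n m + (\<Sum>j\<in>{1..n} \<inter> T. 2 * lookup m j + 1)"
    by (subst sum.inter_restrict) (simp_all only: sum.distrib exp_sq_def finite_atLeastAtMost)
  also have "{1..n} \<inter> T = T" using assms by auto
  also have "(\<Sum>j\<in>T. 2 * lookup m j + 1) = 2 * exp_sum m T + card T"
    by (simp only: sum.distrib exp_sum_def sum_distrib_left card_eq_sum)
  finally show ?thesis by simp
qed

text \<open>Lexicographic in the two statistics. Distinct exponents may be incomparable, and the
  relation need not survive multiplication; \<open>weakly_low\<close> supplies what is
  missing.\<close>

definition below :: "nat \<Rightarrow> (nat \<Rightarrow>\<^sub>0 nat) \<Rightarrow> (nat \<Rightarrow>\<^sub>0 nat) \<Rightarrow> bool" where
  "below n m m' \<longleftrightarrow> exp_sq n m < exp_sq n m' \<or> exp_sq n m = exp_sq n m' \<and> exp_wt n m < exp_wt n m'"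

text \<open>The second condition on \<open>m\<close> records that the sets compatible with the chain of the columns
  of \<open>\<rho>\<close> are compatible with the columns \<open>w{1..i}\<close>, \<open>i \<in> desc n w\<close>; it makes the weight comparison survive
  multiplication by elementary symmetric polynomials.\<close>
definition weakly_low :: "nat \<Rightarrow> (nat \<Rightarrow> nat) \<Rightarrow> (nat \<Rightarrow> nat) \<Rightarrow> (nat \<Rightarrow>\<^sub>0 nat) \<Rightarrow> bool" where
  "weakly_low n w \<rho> m \<longleftrightarrow> keys m \<subseteq> {1..n} \<and> dominated n \<rho> m \<and>
     exp_sq n m \<le> exp_sq n (rexp n \<rho> w) \<and>
     (exp_sq n m = exp_sq n (rexp n \<rho> w) \<longrightarrow> exp_wt n m \<le> exp_wt n (rexp n \<rho> w) \<and>
       (\<forall>S\<subseteq>{1..n}. exp_sum m S = partial \<rho> (card S) \<longrightarrow>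
          exp_sum (rexp n (wt (desc n w)) w) S = partial (wt (desc n w)) (card S)))"

definition leads :: "nat \<Rightarrow> (nat \<Rightarrow> nat) \<Rightarrow> (nat \<Rightarrow> nat) \<Rightarrow> ('a::field) mpoly \<Rightarrow> bool" where
  "leads n w \<rho> f \<longleftrightarrow> weakly_low n w \<rho> (rexp n \<rho> w) \<and>
     (\<forall>m\<in>keys (f - xp (rexp n \<rho> w)). weakly_low n w \<rho> m \<and> below n m (rexp n \<rho> w))"

text \<open>The profile after one factor \<open>elem_sym j\<close>, whose leading summand is the
  product of the variables in the first j places of w.\<close>

definition shift :: "(nat \<Rightarrow> nat) \<Rightarrow> nat \<Rightarrow> nat \<Rightarrow> nat" where
  "shift \<rho> j = (\<lambda>p. \<rho> p + (if p \<le> j then 1 else 0))"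

lemma partial_shift: "partial (shift \<rho> j) k = partial \<rho> k + min j k"
proof -
  have "(\<Sum>p\<in>{1..k}. if p \<le> j then 1 else 0) = card {p \<in> {1..k}. p \<le> j}"
    by (simp add: sum.If_cases Int_def)
  also have "{p \<in> {1..k}. p \<le> j} = {1..min j k}" by auto
  finally show ?thesis by (simp add: partial_def shift_def sum.distrib)
qed

lemma permutes_image_subset:
  fixes w :: "nat \<Rightarrow> nat"
  assumes "w permutes {1..n}" "j \<le> n"
  shows "w ` {1..j} \<subseteq> {1..n}"
proof -
  have "{1..j} \<subseteq> {1..n}" using assms(2) by auto
  then show ?thesis using permutes_image[OF assms(1)] by blast
qed

lemma card_permutes_image: "w permutes {1..n} \<Longrightarrow> card (w ` S) = card S"
  using permutes_inj by (metis card_image inj_on_subset subset_UNIV)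

lemma inv_image_image: "w permutes {1..n} \<Longrightarrow> inv w ` (w ` S) = S"
  by (simp add: image_image permutes_inverses)

lemma image_inv_image: "w permutes {1..n} \<Longrightarrow> w ` (inv w ` S) = S"
  by (simp add: image_image permutes_inverses)

lemma rexp_shift:
  assumes w: "w permutes {1..n}" and j: "j \<le> n"
  shows "rexp n (shift \<rho> j) w = rexp n \<rho> w + ind (w ` {1..j})"
proof (rule poly_mapping_eqI)
  fix k
  have "k \<in> w ` {1..j} \<longleftrightarrow> inv w k \<in> {1..j}"
    using permutes_inverses[OF w] by (metis imageE image_eqI)
  moreover have "w ` {1..j} \<subseteq> {1..n}" by (rule permutes_image_subset[OF w j])
  moreover have "k \<in> {1..n} \<Longrightarrow> 1 \<le> inv w k" using inv_permutes_in[OF w, of k] by auto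
  ultimately show "lookup (rexp n (shift \<rho> j) w) k =
      lookup (rexp n \<rho> w + ind (w ` {1..j})) k"
    by (cases "k \<in> {1..n}") (auto simp: lookup_rexp lookup_add lookup_ind shift_def)
qed

lemma compatible_set_weight:
  assumes w: "w permutes {1..n}" and T: "T \<subseteq> {1..n}" "card T = j"
    and eq: "exp_sum (rexp n (wt (desc n w)) w) T = partial (wt (desc n w)) j"
    and ne: "T \<noteq> w ` {1..j}"
  shows "(\<Sum>t\<in>T. n - t) < (\<Sum>t\<in>w ` {1..j}. n - t)"
proof -
  let ?D = "desc n w"
  define U where "U = inv w ` T"
  have j: "j \<le> n" using card_mono[OF _ T(1)] T(2) by simp
  have U: "U \<subseteq> {1..n}" "card U = j"
    using inv_permutes_in[OF w] T card_inv_image[OF w] by (auto simp: U_def simp del: atLeastAtMost_iff)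
  have fU: "finite U" "0 \<notin> U" using U finite_subset by auto
  have TU: "T = w ` U" unfolding U_def using image_inv_image[OF w] by simp
  have inj: "inj_on w X" for X using permutes_inj[OF w] inj_on_subset by blast
  have eq': "sum (wt ?D) U = partial (wt ?D) (card U)"
    using eq exp_sum_rexp[OF w T(1)] U by (simp add: U_def)
  define A B where "A = {1..j} - U" and "B = U - {1..j}"
  have lt: "n - w b < n - w a" if a: "a \<in> A" and b: "b \<in> B" for a b
  proof -
    have ab: "a < b" "1 \<le> a" "b \<le> n" using a b U by (auto simp: A_def B_def)
    have "wt ?D a = wt ?D b"
      using sum_eq_partial[OF antimono_wt[OF finite_desc] fU eq'] a b U by (simp add: A_def B_def)
    then have "\<not> (\<exists>i\<in>?D. a \<le> i \<and> i < b)" using wt_less[OF finite_desc] by (metis less_irrefl)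
    then have "\<not> w b < w a" using inversion_imp_desc[of a b n w] ab by blast
    moreover have "w a \<noteq> w b" using inj[of UNIV] ab by (auto dest: injD)
    moreover have "w b \<in> {1..n}" using permutes_in_image[OF w, of b] ab by simp
    ultimately show ?thesis by auto
  qed
  have c: "card A = card B" unfolding A_def B_def by (rule card_Diff_eq) (use fU U in auto)
  have "U \<noteq> {1..j}" using ne TU by auto
  then have "A \<noteq> {} \<or> B \<noteq> {}" by (auto simp: A_def B_def)
  then obtain a b where ab: "a \<in> A" "b \<in> B"
    using c fU by (metis A_def B_def card_0_eq ex_in_conv finite_Diff finite_atLeastAtMost)
  have "(\<Sum>p\<in>B. n - w p) < (\<Sum>p\<in>A. n - w p)"
    by (rule sum_le_of_pairwise_le(2)[OF _ _ c _ ab lt[OF ab]])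
      (use fU lt in \<open>auto simp: A_def B_def intro: less_imp_le\<close>)
  moreover have "(\<Sum>p\<in>U. n - w p) = (\<Sum>p\<in>B. n - w p) + (\<Sum>p\<in>{1..j} \<inter> U. n - w p)"
    using sum_split_Int[OF fU(1), of "\<lambda>p. n - w p" "{1..j}"] by (simp add: B_def Int_commute)
  moreover have "(\<Sum>p\<in>{1..j}. n - w p) = (\<Sum>p\<in>A. n - w p) + (\<Sum>p\<in>{1..j} \<inter> U. n - w p)"
    using sum_split_Int[of "{1..j}" "\<lambda>p. n - w p" U] by (simp add: A_def)
  ultimately have "(\<Sum>p\<in>U. n - w p) < (\<Sum>p\<in>{1..j}. n - w p)" by linarith
  then show ?thesis unfolding TU by (simp add: sum.reindex[OF inj])
qed

text \<open>The growth of the squares is bounded by domination, so a tie after the step forces a tie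
  before it and forces T to attain the maximal sum. The last clause of \<open>weakly_low\<close>
  then makes T compatible with the blocks, and the weights decide. The clause is inherited because T
  meets S in at most \<open>min j (card S)\<close> elements, so equality for the shifted profile
  implies equality for \<rho>.\<close>

lemma weakly_low_step:
  assumes w: "w permutes {1..n}" and T: "T \<subseteq> {1..n}" "card T = j"
    and m: "weakly_low n w \<rho> m"
  shows "weakly_low n w (shift \<rho> j) (m + ind T)"
    and "below n m (rexp n \<rho> w) \<or> T \<noteq> w ` {1..j} \<Longrightarrow>
      below n (m + ind T) (rexp n (shift \<rho> j) w)"
proof -
  let ?T0 = "w ` {1..j}" and ?l = "rexp n \<rho> w" and ?l' = "rexp n (shift \<rho> j) w"
  let ?m0 = "rexp n (wt (desc n w)) w" and ?P0 = "partial (wt (desc n w))"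
  have fin: "finite T" using T finite_subset by blast
  have j: "j \<le> n" using card_mono[OF _ T(1)] T(2) by simp
  have T0: "?T0 \<subseteq> {1..n}" "card ?T0 = j"
    using permutes_image_subset[OF w j] card_permutes_image[OF w] by auto
  have l': "?l' = ?l + ind ?T0" by (rule rexp_shift[OF w j])
  have mm: "keys m \<subseteq> {1..n}" "dominated n \<rho> m" "exp_sq n m \<le> exp_sq n ?l"
    "exp_sq n m = exp_sq n ?l \<Longrightarrow> exp_wt n m \<le> exp_wt n ?l"
    "\<And>S. exp_sq n m = exp_sq n ?l \<Longrightarrow> S \<subseteq> {1..n} \<Longrightarrow> exp_sum m S = partial \<rho> (card S) \<Longrightarrow>
      exp_sum ?m0 S = ?P0 (card S)"
    using m by (auto simp: weakly_low_def)
  have s: "exp_sum m T \<le> partial \<rho> j" using mm(2) T by (auto simp: dominated_def)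
  have sl: "exp_sum ?l ?T0 = partial \<rho> j"
    by (simp add: exp_sum_rexp[OF w T0(1)] inv_image_image[OF w] partial_def)
  have sq: "exp_sq n (m + ind T) = exp_sq n m + 2 * exp_sum m T + j"
    "exp_sq n ?l' = exp_sq n ?l + 2 * partial \<rho> j + j"
    using exp_sq_add_ind[OF T(1)] exp_sq_add_ind[OF T0(1)] T0(2) T(2) sl by (simp_all add: l')
  have ew: "exp_wt n (m + ind T) = exp_wt n m + (\<Sum>t\<in>T. n - t)"
    "exp_wt n ?l' = exp_wt n ?l + (\<Sum>t\<in>?T0. n - t)"
    by (simp_all add: l' exp_wt_add exp_wt_ind[OF T(1)] exp_wt_ind[OF T0(1)])
  have le: "exp_sq n (m + ind T) \<le> exp_sq n ?l'" using sq s mm(3) by linarith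
  have tie: "exp_sq n m = exp_sq n ?l" "exp_sum m T = partial \<rho> j"
    if "exp_sq n (m + ind T) = exp_sq n ?l'" using sq s mm(3) that by linarith+
  have wtT: "(\<Sum>t\<in>T. n - t) < (\<Sum>t\<in>?T0. n - t)"
    if "exp_sq n (m + ind T) = exp_sq n ?l'" "T \<noteq> ?T0"
    using compatible_set_weight[OF w T _ that(2)] mm(5)[OF tie(1)[OF that(1)] T(1)] tie(2)[OF that(1)] T(2)
    by simp
  then have wtT': "(\<Sum>t\<in>T. n - t) \<le> (\<Sum>t\<in>?T0. n - t)"
    if "exp_sq n (m + ind T) = exp_sq n ?l'" using that by (cases "T = ?T0") (auto intro: less_imp_le)
  have sumS: "exp_sum (m + ind T) S = exp_sum m S + card (T \<inter> S)" "card (T \<inter> S) \<le> min j (card S)"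
    "exp_sum m S \<le> partial \<rho> (card S)" if S: "S \<subseteq> {1..n}" for S
  proof -
    have fS: "finite S" using S finite_subset by blast
    show "exp_sum (m + ind T) S = exp_sum m S + card (T \<inter> S)"
      by (simp add: exp_sum_add exp_sum_ind[OF fin fS])
    show "card (T \<inter> S) \<le> min j (card S)" using fin fS T(2) by (auto intro: card_mono)
    show "exp_sum m S \<le> partial \<rho> (card S)" using mm(2) S by (auto simp: dominated_def)
  qed
  have "keys (m + ind T) \<subseteq> {1..n}"
    using Poly_Mapping.keys_add[of m "ind T"] mm(1) T(1) keys_ind[OF fin] by blast
  moreover have "dominated n (shift \<rho> j) (m + ind T)"
    unfolding dominated_def partial_shift using sumS by (metis add_mono)
  moreover have "exp_wt n (m + ind T) \<le> exp_wt n ?l'" if "exp_sq n (m + ind T) = exp_sq n ?l'"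
    using ew wtT'[OF that] mm(4)[OF tie(1)[OF that]] by linarith
  moreover have "exp_sum ?m0 S = ?P0 (card S)"
    if "exp_sq n (m + ind T) = exp_sq n ?l'" "S \<subseteq> {1..n}"
      "exp_sum (m + ind T) S = partial (shift \<rho> j) (card S)" for S
  proof -
    have "exp_sum m S = partial \<rho> (card S)"
      using sumS[OF that(2)] that(3) unfolding partial_shift by linarith
    then show ?thesis by (rule mm(5)[OF tie(1)[OF that(1)] that(2)])
  qed
  ultimately show "weakly_low n w (shift \<rho> j) (m + ind T)" using le by (simp add: weakly_low_def)
  assume "below n m ?l \<or> T \<noteq> ?T0"
  then have b: "exp_wt n m < exp_wt n ?l \<or> T \<noteq> ?T0" if "exp_sq n m = exp_sq n ?l"
    using that by (auto simp: below_def)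
  show "below n (m + ind T) ?l'"
  proof (cases "exp_sq n (m + ind T) = exp_sq n ?l'")
    case True
    note e = True
    have "exp_wt n (m + ind T) < exp_wt n ?l'"
      using b[OF tie(1)[OF e]] ew wtT[OF e] wtT'[OF e] mm(4)[OF tie(1)[OF e]] by linarith
    then show ?thesis using e by (simp add: below_def)
  next
    case False
    then show ?thesis using le by (simp add: below_def)
  qed
qed

lemma leads_mult_elem_sym:
  fixes f :: "('a::field) mpoly"
  assumes w: "w permutes {1..n}" and j: "j \<le> n" and f: "leads n w \<rho> f"
  shows "leads n w (shift \<rho> j) (f * elem_sym j {1..n})"
proof -
  let ?T0 = "w ` {1..j}" and ?l = "rexp n \<rho> w" and ?l' = "rexp n (shift \<rho> j) w"
  define g where "g = f - xp ?l"
  define e where "e = (\<Sum>T\<in>{T. T \<subseteq> {1..n} \<and> card T = j} - {?T0}. xp (ind T) :: 'a mpoly)"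
  have T0: "?T0 \<subseteq> {1..n}" "card ?T0 = j"
    using permutes_image_subset[OF w j] card_permutes_image[OF w] by auto
  have l: "weakly_low n w \<rho> ?l" using f by (simp add: leads_def)
  have g: "weakly_low n w \<rho> m \<and> below n m ?l" if "m \<in> keys g" for m
    using f that by (simp add: leads_def g_def)
  have l': "?l' = ?l + ind ?T0" by (rule rexp_shift[OF w j])
  have es: "elem_sym j {1..n} = xp (ind ?T0) + e"
    unfolding elem_sym_ind[OF finite_atLeastAtMost] e_def
    by (rule sum.remove) (use T0 in auto)
  have ke: "\<exists>T\<subseteq>{1..n}. card T = j \<and> T \<noteq> ?T0 \<and> m = ind T" if "m \<in> keys e" for m
    using that unfolding e_def by (auto dest!: keys_sum_xp)
  \<comment> \<open>Each remaining term comes either from the leading term of f and a set other than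
    \<open>?T0\<close>, or from a lower term of f and any set: the two alternatives in
    \<open>weakly_low_step\<close>.\<close>
  have "f * elem_sym j {1..n} - xp ?l' = xp ?l * e + g * elem_sym j {1..n}"
    unfolding es l' g_def by (simp add: algebra_simps mult_single)
  then have sub: "keys (f * elem_sym j {1..n} - xp ?l') \<subseteq>
      {a + b |a b. a \<in> keys (xp ?l :: 'a mpoly) \<and> b \<in> keys e} \<union>
      {a + b |a b. a \<in> keys g \<and> b \<in> keys (elem_sym j {1..n} :: 'a mpoly)}"
    using Poly_Mapping.keys_add[of "xp ?l * e" "g * elem_sym j {1..n}"]
      keys_mult[of "xp ?l" e] keys_mult[of g "elem_sym j {1..n}"] by auto
  have "weakly_low n w (shift \<rho> j) m \<and> below n m ?l'"
    if m: "m \<in> keys (f * elem_sym j {1..n} - xp ?l')" for m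
  proof -
    consider a b where "a \<in> keys (xp ?l :: 'a mpoly)" "b \<in> keys e" "m = a + b"
      | a b where "a \<in> keys g" "b \<in> keys (elem_sym j {1..n} :: 'a mpoly)"
          "m = a + b"
      using subsetD[OF sub m] by blast
    then show ?thesis
    proof cases
      case 1
      obtain T where T: "T \<subseteq> {1..n}" "card T = j" "T \<noteq> ?T0" "b = ind T" using ke[OF 1(2)] by blast
      have "a = ?l" using 1(1) by simp
      then show ?thesis using weakly_low_step[OF w T(1,2) l] T 1(3) by simp
    next
      case 2
      obtain T where T: "T \<subseteq> {1..n}" "card T = j" "b = ind T"
        using keys_elem_sym[OF finite_atLeastAtMost 2(2)] by blast
      show ?thesis using weakly_low_step[OF w T(1,2)] g[OF 2(1)] T(3) 2(3) by simp
    qed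
  qed
  moreover have "weakly_low n w (shift \<rho> j) ?l'"
    using weakly_low_step(1)[OF w T0 l] l' by simp
  ultimately show ?thesis by (simp add: leads_def)
qed

text \<open>The profile after multiplying by one \<open>elem_sym j\<close> for each j in N. By
  \<open>mwt_Suc\<close> its drop at p is the multiplicity of p in N, plus one if p lies in D, so N
  and the profile determine each other.\<close>

definition mwt :: "nat set \<Rightarrow> nat multiset \<Rightarrow> nat \<Rightarrow> nat" where
  "mwt D N p = wt D p + size (filter_mset (\<lambda>j. p \<le> j) N)"

lemma mwt_empty [simp]: "mwt D {#} = wt D"
  by (rule ext) (simp add: mwt_def)

lemma mwt_add: "mwt D (add_mset j N) = shift (mwt D N) j"
  by (rule ext) (simp add: mwt_def shift_def)

lemma mwt_eq_0:
  assumes "D \<subseteq> {1..<h}" "set_mset N \<subseteq> {1..<h}" "h \<le> p"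
  shows "mwt D N p = 0"
proof -
  have "{i \<in> D. p \<le> i} = {}" using assms by auto
  moreover have "filter_mset (\<lambda>j. p \<le> j) N = {#}"
    by (rule multiset_eqI) (use assms in \<open>auto simp: count_eq_zero_iff\<close>)
  ultimately show ?thesis unfolding mwt_def wt_def by (simp only: card.empty size_empty add_0)
qed

lemma mwt_Suc: "finite D \<Longrightarrow> mwt D N p = mwt D N (Suc p) + (if p \<in> D then 1 else 0) + count N p"
proof (induction N)
  case empty then show ?case using wt_Suc[of D p] by simp
next
  case (add j N) then show ?case by (auto simp: mwt_add shift_def)
qed

section \<open>The family indexed by permutations and multisets, and its leading exponents\<close>

abbreviation lead_exp :: "nat \<Rightarrow> (nat \<Rightarrow> nat) \<Rightarrow> nat multiset \<Rightarrow> (nat \<Rightarrow>\<^sub>0 nat)" where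
  "lead_exp n w N \<equiv> rexp n (mwt (desc n w) N) w"

definition hecke_vec :: "nat \<Rightarrow> (nat \<Rightarrow> nat) \<Rightarrow> ('a::field) mpoly" where
  "hecke_vec n w = foldr T_poly (reduced_word n w) (xp (rexp n (wt (desc n w)) id))"

definition basis_vec :: "nat \<Rightarrow> (nat \<Rightarrow> nat) \<Rightarrow> nat multiset \<Rightarrow> ('a::field) mpoly" where
  "basis_vec n w N = hecke_vec n w * prod_mset (image_mset (\<lambda>j. elem_sym j {1..n}) N)"

lemma basis_vec_empty [simp]: "basis_vec n w {#} = hecke_vec n w"
  by (simp add: basis_vec_def)

lemma basis_vec_add: "basis_vec n w (add_mset j N) = basis_vec n w N * elem_sym j {1..n}"
  by (simp add: basis_vec_def mult_ac)

text \<open>All lower terms lose strictly in the sum of squares, so the tie clauses of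
  \<open>weakly_low\<close> are vacuous for them. For the leading exponent the last clause is
  trivial, the profile being \<open>wt (desc n w)\<close> itself.\<close>

lemma leads_hecke_vec:
  assumes w: "w permutes {1..n}"
  shows "leads n w (wt (desc n w)) (hecke_vec n w :: 'a::field mpoly)"
proof -
  let ?\<rho> = "wt (desc n w)"
  note rw = reduced_word[OF w]
  have "sq_low n ?\<rho> m"
    if "m \<in> keys (hecke_vec n w - (xp (rexp n ?\<rho> w) :: 'a mpoly))" for m
    by (rule foldr_T_poly_lead[OF finite_desc rw(1)]) (use that rw in \<open>simp_all add: hecke_vec_def\<close>)
  moreover have "weakly_low n w ?\<rho> (rexp n ?\<rho> w)"
    unfolding weakly_low_def
    using keys_rexp dominated_rexp[OF w antimono_wt[OF finite_desc]] by auto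
  ultimately show ?thesis
    unfolding leads_def sq_low_def weakly_low_def below_def exp_sq_rexp[OF w]
    by (auto dest: less_imp_le less_imp_neq)
qed

lemma leads_basis_vec:
  assumes w: "w permutes {1..n}"
  shows "set_mset N \<subseteq> {1..n} \<Longrightarrow> leads n w (mwt (desc n w) N) (basis_vec n w N)"
proof (induction N)
  case empty then show ?case using leads_hecke_vec[OF w] by simp
next
  case (add j N)
  then show ?case using leads_mult_elem_sym[OF w, of j] by (simp add: basis_vec_add mwt_add)
qed

lemma sorts_rexp:
  assumes w: "w permutes {1..n}"
  shows "sorts n (lookup (lead_exp n w N)) w"
proof -
  have s: "sorts n (\<lambda>k. mwt (desc n w) N (inv w k)) w"
  proof (rule sorts_comp_inv[OF w])
    fix p
    show "mwt (desc n w) N (Suc p) \<le> mwt (desc n w) N p"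
      using mwt_Suc[OF finite_desc, of n w N p] by linarith
    assume "p \<in> desc n w"
    then show "mwt (desc n w) N (Suc p) < mwt (desc n w) N p"
      using mwt_Suc[OF finite_desc, of n w N p] by simp
  qed
  have l: "lookup (lead_exp n w N) (w p) = mwt (desc n w) N (inv w (w p))"
    if "p \<in> {1..n}" for p
    using that by (simp only: lookup_rexp permutes_in_image[OF w] if_True)
  show ?thesis
    unfolding sorts_def
  proof
    fix p assume p: "p \<in> {1..<n}"
    then have "p \<in> {1..n}" "Suc p \<in> {1..n}" by auto
    then show "lookup (lead_exp n w N) (w (Suc p)) <
        lookup (lead_exp n w N) (w p) \<or>
        lookup (lead_exp n w N) (w p) =
        lookup (lead_exp n w N) (w (Suc p)) \<and> w p < w (Suc p)"
      using s[unfolded sorts_def, rule_format, OF p] by (simp only: l)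
  qed
qed

text \<open>The permutation is recovered as the stable sort of the exponent, and then the multiset
  from the drops of the sorted exponents.\<close>

lemma rexp_mwt_inject:
  assumes w: "w permutes {1..n}" and v: "v permutes {1..n}"
    and N: "set_mset N \<subseteq> {1..<n}" "set_mset M \<subseteq> {1..<n}"
    and eq: "lead_exp n w N = lead_exp n v M"
  shows "w = v \<and> N = M"
proof
  show wv: "w = v" using sorts_unique[OF w v] sorts_rexp[OF w] sorts_rexp[OF v] eq by metis
  have p: "mwt (desc n w) N p = mwt (desc n w) M p" if "p \<in> {1..n}" for p
  proof -
    have "w p \<in> {1..n}" using permutes_in_image[OF w] that by blast
    then have "lookup (lead_exp n w K) (w p) = mwt (desc n w) K p" for K
      by (simp only: lookup_rexp permutes_inverses(2)[OF w] if_True)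
    then show ?thesis using eq wv by metis
  qed
  show "N = M"
  proof (rule multiset_eqI)
    fix j
    show "count N j = count M j"
    proof (cases "j \<in> {1..<n}")
      case True
      then show ?thesis using p[of j] p[of "Suc j"] mwt_Suc[OF finite_desc, of n w _ j] by auto
    next
      case False
      then show ?thesis using N by (metis count_inI subsetD)
    qed
  qed
qed

lemma ex_sorts: "\<exists>w. w permutes {1..n} \<and> sorts n m w"
proof -
  define B where "B = (\<Sum>j\<in>{1..n}. m j)"
  \<comment> \<open>A single numerical key for the stable sort: a larger value of m gives a smaller
    leading digit, and j, being at most n, is the last digit in base \<open>Suc n\<close>.\<close>
  define K where "K j = (B - m j) * Suc n + j" for j
  have mB: "m j \<le> B" if "j \<in> {1..n}" for j
    unfolding B_def using that by (intro member_le_sum) auto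
  have K: "m b < m a \<or> m a = m b \<and> a < b" if "K a < K b" "a \<in> {1..n}" "b \<in> {1..n}" for a b
  proof (rule ccontr)
    assume "\<not> ?thesis"
    then consider "m a < m b" | "m a = m b" "b \<le> a" by linarith
    then show False
    proof cases
      case 1
      then have "Suc (B - m b) \<le> B - m a" using mB[OF that(3)] by linarith
      then have "Suc (B - m b) * Suc n \<le> (B - m a) * Suc n" by (rule mult_le_mono1)
      then have "(B - m b) * Suc n + Suc n \<le> (B - m a) * Suc n" by simp
      then show False using that unfolding K_def by auto
    next
      case 2 then show False using that(1) by (simp add: K_def)
    qed
  qed
  have inj: "inj_on K {1..n}"
  proof (rule inj_onI)
    fix a b assume ab: "a \<in> {1..n}" "b \<in> {1..n}" "K a = K b"
    have "K j mod Suc n = j" if "j \<in> {1..n}" for j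
      using that unfolding K_def by (simp only: mod_mult_self3) simp
    then have "K a mod Suc n = a" "K b mod Suc n = b" using ab(1,2) by blast+
    then show "a = b" using ab(3) by metis
  qed
  then have card: "card (K ` {1..n}) = n" by (simp add: card_image)
  \<comment> \<open>The increasing enumeration of the keys starts at 0, hence the shift
    \<open>p - 1\<close> for positions that start at 1.\<close>
  obtain h where h: "bij_betw h {..<n} (K ` {1..n})" and mono: "strict_mono_on {..<n} h"
    using ex_bij_betw_strict_mono_card[of "K ` {1..n}"] card by auto
  define w where "w p = (if p \<in> {1..n} then inv_into {1..n} K (h (p - 1)) else p)" for p
  have b1: "bij_betw (\<lambda>p. p - 1) {1..n} {..<n}"
    by (rule bij_betw_byWitness[where f' = Suc]) auto
  have "bij_betw (inv_into {1..n} K \<circ> (h \<circ> (\<lambda>p. p - 1))) {1..n} {1..n}"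
    using bij_betw_trans[OF bij_betw_trans[OF b1 h] bij_betw_inv_into[OF inj_on_imp_bij_betw[OF inj]]]
    by simp
  then have bij: "bij_betw w {1..n} {1..n}"
    by (rule bij_betw_cong[THEN iffD1, rotated]) (simp add: w_def)
  have w: "w permutes {1..n}" by (rule bij_imp_permutes[OF bij]) (simp only: w_def if_False)
  have Kw: "K (w p) = h (p - 1)" if "p \<in> {1..n}" for p
  proof -
    have "h (p - 1) \<in> K ` {1..n}" using h b1 that by (auto simp: bij_betw_def)
    then show ?thesis using that by (simp add: w_def f_inv_into_f)
  qed
  have "sorts n m w"
    unfolding sorts_def
  proof
    fix p assume p: "p \<in> {1..<n}"
    have "h (p - 1) < h (Suc p - 1)" using p mono by (auto simp: strict_mono_on_def)
    then have "K (w p) < K (w (Suc p))" using Kw[of p] Kw[of "Suc p"] p by simp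
    then show "m (w (Suc p)) < m (w p) \<or> m (w p) = m (w (Suc p)) \<and> w p < w (Suc p)"
      using p bij by (intro K) (auto simp: bij_betw_def)
  qed
  then show ?thesis using w by blast
qed

text \<open>Take for w the stable sort of m. Fewer than h nonzero exponents means that the sorted
  exponents vanish from position h on, so all descents and all drops occur below h; the drops then
  prescribe N.\<close>

lemma rexp_mwt_surj:
  assumes keys: "keys m \<subseteq> {1..n}" and h: "card (keys m) < h" "h \<le> n"
  shows "\<exists>w N. w permutes {1..n} \<and> desc n w \<subseteq> {1..<h} \<and> set_mset N \<subseteq> {1..<h} \<and>
    m = lead_exp n w N"
proof -
  let ?m = "lookup m"
  obtain w where w: "w permutes {1..n}" and s: "sorts n ?m w" using ex_sorts by blast
  have dec: "?m (w q) \<le> ?m (w p)" if "1 \<le> p" "p \<le> q" "q \<le> n" for p q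
    using that(2,1,3)
  proof (induction q rule: dec_induct)
    case (step q)
    then have "q \<in> {1..<n}" by auto
    then have "?m (w (Suc q)) \<le> ?m (w q)"
      using s[unfolded sorts_def, rule_format, of q] by auto
    then show ?case using step by auto
  qed simp
  have zero: "?m (w p) = 0" if "h \<le> p" "p \<le> n" for p
  proof (rule ccontr)
    assume ne: "?m (w p) \<noteq> 0"
    have "w ` {1..p} \<subseteq> keys m"
    proof clarify
      fix q assume "q \<in> {1..p}"
      then have "?m (w p) \<le> ?m (w q)" using dec[of q p] that by auto
      then show "w q \<in> keys m" using ne by (auto simp: in_keys_iff)
    qed
    then have "card (w ` {1..p}) \<le> card (keys m)" by (intro card_mono) auto
    then show False using card_permutes_image[OF w] h that by simp
  qed
  let ?D = "desc n w"
  have lessD: "?m (w (Suc p)) < ?m (w p)" if "p \<in> ?D" for p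
    using s that by (auto simp: sorts_def desc_def)
  have D: "?D \<subseteq> {1..<h}"
  proof
    fix p assume p: "p \<in> ?D"
    then have "\<not> h \<le> p" using lessD[OF p] zero[of p] by (auto simp: desc_def)
    then show "p \<in> {1..<h}" using p by (auto simp: desc_def)
  qed
  \<comment> \<open>The drop at p minus the unit accounted for by a descent. A descent of the stable
    sort forces a positive drop, so the truncated subtraction is exact.\<close>
  define c where "c p = ?m (w p) - ?m (w (Suc p)) - (if p \<in> ?D then 1 else 0)" for p
  define N where "N = (\<Sum>p\<in>{1..<h}. replicate_mset (c p) p)"
  have cN: "count N p = (if p \<in> {1..<h} then c p else 0)" for p
    by (simp add: N_def count_sum)
  have N: "set_mset N \<subseteq> {1..<h}" using cN by (auto simp: set_mset_def split: if_splits)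
  have high: "mwt ?D N p = 0" if "h \<le> p" for p by (rule mwt_eq_0[OF D N that])
  have low: "mwt ?D N p = ?m (w p)" if "p \<le> h" "1 \<le> p" for p
    using that
  proof (induction p rule: inc_induct)
    case base then show ?case using high[of h] zero[of h] h by simp
  next
    case (step p)
    then have p: "p \<in> {1..<h}" by auto
    have "?m (w (Suc p)) \<le> ?m (w p)" using dec[of p "Suc p"] p h by auto
    moreover have "p \<in> ?D \<Longrightarrow> ?m (w (Suc p)) < ?m (w p)" by (rule lessD)
    ultimately show ?case using step mwt_Suc[OF finite_desc, of n w N p] cN[of p] p by (auto simp: c_def)
  qed
  have "m = rexp n (mwt ?D N) w"
  proof (rule poly_mapping_eqI)
    fix k
    show "?m k = lookup (rexp n (mwt ?D N) w) k"
    proof (cases "k \<in> {1..n}")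
      case True
      then have "inv w k \<in> {1..n}" by (rule inv_permutes_in[OF w])
      then have "mwt ?D N (inv w k) = ?m (w (inv w k))"
        using low[of "inv w k"] high[of "inv w k"] zero[of "inv w k"] by (cases "inv w k \<le> h") auto
      then show ?thesis using True by (simp add: lookup_rexp permutes_inverses(1)[OF w])
    next
      case False
      then have "?m k = 0" using keys by (auto simp: in_keys_iff)
      then show ?thesis using False by (simp only: lookup_rexp if_False)
    qed
  qed
  then show ?thesis using w D N by blast
qed

section \<open>The Tanisaki ideal of a hook\<close>

lemma polysI: "(\<And>m. m \<in> keys f \<Longrightarrow> keys m \<subseteq> {1..n}) \<Longrightarrow> f \<in> polys n"
  by (simp add: polys_def)

lemma polys_add: "f \<in> polys n \<Longrightarrow> g \<in> polys n \<Longrightarrow> f + g \<in> polys n"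
  using Poly_Mapping.keys_add[of f g] by (auto simp: polys_def)

lemma polys_mult:
  assumes "f \<in> polys n" "g \<in> polys n"
  shows "f * g \<in> polys n"
proof (rule polysI)
  fix m assume "m \<in> keys (f * g)"
  then obtain a b where "a \<in> keys f" "b \<in> keys g" "m = a + b"
    using keys_mult[of f g] by blast
  then show "keys m \<subseteq> {1..n}"
    using assms Poly_Mapping.keys_add[of a b] unfolding polys_def by blast
qed

lemma polys_xp: "keys m \<subseteq> {1..n} \<Longrightarrow> xp m \<in> polys n"
  by (rule polysI) simp

lemma polys_const: "const c \<in> polys n"
  by (rule polysI) (simp add: const_def split: if_splits)

lemma polys_0: "0 \<in> polys n"
  by (simp add: polys_def)


lemma polys_sum: "(\<And>x. x \<in> X \<Longrightarrow> F x \<in> polys n) \<Longrightarrow> (\<Sum>x\<in>X. F x) \<in> polys n"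
  by (induction X rule: infinite_finite_induct) (auto intro: polys_add polys_0)

lemma polys_elem_sym:
  assumes "S \<subseteq> {1..n}"
  shows "elem_sym r S \<in> polys n"
proof (rule polysI)
  fix m assume m: "m \<in> keys (elem_sym r S :: 'a mpoly)"
  have fin: "finite S" by (rule finite_subset[OF assms finite_atLeastAtMost])
  obtain T where T: "T \<subseteq> S" "m = ind T" using keys_elem_sym[OF fin m] by auto
  then have "keys m = T" using keys_ind[OF finite_subset[OF T(1) fin]] by simp
  then show "keys m \<subseteq> {1..n}" using T(1) assms by blast
qed

lemma polys_T_poly:
  assumes "i \<in> {1..<n}" "f \<in> polys n"
  shows "T_poly i f \<in> polys n"
proof (rule polysI)
  fix m assume "m \<in> keys (T_poly i f)"
  then obtain m1 where "m1 \<in> keys f" "exp_seg i m1 m" using keys_T_poly by blast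
  then show "keys m \<subseteq> {1..n}"
    using exp_seg_keys[OF assms(1)] assms(2) unfolding polys_def by blast
qed

interpretation mpoly: vector_space "\<lambda>(c::'a::field) (f::'a mpoly). const c * f"
  by unfold_locales
    (simp_all add: const_def single_add mult_single distrib_left distrib_right flip: mult.assoc)

definition has_lead :: "nat \<Rightarrow> ('a::field) mpoly \<Rightarrow> (nat \<Rightarrow>\<^sub>0 nat) \<Rightarrow> bool" where
  "has_lead n f m \<longleftrightarrow> lookup f m = 1 \<and>
     (\<forall>m'\<in>keys f. keys m' \<subseteq> {1..n} \<and> (m' = m \<or> below n m' m))"

lemma below_irrefl: "\<not> below n m m"
  by (simp add: below_def)

lemma below_antisym: "below n m m' \<Longrightarrow> \<not> below n m' m"
  by (auto simp: below_def)

lemma has_lead_in_keys: "has_lead n f m \<Longrightarrow> m \<in> keys f"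
  by (simp add: has_lead_def in_keys_iff)

lemma has_lead_unique: "has_lead n f m \<Longrightarrow> has_lead n f m' \<Longrightarrow> m = m'"
  using has_lead_in_keys below_antisym unfolding has_lead_def by metis

lemma leads_imp_has_lead:
  fixes f :: "('a::field) mpoly"
  assumes "leads n w \<rho> f"
  shows "has_lead n f (rexp n \<rho> w)"
proof -
  let ?l = "rexp n \<rho> w"
  define g where "g = f - xp ?l"
  have g: "keys m \<subseteq> {1..n} \<and> below n m ?l" if "m \<in> keys g" for m
    using assms that by (simp add: leads_def g_def weakly_low_def)
  have f: "f = xp ?l + g" by (simp add: g_def)
  have "lookup g ?l = 0" using g below_irrefl by (metis in_keys_iff)
  then have "lookup f ?l = 1" by (simp add: f lookup_add)
  moreover have "m = ?l \<or> m \<in> keys g" if "m \<in> keys f" for m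
    using that Poly_Mapping.keys_add[of "xp ?l" g] unfolding f by auto
  ultimately show ?thesis using g keys_rexp unfolding has_lead_def by metis
qed

lemma has_lead_xp: "keys m \<subseteq> {1..n} \<Longrightarrow> has_lead n (xp m) m"
  by (simp add: has_lead_def)

lemma ex_max_nat:
  fixes g :: "'b \<Rightarrow> nat"
  assumes "finite S" "S \<noteq> {}"
  shows "\<exists>x\<in>S. \<forall>y\<in>S. g y \<le> g x"
proof -
  have "Max (g ` S) \<in> g ` S" using assms by (intro Max_in) auto
  then obtain x where "x \<in> S" "g x = Max (g ` S)" by auto
  then show ?thesis using assms by (auto intro!: bexI[of _ x])
qed

text \<open>Among the vectors with nonzero coefficient choose one whose lead is maximal, first for
  \<open>exp_sq\<close> and then for \<open>exp_wt\<close>. Its lead occurs in no other vector of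
  the combination: it would have to be the lead of that vector, which injectivity excludes, or lie
  below it, which maximality excludes. Incomparable leads do no harm.\<close>

lemma independent_of_leads:
  fixes B :: "('a::field) mpoly set"
  assumes lead: "\<And>b. b \<in> B \<Longrightarrow> has_lead n b (l b)" and inj: "inj_on l B"
  shows "\<not> mpoly.dependent B"
proof
  assume "mpoly.dependent B"
  then obtain S u where S: "finite S" "S \<subseteq> B" "(\<Sum>v\<in>S. const (u v) * v) = 0" "\<exists>v\<in>S. u v \<noteq> 0"
    unfolding mpoly.dependent_explicit by blast
  define X where "X = {v \<in> S. u v \<noteq> 0}"
  have X: "finite X" "X \<noteq> {}" using S by (auto simp: X_def)
  obtain v1 where v1: "v1 \<in> X" "\<forall>v\<in>X. exp_sq n (l v) \<le> exp_sq n (l v1)"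
    using ex_max_nat[OF X, of "\<lambda>v. exp_sq n (l v)"] by blast
  define Y where "Y = {v \<in> X. exp_sq n (l v) = exp_sq n (l v1)}"
  have Y: "finite Y" "Y \<noteq> {}" using X v1 by (auto simp: Y_def)
  obtain v0 where v0: "v0 \<in> Y" "\<forall>v\<in>Y. exp_wt n (l v) \<le> exp_wt n (l v0)"
    using ex_max_nat[OF Y, of "\<lambda>v. exp_wt n (l v)"] by blast
  have max: "\<not> below n (l v0) (l v)" if "v \<in> X" for v
  proof
    assume b: "below n (l v0) (l v)"
    have sq: "exp_sq n (l v0) = exp_sq n (l v1)" using v0 by (simp add: Y_def)
    have "exp_sq n (l v) \<le> exp_sq n (l v1)" using v1 that by blast
    then have "exp_sq n (l v) = exp_sq n (l v1)" "exp_wt n (l v0) < exp_wt n (l v)"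
      using b sq by (auto simp: below_def)
    then show False using v0(2) that by (auto simp: Y_def not_le)
  qed
  have v0S: "v0 \<in> S" "u v0 \<noteq> 0" using v0 by (auto simp: Y_def X_def)
  have "u v * lookup v (l v0) = (if v = v0 then u v0 else 0)" if v: "v \<in> S" for v
  proof (cases "v = v0")
    case True
    then show ?thesis using lead[of v0] v0S S by (auto simp: has_lead_def)
  next
    case False
    have "lookup v (l v0) = 0" if "u v \<noteq> 0"
    proof (rule ccontr)
      assume "lookup v (l v0) \<noteq> 0"
      then have "l v0 \<in> keys v" by (simp add: in_keys_iff)
      then have "l v0 = l v \<or> below n (l v0) (l v)"
        using lead[of v] v S(2) unfolding has_lead_def by blast
      moreover have "v \<in> X" using v that by (simp add: X_def)
      ultimately have "l v0 = l v" using max by blast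
      then have "v0 = v" by (rule inj_onD[OF inj]) (use v v0S S(2) in auto)
      then show False using False by simp
    qed
    then show ?thesis using False by auto
  qed
  then have "(\<Sum>v\<in>S. u v * lookup v (l v0)) = u v0"
    using v0S S(1) by simp
  moreover have "(\<Sum>v\<in>S. u v * lookup v (l v0)) = lookup (\<Sum>v\<in>S. const (u v) * v) (l v0)"
    by (simp add: lookup_sum lookup_const_mult)
  ultimately show False using S(3) v0S by simp
qed

section \<open>A basis of all polynomials adapted to the ideal\<close>

definition high_exps :: "nat \<Rightarrow> nat \<Rightarrow> (nat \<Rightarrow>\<^sub>0 nat) set" where
  "high_exps n h = {m. keys m \<subseteq> {1..n} \<and> h \<le> card (keys m)}"

definition hook_perms :: "nat \<Rightarrow> nat \<Rightarrow> (nat \<Rightarrow> nat) set" where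
  "hook_perms n h = {w. w permutes {1..n} \<and> desc n w \<subseteq> {1..<h}}"

definition ideal_basis :: "nat \<Rightarrow> nat \<Rightarrow> ('a::field) mpoly set" where
  "ideal_basis n h =
    {basis_vec n w N |w N. w \<in> hook_perms n h \<and> set_mset N \<subseteq> {1..<h} \<and> N \<noteq> {#}} \<union> xp ` high_exps n h"

lemma basis_vec_in_ideal_basis:
  "w \<in> hook_perms n h \<Longrightarrow> set_mset N \<subseteq> {1..<h} \<Longrightarrow> N \<noteq> {#} \<Longrightarrow>
    basis_vec n w N \<in> ideal_basis n h"
  unfolding ideal_basis_def by blast

lemma finite_hook_perms: "finite (hook_perms n h)"
  by (rule finite_subset[OF _ finite_permutations[of "{1..n}"]]) (auto simp: hook_perms_def)

lemma basis_cases: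
  assumes "b \<in> hecke_vec n ` hook_perms n h \<union> ideal_basis n h"
  obtains (low) w N where "w \<in> hook_perms n h" "set_mset N \<subseteq> {1..<h}" "b = basis_vec n w N"
  | (high) m where "m \<in> high_exps n h" "b = xp m"
  using assms
proof
  assume "b \<in> hecke_vec n ` hook_perms n h"
  then obtain w where "w \<in> hook_perms n h" "b = basis_vec n w {#}" by auto
  then show ?thesis using low[of w "{#}"] by simp
next
  assume "b \<in> ideal_basis n h"
  then show ?thesis using low high unfolding ideal_basis_def by blast
qed

lemma basis_vec_lead:
  assumes "w \<in> hook_perms n h" "set_mset N \<subseteq> {1..<h}" "h \<le> n"
  shows "has_lead n (basis_vec n w N) (lead_exp n w N)"
  by (rule leads_imp_has_lead, rule leads_basis_vec) (use assms in \<open>auto simp: hook_perms_def\<close>)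

lemma rexp_mwt_not_high:
  assumes w: "w \<in> hook_perms n h" and N: "set_mset N \<subseteq> {1..<h}" and h: "1 \<le> h"
  shows "lead_exp n w N \<notin> high_exps n h"
proof -
  have p: "w permutes {1..n}" and D: "desc n w \<subseteq> {1..<h}" using w by (auto simp: hook_perms_def)
  have zero: "mwt (desc n w) N p = 0" if "h \<le> p" for p by (rule mwt_eq_0[OF D N that])
  have "keys (lead_exp n w N) \<subseteq> w ` {1..<h}"
  proof
    fix k assume "k \<in> keys (lead_exp n w N)"
    then have ne: "lookup (lead_exp n w N) k \<noteq> 0"
      by (simp only: in_keys_iff) simp
    have k1: "k \<in> {1..n}" by (rule ccontr) (use ne in \<open>simp only: lookup_rexp if_False\<close>)
    have eq: "lookup (lead_exp n w N) k = mwt (desc n w) N (inv w k)"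
      using k1 by (simp only: lookup_rexp if_True)
    have "\<not> h \<le> inv w k"
    proof
      assume "h \<le> inv w k"
      then have "mwt (desc n w) N (inv w k) = 0" by (rule zero)
      then show False using ne eq by metis
    qed
    moreover have "1 \<le> inv w k" using inv_permutes_in[OF p k1] by simp
    ultimately have "inv w k \<in> {1..<h}" by simp
    then show "k \<in> w ` {1..<h}" using permutes_inverses(1)[OF p, of k] by (metis image_eqI)
  qed
  then have "card (keys (lead_exp n w N)) \<le> card (w ` {1..<h})"
    by (intro card_mono) auto
  also have "card (w ` {1..<h}) = h - 1" by (simp add: card_permutes_image[OF p])
  finally have "card (keys (lead_exp n w N)) < h" using h by linarith
  then show ?thesis by (simp add: high_exps_def)
qed

lemma basis_vec_inject:
  assumes "w \<in> hook_perms n h" "set_mset N \<subseteq> {1..<h}" "v \<in> hook_perms n h" "set_mset M \<subseteq> {1..<h}"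
    and h: "h \<le> n" and eq: "lead_exp n w N = lead_exp n v M"
  shows "w = v \<and> N = M"
proof -
  have "{1..<h} \<subseteq> {1..<n}" using h by auto
  then show ?thesis
    using rexp_mwt_inject[of w n v N M] assms unfolding hook_perms_def by blast
qed

lemma independent_basis:
  assumes h: "1 \<le> h" "h \<le> n"
  shows "\<not> mpoly.dependent (hecke_vec n ` hook_perms n h \<union> ideal_basis n h :: 'a::field mpoly set)"
proof -
  let ?B = "hecke_vec n ` hook_perms n h \<union> ideal_basis n h :: 'a mpoly set"
  \<comment> \<open>The choice is harmless because leads are unique: \<open>l\<close> takes the
    value \<open>lead_exp n w N\<close> or m according to the kind of b, and these values identify
    b.\<close>
  define l where "l b = (SOME m. has_lead n b m)" for b :: "'a mpoly"
  have ex: "\<exists>m. has_lead n b m" if "b \<in> ?B" for b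
    using that
  proof (cases rule: basis_cases)
    case (low w N) then show ?thesis using basis_vec_lead[OF low(1,2) h(2)] by blast
  next
    case (high m) then show ?thesis using has_lead_xp unfolding high_exps_def by blast
  qed
  have l: "has_lead n b (l b)" if "b \<in> ?B" for b
    unfolding l_def using ex[OF that] by (rule someI_ex)
  have l_low: "l (basis_vec n w N) = lead_exp n w N"
    if "w \<in> hook_perms n h" "set_mset N \<subseteq> {1..<h}" "basis_vec n w N \<in> ?B" for w N
    using has_lead_unique[OF l[OF that(3)] basis_vec_lead[OF that(1,2) h(2)]] .
  have l_high: "l (xp m) = m" if "m \<in> high_exps n h" "xp m \<in> ?B" for m
    using has_lead_unique[OF l[OF that(2)] has_lead_xp] that(1) by (simp add: high_exps_def)
  have "inj_on l ?B"
  proof (rule inj_onI)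
    fix b b' assume b: "b \<in> ?B" and b': "b' \<in> ?B" and eq: "l b = l b'"
    from b show "b = b'"
    proof (cases rule: basis_cases)
      case (low w N)
      note 1 = low l_low[OF low(1,2)]
      from b' show ?thesis
      proof (cases rule: basis_cases)
        case (low v M)
        then show ?thesis
          using 1 l_low[OF low(1,2)] basis_vec_inject[OF 1(1,2) low(1,2) h(2)] eq b b' by metis
      next
        case (high m)
        then show ?thesis using 1 l_high[OF high(1)] rexp_mwt_not_high[OF 1(1,2) h(1)] eq b b' by metis
      qed
    next
      case (high m)
      note 1 = high l_high[OF high(1)]
      from b' show ?thesis
      proof (cases rule: basis_cases)
        case (low v M)
        then show ?thesis using 1 l_low[OF low(1,2)] rexp_mwt_not_high[OF low(1,2) h(1)] eq b b' by metis
      next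
        case (high m')
        then show ?thesis using 1 l_high[OF high(1)] eq b b' by metis
      qed
    qed
  qed
  then show ?thesis using independent_of_leads[OF l] by blast
qed

text \<open>Straightening: subtract the basis vector that leads with m, and apply induction to the
  terms that remain. The comparison \<open>below\<close> is well founded as the inverse image of a
  lexicographic product.\<close>

lemma xp_in_span_basis:
  assumes h: "1 \<le> h" "h \<le> n"
  shows "keys m \<subseteq> {1..n} \<Longrightarrow>
    xp m \<in> mpoly.span (hecke_vec n ` hook_perms n h \<union> ideal_basis n h :: 'a::field mpoly set)"
proof -
  let ?B = "hecke_vec n ` hook_perms n h \<union> ideal_basis n h :: 'a mpoly set"
  define r where "r = inv_image (less_than <*lex*> less_than) (\<lambda>m. (exp_sq n m, exp_wt n m))"
  have wf: "wf r" unfolding r_def by (intro wf_inv_image wf_lex_prod wf_less_than)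
  have r: "(m, m') \<in> r \<longleftrightarrow> below n m m'" for m m'
    by (auto simp: r_def below_def)
  show "keys m \<subseteq> {1..n} \<Longrightarrow> xp m \<in> mpoly.span ?B"
  proof (induction m rule: wf_induct_rule[OF wf])
    case (1 m)
    show ?case
    proof (cases "h \<le> card (keys m)")
      case True
      then have "xp m \<in> ?B" using 1(2) by (auto simp: ideal_basis_def high_exps_def)
      then show ?thesis by (rule mpoly.span_base)
    next
      case False
      then obtain w N where w: "w permutes {1..n}" "desc n w \<subseteq> {1..<h}" and N: "set_mset N \<subseteq> {1..<h}"
        and m: "m = lead_exp n w N"
        using rexp_mwt_surj[OF 1(2) _ h(2)] by (meson not_le)
      have wh: "w \<in> hook_perms n h" using w by (simp add: hook_perms_def)
      define b where "b = (basis_vec n w N :: 'a mpoly)"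
      have bB: "b \<in> ?B"
      proof (cases "N = {#}")
        case True then show ?thesis using wh by (simp add: b_def)
      next
        case False
        then have "b \<in> ideal_basis n h" unfolding ideal_basis_def b_def using wh N by blast
        then show ?thesis by blast
      qed
      have "set_mset N \<subseteq> {1..n}" using N h(2) by auto
      then have "leads n w (mwt (desc n w) N) b" unfolding b_def by (rule leads_basis_vec[OF w(1)])
      then have low: "keys k \<subseteq> {1..n} \<and> below n k m" if "k \<in> keys (b - xp m)" for k
        using that unfolding leads_def weakly_low_def m by blast
      have "b - xp m = (\<Sum>k\<in>keys (b - xp m).
          const (lookup (b - xp m) k) * xp k)" by (rule poly_sum_xp)
      also have "\<dots> \<in> mpoly.span ?B"
        by (intro mpoly.span_sum mpoly.span_scale 1(1)) (use low r in auto)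
      finally have "b - (b - xp m) \<in> mpoly.span ?B"
        by (rule mpoly.span_diff[OF mpoly.span_base[OF bB]])
      then show ?thesis by simp
    qed
  qed
qed

lemma polys_subset_span:
  assumes h: "1 \<le> h" "h \<le> n" and f: "f \<in> polys n"
  shows "f \<in> mpoly.span (hecke_vec n ` hook_perms n h \<union> ideal_basis n h :: 'a::field mpoly set)"
  by (subst poly_sum_xp, intro mpoly.span_sum mpoly.span_scale xp_in_span_basis[OF h])
    (use f in \<open>auto simp: polys_def\<close>)

lemma high_in_span:
  assumes "\<And>m. m \<in> keys f \<Longrightarrow> m \<in> high_exps n h"
  shows "f \<in> mpoly.span (ideal_basis n h :: 'a::field mpoly set)"
  by (subst poly_sum_xp, intro mpoly.span_sum mpoly.span_scale mpoly.span_base)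
    (use assms in \<open>auto simp: ideal_basis_def\<close>)

lemma keys_add_nat:
  fixes a b :: "nat \<Rightarrow>\<^sub>0 nat"
  shows "keys (a + b) = keys a \<union> keys b"
  by (auto simp: in_keys_iff lookup_add)

lemma high_exps_add:
  assumes "a \<in> high_exps n h" "keys b \<subseteq> {1..n}"
  shows "a + b \<in> high_exps n h"
proof -
  have "card (keys a) \<le> card (keys (a + b))"
    by (rule card_mono) (auto simp: keys_add_nat)
  then show ?thesis using assms by (auto simp: high_exps_def keys_add_nat)
qed

text \<open>Written increasingly, the conjugate consists of h - 1 zeros, n - h ones and finally h:
  any nonzero part counts for \<open>k = n\<close>, and for smaller k at most the long row
  \<open>n - h + 1\<close> reaches the threshold.\<close>

lemma conj_part_hook:
  assumes h: "1 \<le> h" "h \<le> n" and k: "1 \<le> k" "k \<le> n"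
  shows "conj_part n (hook n h) k = (if k = n then h else if k < h then 0 else 1)"
proof -
  consider "k = n" | "k < h" "k \<noteq> n" | "h \<le> k" "k < n" using k by linarith
  then show ?thesis
  proof cases
    case 1
    then have "{i \<in> {1..n}. n + 1 - k \<le> hook n h i} = {n - h<..n}"
      using h by (auto simp: hook_def)
    then show ?thesis using 1 h by (simp add: conj_part_def)
  next
    case 2
    then have "{i \<in> {1..n}. n + 1 - k \<le> hook n h i} = {}"
      using h by (auto simp: hook_def)
    then show ?thesis using 2 by (simp only: conj_part_def) simp
  next
    case 3
    then have "{i \<in> {1..n}. n + 1 - k \<le> hook n h i} = {n}"
      using h by (auto simp: hook_def)
    then show ?thesis using 3 by (simp only: conj_part_def) simp
  qed
qed

text \<open>Below n the sum counts the ones among the first k parts; truncated subtraction gives 0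
  for \<open>k < h\<close>. The last part h completes the total to n.\<close>

lemma d_part_hook:
  assumes h: "1 \<le> h" "h \<le> n" and k: "k \<le> n"
  shows "d_part n (hook n h) k = (if k = n then n else k + 1 - h)"
proof -
  have lt: "k < n \<Longrightarrow> d_part n (hook n h) k = k + 1 - h" for k
  proof (induction k)
    case 0 then show ?case using h by (simp add: d_part_def)
  next
    case (Suc k)
    then have "d_part n (hook n h) (Suc k) = (k + 1 - h) + (if Suc k < h then 0 else 1)"
      using conj_part_hook[OF h, of "Suc k"] by (simp add: d_part_def)
    then show ?case by auto
  qed
  show ?thesis
  proof (cases "k = n")
    case True
    obtain n' where n': "n = Suc n'" using h by (cases n) auto
    have "d_part n (hook n h) n = d_part n (hook n h) n' + conj_part n (hook n h) n"
      by (simp add: d_part_def n')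
    also have "\<dots> = n' + 1 - h + h" using lt[of n'] conj_part_hook[OF h, of n] n' h by simp
    finally show ?thesis using True h n' by simp
  next
    case False then show ?thesis using lt k by simp
  qed
qed

section \<open>The generators for a hook and the span of the ideal basis\<close>

definition hook_gens :: "nat \<Rightarrow> nat \<Rightarrow> ('a::field) mpoly set" where
  "hook_gens n h = {elem_sym r S | r S. S \<subseteq> {1..n} \<and> r \<le> card S \<and>
     (if S = {1..n} then 1 \<le> r else h \<le> r)}"

text \<open>For a proper subset with k elements and \<open>h \<le> k\<close> the bound
  \<open>k - d_k\<close> equals h - 1. For \<open>k < h\<close> both forms of the condition
  contradict \<open>r \<le> k\<close>. Only the full set has bound 0 and so contributes every
  positive degree.\<close>

lemma tanisaki_hook:
  assumes h: "1 \<le> h" "h \<le> n"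
  shows "tanisaki n (hook n h) = gen_ideal n (hook_gens n h)"
proof -
  have "int (card S) - int (d_part n (hook n h) (card S)) < int r \<longleftrightarrow>
      (if S = {1..n} then 1 \<le> r else h \<le> r)" if S: "S \<subseteq> {1..n}" "r \<le> card S" for r S
  proof -
    have "card S \<le> n" using card_mono[OF _ S(1)] by simp
    moreover have "S = {1..n} \<longleftrightarrow> card S = n"
      using card_subset_eq[OF _ S(1)] by auto
    ultimately show ?thesis using d_part_hook[OF h, of "card S"] S(2) by auto
  qed
  then have "{elem_sym r S | r S. S \<subseteq> {1..n} \<and> r \<le> card S
        \<and> int r > int (card S) - int (d_part n (hook n h) (card S))} = (hook_gens n h :: 'a mpoly set)"
    unfolding hook_gens_def by blast
  then show ?thesis by (simp only: tanisaki_def)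
qed

lemma gen_idealE:
  assumes "f \<in> gen_ideal n G"
  obtains k C F where "f = (\<Sum>j<(k::nat). C j * F j)" "\<forall>j<k. C j \<in> polys n \<and> F j \<in> G"
  using assms unfolding gen_ideal_def by auto

lemma gen_idealI:
  "f = (\<Sum>j<(k::nat). C j * F j) \<Longrightarrow> \<forall>j<k. C j \<in> polys n \<and> F j \<in> G \<Longrightarrow> f \<in> gen_ideal n G"
  unfolding gen_ideal_def by (intro CollectI exI conjI)

lemma gen_ideal_0: "0 \<in> gen_ideal n G"
  unfolding gen_ideal_def by (auto intro!: exI[of _ "0::nat"])

lemma gen_ideal_add_term:
  assumes "f \<in> gen_ideal n G" "c \<in> polys n" "g \<in> G"
  shows "f + c * g \<in> gen_ideal n G"
proof -
  obtain k :: nat and C F where f: "f = (\<Sum>j<k. C j * F j)" and C: "\<forall>j<k. C j \<in> polys n \<and> F j \<in> G"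
    using assms(1) by (rule gen_idealE)
  have "f + c * g = (\<Sum>j<Suc k. (C(k := c)) j * (F(k := g)) j)" using f by simp
  moreover have "\<forall>j<Suc k. (C(k := c)) j \<in> polys n \<and> (F(k := g)) j \<in> G"
    using C assms(2,3) by (auto simp: less_Suc_eq)
  ultimately show ?thesis by (rule gen_idealI)
qed

lemma gen_ideal_sum:
  assumes "f \<in> gen_ideal n G" "\<And>j. j < k \<Longrightarrow> C j \<in> polys n \<and> F j \<in> G"
  shows "f + (\<Sum>j<(k::nat). C j * F j) \<in> gen_ideal n G"
  using assms(2)
proof (induction k)
  case (Suc k)
  then show ?case
    using gen_ideal_add_term[of "f + (\<Sum>j<k. C j * F j)" n G "C k" "F k"] by (simp add: add.assoc)
qed (simp add: assms(1))

lemma gen_ideal_add: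
  assumes "f \<in> gen_ideal n G" "g \<in> gen_ideal n G"
  shows "f + g \<in> gen_ideal n G"
proof -
  obtain k :: nat and C F where "g = (\<Sum>j<k. C j * F j)" "\<forall>j<k. C j \<in> polys n \<and> F j \<in> G"
    using assms(2) by (rule gen_idealE)
  then show ?thesis using gen_ideal_sum[OF assms(1)] by blast
qed

lemma gen_ideal_mult:
  assumes "f \<in> gen_ideal n G" "c \<in> polys n"
  shows "c * f \<in> gen_ideal n G"
proof -
  obtain k :: nat and C F where f: "f = (\<Sum>j<k. C j * F j)" and C: "\<forall>j<k. C j \<in> polys n \<and> F j \<in> G"
    using assms(1) by (rule gen_idealE)
  have "c * f = (\<Sum>j<k. (c * C j) * F j)" by (simp add: f sum_distrib_left mult.assoc)
  moreover have "\<forall>j<k. c * C j \<in> polys n \<and> F j \<in> G" using C assms(2) polys_mult by blast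
  ultimately show ?thesis by (rule gen_idealI)
qed

lemma gen_ideal_gen:
  assumes "g \<in> G" "c \<in> polys n"
  shows "c * g \<in> gen_ideal n G"
  using gen_ideal_add_term[OF gen_ideal_0 assms(2,1)] by simp

lemma basis_vec_in_polys:
  assumes "w \<in> hook_perms n h" "set_mset N \<subseteq> {1..<h}" "h \<le> n"
  shows "basis_vec n w N \<in> polys n"
  using basis_vec_lead[OF assms] by (auto simp: has_lead_def polys_def)

lemma ideal_basis_subset:
  assumes h: "1 \<le> h" "h \<le> n"
  shows "ideal_basis n h \<subseteq> (gen_ideal n (hook_gens n h) :: 'a::field mpoly set)"
proof
  fix b :: "'a mpoly" assume "b \<in> ideal_basis n h"
  then consider w N where "w \<in> hook_perms n h" "set_mset N \<subseteq> {1..<h}" "N \<noteq> {#}" "b = basis_vec n w N"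
    | m where "m \<in> high_exps n h" "b = xp m"
    unfolding ideal_basis_def by blast
  then show "b \<in> gen_ideal n (hook_gens n h)"
  proof cases
    case 1
    then obtain j M where N: "N = add_mset j M" by (meson multiset_cases)
    have j: "j \<in> {1..<h}" "set_mset M \<subseteq> {1..<h}" using 1(2) N by auto
    have "elem_sym j {1..n} \<in> (hook_gens n h :: 'a mpoly set)"
      using j h unfolding hook_gens_def
      by (intro CollectI exI[of _ j] exI[of _ "{1..n}"]) auto
    then show ?thesis
      using gen_ideal_gen basis_vec_in_polys[OF 1(1) j(2) h(2)] by (simp add: 1(4) N basis_vec_add)
  next
    case 2
    obtain T where T: "T \<subseteq> keys m" "card T = h" "finite T"
      using 2(1) obtain_subset_with_card_n[of h "keys m"] unfolding high_exps_def by blast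
    have Tn: "T \<subseteq> {1..n}" using T 2(1) by (auto simp: high_exps_def)
    \<comment> \<open>The difference of exponents is truncated pointwise; it is exact because T lies
      in the support of m.\<close>
    have m: "m = (m - ind T) + ind T"
    proof (rule poly_mapping_eqI)
      fix k show "lookup m k = lookup (m - ind T + ind T) k"
        using T by (auto simp: lookup_add lookup_minus lookup_ind in_keys_iff)
    qed
    \<comment> \<open>With exactly h variables the polynomial of degree h is a single squarefree
      monomial, so every monomial in at least h variables is a multiple of a generator.\<close>
    have "{U. U \<subseteq> T \<and> card U = h} = {T}"
      using T card_subset_eq[OF T(3)] by auto
    then have "elem_sym h T = (xp (ind T) :: 'a mpoly)" by (simp add: elem_sym_ind[OF T(3)])
    moreover have "elem_sym h T \<in> (hook_gens n h :: 'a mpoly set)"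
      unfolding hook_gens_def
      by (rule CollectI, rule exI[of _ h], rule exI[of _ T]) (use T Tn h in auto)
    moreover have "xp (m - ind T) \<in> (polys n :: 'a mpoly set)"
    proof (rule polys_xp)
      have "keys (m - ind T) \<subseteq> keys m"
        by (auto simp: in_keys_iff lookup_minus)
      then show "keys (m - ind T) \<subseteq> {1..n}" using 2(1) by (auto simp: high_exps_def)
    qed
    moreover have "b = xp (m - ind T) * xp (ind T)" using 2(2) m by (simp add: mult_single flip: m)
    ultimately show ?thesis using gen_ideal_gen by metis
  qed
qed

text \<open>Expand f in the basis of all polynomials: a product vector gains one more factor and so
  acquires a nonempty multiset, and a monomial in at least h variables only gains further
  variables.\<close>

lemma mult_elem_sym_in_span:
  assumes h: "1 \<le> h" "h \<le> n" and r: "1 \<le> r" "r < h" and f: "f \<in> polys n"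
  shows "f * elem_sym r {1..n} \<in> mpoly.span (ideal_basis n h :: 'a::field mpoly set)"
  using polys_subset_span[OF h f]
proof (induction rule: mpoly.span_induct_alt)
  case base then show ?case by (simp add: mpoly.span_zero)
next
  case (step c b y)
  have "b * elem_sym r {1..n} \<in> mpoly.span (ideal_basis n h)"
    using step(1)
  proof (cases rule: basis_cases)
    case (low w N)
    have "set_mset (add_mset r N) \<subseteq> {1..<h}" using low(2) r by auto
    then have "basis_vec n w (add_mset r N) \<in> (ideal_basis n h :: 'a mpoly set)"
      by (intro basis_vec_in_ideal_basis[OF low(1)]) simp_all
    then show ?thesis using mpoly.span_base by (simp add: low(3) basis_vec_add)
  next
    case (high m)
    show ?thesis
    proof (rule high_in_span)
      fix k assume "k \<in> keys (b * elem_sym r {1..n})"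
      then obtain a where a: "a \<in> keys (elem_sym r {1..n} :: 'a mpoly)" "k = m + a"
        using keys_mult[of b "elem_sym r {1..n}"] by (auto simp: high(2))
      have "keys a \<subseteq> {1..n}"
        using polys_elem_sym[of "{1..n}" n r, where 'a = 'a] a(1) by (auto simp: polys_def)
      then show "k \<in> high_exps n h" using high_exps_add[OF high(1)] a(2) by blast
    qed
  qed
  then have "const c * (b * elem_sym r {1..n}) + y * elem_sym r {1..n} \<in> mpoly.span (ideal_basis n h)"
    by (intro mpoly.span_add mpoly.span_scale step(2))
  then show ?case by (simp add: distrib_right mult.assoc)
qed

lemma gen_ideal_eq_span:
  assumes h: "1 \<le> h" "h \<le> n"
  shows "gen_ideal n (hook_gens n h) = mpoly.span (ideal_basis n h :: 'a::field mpoly set)"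
proof
  show "mpoly.span (ideal_basis n h) \<subseteq> (gen_ideal n (hook_gens n h) :: 'a mpoly set)"
  proof (rule mpoly.span_minimal[OF ideal_basis_subset[OF h]])
    show "mpoly.subspace (gen_ideal n (hook_gens n h) :: 'a mpoly set)"
      by (rule mpoly.subspaceI) (auto intro: gen_ideal_0 gen_ideal_add gen_ideal_mult polys_const)
  qed
  show "(gen_ideal n (hook_gens n h) :: 'a mpoly set) \<subseteq> mpoly.span (ideal_basis n h)"
  proof
    fix f :: "'a mpoly" assume "f \<in> gen_ideal n (hook_gens n h)"
    then obtain k :: nat and C F where f: "f = (\<Sum>j<k. C j * F j)"
      and C: "\<forall>j<k. C j \<in> polys n \<and> F j \<in> (hook_gens n h :: 'a mpoly set)"
      by (rule gen_idealE)
    have "c * g \<in> mpoly.span (ideal_basis n h)"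
      if c: "c \<in> polys n" and "g \<in> hook_gens n h" for c g :: "'a mpoly"
    proof -
      obtain r S where g: "g = elem_sym r S" and S: "S \<subseteq> {1..n}" "r \<le> card S"
        and rS: "if S = {1..n} then 1 \<le> r else h \<le> r"
        using \<open>g \<in> hook_gens n h\<close> unfolding hook_gens_def by blast
      show ?thesis
      proof (cases "h \<le> r")
        case True
        have fS: "finite S" using S finite_subset by blast
        show ?thesis
        proof (rule high_in_span)
          fix m assume "m \<in> keys (c * g)"
          then obtain a b where ab: "a \<in> keys c" "b \<in> keys g" "m = a + b"
            using keys_mult[of c g] by blast
          obtain T where T: "T \<subseteq> S" "card T = r" "b = ind T"
            using keys_elem_sym[OF fS] ab(2) g by blast
          have fT: "finite T" using T fS finite_subset by blast
          have "b \<in> high_exps n h" using T True S keys_ind[OF fT] by (auto simp: high_exps_def)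
          then show "m \<in> high_exps n h"
            using high_exps_add[of b n h a] ab c by (auto simp: polys_def add.commute)
        qed
      next
        case False
        then have "S = {1..n}" "1 \<le> r" using rS by (auto split: if_splits)
        then show ?thesis using mult_elem_sym_in_span[OF h _ _ c, of r] False g by simp
      qed
    qed
    then show "f \<in> mpoly.span (ideal_basis n h)" unfolding f using C by (intro mpoly.span_sum) auto
  qed
qed

section \<open>Stability of the ideal under the Demazure operators\<close>

lemma swap_poly_elem_sym:
  assumes i: "i \<in> {1..<n}"
  shows "swap_poly i (elem_sym r {1..n}) = elem_sym r {1..n}"
proof -
  have img: "sw i ` {1..n} = {1..n}" by (rule permutes_image[OF sw_permutes[OF i]])
  have inj: "inj_on (sw i) T" for T by (rule inj_on_inverseI[of _ "sw i"]) simp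
  have ii: "sw i ` sw i ` T = T" for T by (simp add: image_image)
  have s: "swap_poly i (xp (ind T)) = xp (ind (sw i ` T))" if "T \<subseteq> {1..n}" for T
  proof -
    have fin: "finite T" using that finite_subset by blast
    have "swap_exp i (ind T) = ind (sw i ` T)"
    proof (rule poly_mapping_eqI)
      fix k
      have "sw i k \<in> T \<longleftrightarrow> k \<in> sw i ` T" by (metis image_iff sw_sw)
      then show "lookup (swap_exp i (ind T)) k =
          lookup (ind (sw i ` T)) k"
        using fin by (simp add: lookup_map_key_sw lookup_ind)
    qed
    then show ?thesis by (simp add: swap_poly_single)
  qed
  have add: "swap_poly i (\<Sum>T\<in>X. F T) = (\<Sum>T\<in>X. swap_poly i (F T))" for X and F :: "nat set \<Rightarrow> 'a mpoly"
    by (induction X rule: infinite_finite_induct) (auto simp: swap_poly_add)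
  let ?X = "{T. T \<subseteq> {1..n} \<and> card T = r}"
  have mem: "sw i ` T \<in> ?X" if "T \<in> ?X" for T
    using that image_mono[of T "{1..n}" "sw i"] img card_image[OF inj[of T]] by auto
  have "swap_poly i (elem_sym r {1..n}) = (\<Sum>T\<in>?X. xp (ind (sw i ` T)) :: 'a mpoly)"
    unfolding elem_sym_ind[OF finite_atLeastAtMost] add by (rule sum.cong) (auto simp: s)
  also have "\<dots> = (\<Sum>T\<in>?X. xp (ind T))"
    by (rule sum.reindex_bij_witness[where i = "\<lambda>T. sw i ` T" and j = "\<lambda>T. sw i ` T"])
      (rule ii refl | erule mem)+
  finally show ?thesis by (simp only: elem_sym_ind[OF finite_atLeastAtMost])
qed

text \<open>Along the segment no support is lost: two nonzero exponents keep a positive minimum, and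
  a single nonzero one keeps a positive sum.\<close>

lemma exp_seg_high:
  assumes i: "i \<in> {1..<n}" and s: "exp_seg i m m'" and m: "m \<in> high_exps n h"
  shows "m' \<in> high_exps n h"
proof -
  let ?x = "lookup m i" and ?y = "lookup m (Suc i)"
  obtain a b where m': "m' = exp_upd m i a b" and ab: "a + b = ?x + ?y" "min ?x ?y \<le> a" "a \<le> max ?x ?y"
    using s by (auto simp: exp_seg_def)
  let ?R = "keys m - {i, Suc i}"
  have k: "keys m = ?R \<union> ((if ?x = 0 then {} else {i}) \<union> (if ?y = 0 then {} else {Suc i}))"
    by (auto simp: in_keys_iff)
  have k': "keys m' = ?R \<union> ((if a = 0 then {} else {i}) \<union> (if b = 0 then {} else {Suc i}))"
    by (auto simp: in_keys_iff m' lookup_exp_upd split: if_splits)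
  have c: "card (?R \<union> V) = card ?R + card V" if "V \<subseteq> {i, Suc i}" for V
    by (rule card_Un_disjoint) (use that finite_subset in auto)
  have "card ((if ?x = 0 then {} else {i}) \<union> (if ?y = 0 then {} else {Suc i})) \<le>
      card ((if a = 0 then {} else {i}) \<union> (if b = 0 then {} else {Suc i}))"
    using ab by (auto simp: min_def max_def split: if_splits)
  then have "card (keys m) \<le> card (keys m')"
    by (subst k, subst k', subst c, simp, subst c, simp, simp)
  then show ?thesis using exp_seg_keys[OF i s] m by (auto simp: high_exps_def)
qed

lemma T_poly_ideal:
  assumes h: "1 \<le> h" "h \<le> n" and i: "i \<in> {1..<n}"
    and f: "f \<in> mpoly.span (ideal_basis n h :: 'a::field mpoly set)"
  shows "T_poly i f \<in> mpoly.span (ideal_basis n h)"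
  using f
proof (induction rule: mpoly.span_induct_alt)
  case base then show ?case by (simp add: mpoly.span_zero)
next
  case (step c b y)
  from step(1) consider
    w N where "w \<in> hook_perms n h" "set_mset N \<subseteq> {1..<h}" "N \<noteq> {#}" "b = basis_vec n w N"
    | m where "m \<in> high_exps n h" "b = xp m"
    unfolding ideal_basis_def by blast
  then have "T_poly i b \<in> mpoly.span (ideal_basis n h)"
  proof cases
    case 1
    then obtain j M where N: "N = add_mset j M" by (meson multiset_cases)
    have j: "j \<in> {1..<h}" "set_mset M \<subseteq> {1..<h}" using 1(2) N by auto
    have "T_poly i b = T_poly i (basis_vec n w M) * elem_sym j {1..n}"
      by (simp add: 1(4) N basis_vec_add T_poly_mult_symmetric swap_poly_elem_sym[OF i])
    then show ?thesis
      using mult_elem_sym_in_span[OF h _ _ polys_T_poly[OF i basis_vec_in_polys[OF 1(1) j(2) h(2)]], of j] j(1)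
      by simp
  next
    case 2
    show ?thesis
      by (rule high_in_span) (use 2 exp_seg_high[OF i] keys_T_poly_xp in blast)
  qed
  then show ?case
    by (simp add: T_poly_add T_poly_const_mult mpoly.span_add mpoly.span_scale step(2))
qed

section \<open>The isomorphism\<close>

lemma hook_perms_desc_class: "w \<in> hook_perms n h \<longleftrightarrow> w \<in> desc_class n (desc n w) \<and> desc n w \<subseteq> {1..<h}"
  by (auto simp: hook_perms_def desc_class_def)

text \<open>The word of w may start with i, so the quadratic relation applies. This and the next two
  lemmas mirror the three rules for \<open>hcoset\<close>.\<close>

lemma T_poly_hecke_vec_down:
  assumes w: "w permutes {1..n}" and i: "i \<in> {1..<n}" and d: "inv w (Suc i) < inv w i"
  shows "T_poly i (hecke_vec n w) = - (hecke_vec n w :: 'a::field mpoly)"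
proof -
  have v: "sw i \<circ> w permutes {1..n}" by (rule sw_comp_permutes[OF i w])
  have "foldr T_poly (reduced_word n (sw i \<circ> (sw i \<circ> w))) x =
      T_poly i (foldr T_poly (reduced_word n (sw i \<circ> w)) x)" for x :: "'a mpoly"
    by (rule foldr_reduced_word_left[OF braid_ops_T_poly v i])
      (use d in \<open>simp add: inv_sw_comp_apply[OF w]\<close>)
  then show ?thesis by (simp add: hecke_vec_def T_poly_T_poly)
qed

lemma T_poly_hecke_vec_up:
  assumes w: "w permutes {1..n}" and i: "i \<in> {1..<n}" and u: "inv w i < inv w (Suc i)"
    and a: "inv w (Suc i) \<noteq> Suc (inv w i)"
  shows "T_poly i (hecke_vec n w) = (hecke_vec n (sw i \<circ> w) :: 'a::field mpoly)"
proof -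
  have "desc n (sw i \<circ> w) = desc n w" by (rule desc_sw_nonadjacent[OF w i a]) (use u in simp)
  then show ?thesis
    using foldr_reduced_word_left[OF braid_ops_T_poly w i u, of "xp (rexp n (wt (desc n w)) id) :: 'a mpoly"]
    by (simp only: hecke_vec_def)
qed

text \<open>Here \<open>sw i \<circ> w\<close> equals \<open>w \<circ> sw p\<close> for a position p
  that is not a descent. So the new letter may act first, and it kills \<open>x_D\<close>, whose
  exponents at p and p+1 agree.\<close>

lemma T_poly_hecke_vec_adjacent:
  assumes w: "w permutes {1..n}" and i: "i \<in> {1..<n}" and a: "inv w (Suc i) = Suc (inv w i)"
  shows "T_poly i (hecke_vec n w) = (0 :: 'a::field mpoly)"
proof -
  define p where "p = inv w i"
  define x where "x = (xp (rexp n (wt (desc n w)) id) :: 'a mpoly)"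
  note adj = desc_sw_adjacent[OF w i a, folded p_def]
  have "p \<notin> desc n w" using adj(3) by (simp add: desc_def)
  then have "wt (desc n w) (sw p k) = wt (desc n w) k" for k by (rule wt_sw[OF finite_desc])
  moreover have "sw p k \<in> {1..n} \<longleftrightarrow> k \<in> {1..n}" for k
    by (rule permutes_in_image[OF sw_permutes[OF adj(2)]])
  ultimately have "swap_exp p (rexp n (wt (desc n w)) id) = rexp n (wt (desc n w)) id"
    by (intro poly_mapping_eqI) (simp only: lookup_map_key_sw lookup_rexp inv_id id_apply)
  then have "swap_poly p x = x" by (simp only: x_def swap_poly_single)
  then have 0: "T_poly p x = 0" by (intro T_poly_eqI) simp
  have "T_poly i (hecke_vec n w) = foldr T_poly (reduced_word n (sw i \<circ> w)) x"
    using foldr_reduced_word_left[OF braid_ops_T_poly w i, of x] a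
    by (simp add: hecke_vec_def x_def)
  also have "\<dots> = foldr T_poly (reduced_word n w) (T_poly p x)"
    unfolding adj(1) by (rule foldr_reduced_word_right[OF braid_ops_T_poly w adj(2,3)])
  also have "\<dots> = 0"
  proof -
    have "foldr T_poly ws (0 :: 'a mpoly) = 0" for ws by (induction ws) auto
    then show ?thesis by (simp only: 0)
  qed
  finally show ?thesis .
qed

section \<open>Coordinates modulo the ideal\<close>

lemma hecke_vec_in_polys: "w \<in> hook_perms n h \<Longrightarrow> h \<le> n \<Longrightarrow> hecke_vec n w \<in> polys n"
  using basis_vec_in_polys[of w n h "{#}"] by simp

lemma hecke_vec_lead:
  assumes "w \<in> hook_perms n h" "h \<le> n"
  shows "has_lead n (hecke_vec n w) (lead_exp n w {#})"
  using basis_vec_lead[OF assms(1) _ assms(2), of "{#}"] by (simp del: mwt_empty)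

text \<open>Independence was shown for a set of polynomials. To speak of coordinates indexed by
  permutations, the indexing has to be injective and its image disjoint from
  \<open>ideal_basis\<close>; this lemma and the next supply that.\<close>

lemma hecke_vec_inject:
  assumes h: "h \<le> n" and w: "w \<in> hook_perms n h" and v: "v \<in> hook_perms n h"
    and eq: "hecke_vec n w = (hecke_vec n v :: 'a::field mpoly)"
  shows "w = v"
proof -
  have "lead_exp n w {#} = lead_exp n v {#}"
    using has_lead_unique[OF hecke_vec_lead[OF w h, where 'a = 'a]] hecke_vec_lead[OF v h, where 'a = 'a]
    unfolding eq by blast
  then show ?thesis
    using basis_vec_inject[OF w _ v _ h, of "{#}" "{#}"] by simp
qed

lemma hecke_vec_notin_ideal_basis:
  assumes h: "1 \<le> h" "h \<le> n" and w: "w \<in> hook_perms n h"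
  shows "hecke_vec n w \<notin> (ideal_basis n h :: 'a::field mpoly set)"
proof
  assume "hecke_vec n w \<in> (ideal_basis n h :: 'a mpoly set)"
  then consider v N where "v \<in> hook_perms n h" "set_mset N \<subseteq> {1..<h}" "N \<noteq> {#}"
      "hecke_vec n w = (basis_vec n v N :: 'a mpoly)"
    | m where "m \<in> high_exps n h" "hecke_vec n w = (xp m :: 'a mpoly)"
    unfolding ideal_basis_def by blast
  moreover have l: "has_lead n (hecke_vec n w :: 'a mpoly) (lead_exp n w {#})"
    by (rule hecke_vec_lead[OF w h(2)])
  ultimately show False
  proof cases
    case 1
    then have "lead_exp n w {#} = lead_exp n v N"
      using has_lead_unique[OF l] basis_vec_lead[OF 1(1,2) h(2), where 'a = 'a] by simp
    then show False using basis_vec_inject[OF w _ 1(1,2) h(2), of "{#}"] 1(3) by simp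
  next
    case 2
    then have "lead_exp n w {#} = m"
      using has_lead_unique[OF l] has_lead_xp[of m n, where 'a = 'a] by (simp add: high_exps_def)
    then show False using rexp_mwt_not_high[OF w _ h(1), of "{#}"] 2(1) by simp
  qed
qed

lemma ex_hecke_coords:
  assumes h: "1 \<le> h" "h \<le> n" and f: "f \<in> polys n"
  shows "\<exists>c. f - (\<Sum>w\<in>hook_perms n h. const (c w) * hecke_vec n w) \<in>
    mpoly.span (ideal_basis n h :: 'a::field mpoly set)"
  using polys_subset_span[OF h f]
proof (induction rule: mpoly.span_induct_alt)
  case base
  show ?case by (rule exI[of _ "\<lambda>_. 0"]) (simp add: mpoly.span_zero)
next
  case (step a b y)
  let ?L = "\<lambda>c. \<Sum>w\<in>hook_perms n h. const (c w) * (hecke_vec n w :: 'a mpoly)"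
  obtain c where c: "y - ?L c \<in> mpoly.span (ideal_basis n h)" using step(2) by blast
  from step(1) show ?case
  proof
    assume "b \<in> hecke_vec n ` hook_perms n h"
    then obtain v where v: "v \<in> hook_perms n h" "b = hecke_vec n v" by blast
    have "?L (\<lambda>w. c w + (if w = v then a else 0)) =
        ?L c + (\<Sum>w\<in>hook_perms n h. if w = v then const a * hecke_vec n w else 0)"
      unfolding sum.distrib[symmetric]
      by (rule sum.cong) (auto simp: mpoly.scale_left_distrib)
    also have "\<dots> = ?L c + const a * b" using v finite_hook_perms by simp
    finally have eq: "const a * b + y - ?L (\<lambda>w. c w + (if w = v then a else 0)) = y - ?L c"
      by simp
    show ?thesis by (rule exI[of _ "\<lambda>w. c w + (if w = v then a else 0)"], subst eq, rule c)
  next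
    assume "b \<in> ideal_basis n h"
    then have "const a * b + (y - ?L c) \<in> mpoly.span (ideal_basis n h)"
      by (intro mpoly.span_add[OF mpoly.span_scale[OF mpoly.span_base] c])
    then show ?thesis by (intro exI[of _ c]) (simp add: add_diff_eq)
  qed
qed

text \<open>With a nonzero coefficient one could solve for \<open>hecke_vec n w\<close> and express
  it through the other basis elements.\<close>

lemma hecke_coords_zero:
  assumes h: "1 \<le> h" "h \<le> n" and w: "w \<in> hook_perms n h"
    and c: "(\<Sum>v\<in>hook_perms n h. const (c v) * hecke_vec n v) \<in>
      mpoly.span (ideal_basis n h :: 'a::field mpoly set)"
  shows "c w = 0"
proof (rule ccontr)
  assume ne: "c w \<noteq> 0"
  let ?B = "hecke_vec n ` hook_perms n h \<union> ideal_basis n h :: 'a mpoly set"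
  let ?B' = "?B - {hecke_vec n w}"
  have fin: "finite (hook_perms n h)" by (rule finite_hook_perms)
  have "ideal_basis n h \<subseteq> ?B'" using hecke_vec_notin_ideal_basis[OF h w] by blast
  then have s: "(\<Sum>v\<in>hook_perms n h. const (c v) * hecke_vec n v) \<in> mpoly.span ?B'"
    using c mpoly.span_mono by blast
  have r: "(\<Sum>v\<in>hook_perms n h - {w}. const (c v) * hecke_vec n v) \<in> mpoly.span ?B'"
  proof (intro mpoly.span_sum mpoly.span_scale mpoly.span_base)
    fix v assume v: "v \<in> hook_perms n h - {w}"
    then have "hecke_vec n v \<noteq> (hecke_vec n w :: 'a mpoly)"
      using hecke_vec_inject[OF h(2) _ w] by blast
    then show "hecke_vec n v \<in> ?B'" using v by blast
  qed
  have "const (c w) * hecke_vec n w = (\<Sum>v\<in>hook_perms n h. const (c v) * hecke_vec n v)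
      - (\<Sum>v\<in>hook_perms n h - {w}. const (c v) * (hecke_vec n v :: 'a mpoly))"
    by (simp add: sum.remove[OF fin w])
  then have "const (c w) * hecke_vec n w \<in> mpoly.span ?B'" using mpoly.span_diff[OF s r] by simp
  then have "const (inverse (c w)) * (const (c w) * hecke_vec n w) \<in> mpoly.span ?B'"
    by (rule mpoly.span_scale)
  then have "hecke_vec n w \<in> mpoly.span ?B'" using ne by (simp add: mpoly.scale_scale)
  moreover have "hecke_vec n w \<in> ?B" using w by blast
  ultimately have "mpoly.dependent ?B" unfolding mpoly.dependent_def by blast
  then show False using independent_basis[OF h] by blast
qed

text \<open>The quotient is represented by its projection: a linear equivariant map from
  \<open>polys n\<close> onto the direct sum with kernel \<open>I_\<mu>\<close> amounts to an
  isomorphism from \<open>R_\<mu>\<close>.\<close>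

theorem theorem8p3:
  fixes n h :: nat
  assumes "1 \<le> h" and "h \<le> n"
  shows "\<exists>\<phi> :: ('a::field) mpoly \<Rightarrow> (nat set \<Rightarrow> 'a hecke).
      (\<forall>f \<in> polys n. \<phi> f \<in> dsum_proj n {1..<h})
    \<and> (\<forall>f \<in> polys n. \<forall>g \<in> polys n. \<phi> (f + g) = (\<lambda>D u. \<phi> f D u + \<phi> g D u))
    \<and> (\<forall>c. \<forall>f \<in> polys n. \<phi> (const c * f) = (\<lambda>D u. c * \<phi> f D u))
    \<and> (\<forall>F \<in> dsum_proj n {1..<h}. \<exists>f \<in> polys n. \<phi> f = F)
    \<and> (\<forall>f \<in> polys n. \<phi> f = (\<lambda>D u. 0) \<longleftrightarrow> f \<in> tanisaki n (hook n h))
    \<and> (\<forall>i \<in> {1..<n}. \<forall>f \<in> polys n. \<phi> (T_poly i f) = (\<lambda>D. T_hecke n i (\<phi> f D)))"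
proof -
  note h = assms
  let ?W = "hook_perms n h"
  let ?I = "mpoly.span (ideal_basis n h) :: 'a mpoly set"
  let ?hv = "hecke_vec n :: (nat \<Rightarrow> nat) \<Rightarrow> 'a mpoly"
  define L where "L c = (\<Sum>w\<in>?W. const (c w) * ?hv w)" for c
  \<comment> \<open>The chosen coefficients are determined only on \<open>?W\<close>, by
    \<open>co_eq\<close>. As \<open>\<Phi>\<close> uses no others, the map \<phi> is linear in spite
    of the choice.\<close>
  define co where "co f = (SOME c. f - L c \<in> ?I)" for f :: "'a mpoly"
  define \<Phi> where "\<Phi> c = (\<lambda>D u. if D \<subseteq> {1..<h} then coset_comb n D c u else 0)"
    for c :: "(nat \<Rightarrow> nat) \<Rightarrow> 'a"
  define \<phi> where "\<phi> f = \<Phi> (co f)" for f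
  have fin: "finite ?W" by (rule finite_hook_perms)
  have ideal: "tanisaki n (hook n h) = ?I"
    by (simp add: tanisaki_hook[OF h] gen_ideal_eq_span[OF h])
  have hvp: "?hv w \<in> polys n" if "w \<in> ?W" for w using hecke_vec_in_polys[OF that h(2)] .
  have L_diff: "L c - L c' = L (\<lambda>w. c w - c' w)" for c c'
    by (simp add: L_def mpoly.scale_left_diff_distrib sum_subtractf)
  have L_add: "L c + L c' = L (\<lambda>w. c w + c' w)" for c c'
    by (simp add: L_def mpoly.scale_left_distrib sum.distrib)
  have L_scale: "const a * L c = L (\<lambda>w. a * c w)" for a c
    by (simp add: L_def sum_distrib_left mpoly.scale_scale)
  have L_polys: "L c \<in> polys n" for c
    unfolding L_def by (intro polys_sum polys_mult polys_const hvp)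
  have co: "f - L (co f) \<in> ?I" if "f \<in> polys n" for f
    unfolding co_def using ex_hecke_coords[OF h that] unfolding L_def[symmetric] by (rule someI_ex)
  have co_eq: "co f w = c w" if f: "f \<in> polys n" and c: "f - L c \<in> ?I" and w: "w \<in> ?W" for f c w
  proof -
    have "L (\<lambda>w. co f w - c w) \<in> ?I"
      using mpoly.span_diff[OF c co[OF f]] by (simp add: L_diff[symmetric])
    then have "co f w - c w = 0" unfolding L_def by (rule hecke_coords_zero[OF h w])
    then show ?thesis by simp
  qed
  have DW: "desc_class n D \<subseteq> ?W" if "D \<subseteq> {1..<h}" for D
    using that by (auto simp: desc_class_def hook_perms_def)
  have \<Phi>_cong: "\<Phi> c = \<Phi> c'" if "\<And>w. w \<in> ?W \<Longrightarrow> c w = c' w" for c c'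
  proof (intro ext)
    fix D u show "\<Phi> c D u = \<Phi> c' D u"
    proof (cases "D \<subseteq> {1..<h}")
      case True
      have "coset_comb n D c u = coset_comb n D c' u"
        by (rule sum.cong[OF refl]) (use that DW[OF True] in \<open>simp add: subset_iff\<close>)
      then show ?thesis by (simp only: \<Phi>_def)
    qed (simp only: \<Phi>_def if_False)
  qed
  have \<phi>_eq: "\<phi> f = \<Phi> c" if "f \<in> polys n" "f - L c \<in> ?I" for f c
    unfolding \<phi>_def by (rule \<Phi>_cong) (rule co_eq[OF that])
  have \<Phi>_0: "\<Phi> (\<lambda>_. 0) = (\<lambda>D u. 0)" by (intro ext) (simp add: \<Phi>_def)
  have D_n: "D \<subseteq> {1..<n}" if "D \<subseteq> {1..<h}" for D using that h by auto

  have 1: "\<phi> f \<in> dsum_proj n {1..<h}" if "f \<in> polys n" for f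
  proof -
    have "\<phi> f D \<in> proj_mod n D" if D: "D \<subseteq> {1..<h}" for D
    proof -
      have "\<phi> f D = (\<lambda>u. coset_comb n D (co f) u)"
        using D by (simp add: \<phi>_def \<Phi>_def)
      then show ?thesis unfolding proj_mod_eq[OF D_n[OF D]] by (simp only: proj_spanI)
    qed
    moreover have "\<phi> f D = (\<lambda>_. 0)" if "\<not> D \<subseteq> {1..<h}" for D
      by (simp only: \<phi>_def \<Phi>_def that if_False)
    ultimately show ?thesis unfolding dsum_proj_def by blast
  qed
  have 2: "\<phi> (f + g) = (\<lambda>D u. \<phi> f D u + \<phi> g D u)" if f: "f \<in> polys n" and g: "g \<in> polys n" for f g
  proof -
    have "f + g - L (\<lambda>w. co f w + co g w) = (f - L (co f)) + (g - L (co g))"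
      by (simp add: L_add[symmetric])
    then have "f + g - L (\<lambda>w. co f w + co g w) \<in> ?I"
      using mpoly.span_add[OF co[OF f] co[OF g]] by (simp only:)
    then have "\<phi> (f + g) = \<Phi> (\<lambda>w. co f w + co g w)" by (rule \<phi>_eq[OF polys_add[OF f g]])
    then show ?thesis by (auto simp: \<phi>_def \<Phi>_def distrib_right sum.distrib fun_eq_iff)
  qed
  have 3: "\<phi> (const c * f) = (\<lambda>D u. c * \<phi> f D u)" if f: "f \<in> polys n" for c f
  proof -
    have "const c * f - L (\<lambda>w. c * co f w) = const c * (f - L (co f))"
      by (simp add: L_scale[symmetric] right_diff_distrib)
    then have "const c * f - L (\<lambda>w. c * co f w) \<in> ?I"
      using mpoly.span_scale[OF co[OF f], of c] by (simp only:)
    then have "\<phi> (const c * f) = \<Phi> (\<lambda>w. c * co f w)" by (rule \<phi>_eq[OF polys_mult[OF polys_const f]])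
    then show ?thesis by (auto simp: \<phi>_def \<Phi>_def sum_distrib_left mult.assoc fun_eq_iff)
  qed
  have 4: "\<exists>f \<in> polys n. \<phi> f = F" if F: "F \<in> dsum_proj n {1..<h}" for F
  proof -
    have "\<exists>a. F D = (\<lambda>u. coset_comb n D a u)" if D: "D \<subseteq> {1..<h}" for D
    proof -
      have "F D \<in> proj_mod n D" using F D unfolding dsum_proj_def by blast
      then show ?thesis unfolding proj_mod_eq[OF D_n[OF D]] proj_span_def by blast
    qed
    then obtain a where a: "\<And>D. D \<subseteq> {1..<h} \<Longrightarrow>
        F D = (\<lambda>u. \<Sum>w\<in>desc_class n D. a D w * hcoset n D w u)" by metis
    \<comment> \<open>Each permutation lies in exactly one descent class, so the coefficients chosen
      separately for every D glue to one function.\<close>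
    let ?c = "\<lambda>w. a (desc n w) w"
    have "\<phi> (L ?c) = \<Phi> ?c" by (rule \<phi>_eq[OF L_polys]) (simp add: mpoly.span_zero)
    also have "\<dots> = F"
    proof (intro ext)
      fix D u
      show "\<Phi> ?c D u = F D u"
      proof (cases "D \<subseteq> {1..<h}")
        case True
        have "coset_comb n D ?c u =
            (\<Sum>w\<in>desc_class n D. a D w * hcoset n D w u)"
          by (rule sum.cong) (auto simp: desc_class_def)
        then show ?thesis using True a[OF True] by (simp add: \<Phi>_def)
      next
        case False
        then have "F D = (\<lambda>_. 0)" using F unfolding dsum_proj_def by blast
        then show ?thesis unfolding \<Phi>_def by (simp only: False if_False)
      qed
    qed
    finally show ?thesis using L_polys by blast
  qed
  \<comment> \<open>Evaluating the component for \<open>desc n v\<close> at v itself returns the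
    coefficient at v, so a polynomial with zero image has all coordinates zero.\<close>
  have \<Phi>_eval: "\<Phi> c (desc n v) v = c v" if v: "v \<in> ?W" for c v
  proof -
    have vD: "v \<in> desc_class n (desc n v)" "desc n v \<subseteq> {1..<h}"
      using v hook_perms_desc_class by blast+
    have "(\<Sum>w\<in>desc_class n (desc n v). c w * hcoset n (desc n v) w v) =
        (\<Sum>w\<in>desc_class n (desc n v). if v = w then c w else 0)"
      by (rule sum.cong[OF refl]) (simp add: hcoset_eval[OF _ vD(1)])
    then show ?thesis using vD by (simp add: \<Phi>_def)
  qed
  have 5: "\<phi> f = (\<lambda>D u. 0) \<longleftrightarrow> f \<in> tanisaki n (hook n h)" if f: "f \<in> polys n" for f
  proof
    assume z: "\<phi> f = (\<lambda>D u. 0)"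
    have "co f w = 0" if "w \<in> ?W" for w using \<Phi>_eval[OF that, of "co f"] z by (simp add: \<phi>_def)
    then have "L (co f) = 0" unfolding L_def by (intro sum.neutral) simp
    then show "f \<in> tanisaki n (hook n h)" using co[OF f] by (simp add: ideal)
  next
    assume "f \<in> tanisaki n (hook n h)"
    then have "f - L (\<lambda>_. 0) \<in> ?I" by (simp add: ideal L_def)
    then show "\<phi> f = (\<lambda>D u. 0)" using \<phi>_eq[OF f] \<Phi>_0 by simp
  qed
  have \<phi>_hv: "\<phi> (?hv w) = (\<lambda>D u. if D = desc n w then hcoset n D w u else 0)"
    if w: "w \<in> ?W" for w
  proof -
    let ?c = "\<lambda>v. if v = w then 1 else 0 :: 'a"
    have wD: "w \<in> desc_class n (desc n w)" "desc n w \<subseteq> {1..<h}"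
      using w hook_perms_desc_class by blast+
    have "L ?c = (\<Sum>v\<in>?W. if v = w then ?hv v else 0)"
      unfolding L_def by (rule sum.cong) auto
    also have "\<dots> = ?hv w" using w fin by simp
    finally have "\<phi> (?hv w) = \<Phi> ?c" by (intro \<phi>_eq[OF hvp[OF w]]) (simp add: mpoly.span_zero)
    also have "\<dots> = (\<lambda>D u. if D = desc n w then hcoset n D w u else 0)"
    proof (intro ext)
      fix D u
      have "(\<Sum>v\<in>desc_class n D. ?c v * hcoset n D v u) =
          (\<Sum>v\<in>desc_class n D. if v = w then hcoset n D v u else 0)"
        by (rule sum.cong) auto
      also have "\<dots> = (if D = desc n w then hcoset n D w u else 0)"
      proof -
        have "w \<in> desc_class n D \<longleftrightarrow> D = desc n w" using wD(1) by (auto simp: desc_class_def)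
        then show ?thesis by simp
      qed
      finally show "\<Phi> ?c D u = (if D = desc n w then hcoset n D w u else 0)"
        using wD(2) by (auto simp: \<Phi>_def)
    qed
    finally show ?thesis .
  qed
  have \<phi>_0: "\<phi> 0 = (\<lambda>D u. 0)" using 5[OF polys_0] by (simp add: ideal mpoly.span_zero)
  have \<phi>_uminus: "\<phi> (- f) = (\<lambda>D u. - \<phi> f D u)" if "f \<in> polys n" for f
    using 3[OF that, of "- 1"] by simp
  have \<phi>_T_hv: "\<phi> (T_poly i (?hv w)) = (\<lambda>D. T_hecke n i (\<phi> (?hv w) D))"
    if i: "i \<in> {1..<n}" and w: "w \<in> ?W" for i w
  proof -
    let ?D = "desc n w"
    have wD: "w \<in> desc_class n ?D" "?D \<subseteq> {1..<h}"
      using w hook_perms_desc_class by blast+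
    have p: "w permutes {1..n}" by (rule desc_classD(1)[OF wD(1)])
    have T0: "T_hecke n i (\<lambda>u. 0 :: 'a) = (\<lambda>u. 0)" by (auto simp: T_hecke_def)
    have rhs: "T_hecke n i (\<phi> (?hv w) D) =
        (if D = ?D then T_hecke n i (hcoset n ?D w) else (\<lambda>u. 0))" for D
      by (cases "D = ?D") (simp_all add: \<phi>_hv[OF w] T0)
    have "inv w i \<noteq> inv w (Suc i)" by (rule inv_permutes_neq[OF p]) simp
    then consider "inv w (Suc i) < inv w i" | "inv w (Suc i) = Suc (inv w i)"
      | "inv w i < inv w (Suc i)" "inv w (Suc i) \<noteq> Suc (inv w i)" by linarith
    then show ?thesis
    proof cases
      case 1
      then show ?thesis
        unfolding rhs T_poly_hecke_vec_down[OF p i 1] \<phi>_uminus[OF hvp[OF w]]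
        by (intro ext) (simp add: \<phi>_hv[OF w]
          T_hcoset_down[OF p i finite_desc desc_class_down[OF wD(1) i 1]])
    next
      case 2
      then show ?thesis
        unfolding rhs T_poly_hecke_vec_adjacent[OF p i 2] \<phi>_0
        by (intro ext) (simp add:
          T_hcoset_eq[OF p i finite_desc conjunct2[OF desc_class_adjacent[OF wD(1) i 2]]])
    next
      case 3
      note up = desc_class_up[OF wD(1) i 3]
      have v: "sw i \<circ> w \<in> ?W" "desc n (sw i \<circ> w) = ?D"
        using up wD(2) by (auto simp: desc_class_def hook_perms_def)
      show ?thesis
        unfolding rhs T_poly_hecke_vec_up[OF p i 3] \<phi>_hv[OF v(1)] v(2)
        by (intro ext) (simp add: T_hcoset_up[OF p i finite_desc conjunct2[OF up]])
    qed
  qed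
  have \<phi>_sum: "\<phi> (\<Sum>w\<in>V. const (c w) * G w) = (\<lambda>D u. \<Sum>w\<in>V. c w * \<phi> (G w) D u)"
    if "finite V" "\<And>w. w \<in> V \<Longrightarrow> G w \<in> polys n" for V c and G :: "(nat \<Rightarrow> nat) \<Rightarrow> 'a mpoly"
    using that
  proof (induction V rule: finite_induct)
    case (insert w V)
    have "\<phi> (const (c w) * G w + (\<Sum>w\<in>V. const (c w) * G w)) =
        (\<lambda>D u. \<phi> (const (c w) * G w) D u + \<phi> (\<Sum>w\<in>V. const (c w) * G w) D u)"
      by (intro 2 polys_mult polys_const polys_sum) (use insert.prems in auto)
    then show ?case using insert 3[of "G w" "c w"] by simp
  qed (simp add: \<phi>_0)
  have 6: "\<phi> (T_poly i f) = (\<lambda>D. T_hecke n i (\<phi> f D))" if i: "i \<in> {1..<n}" and f: "f \<in> polys n" for i f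
  proof -
    \<comment> \<open>A representative of \<open>T_poly i f\<close> modulo the ideal, since
      \<open>T_poly\<close> preserves the ideal. It reduces equivariance to the vectors
      \<open>hecke_vec n w\<close>, where \<open>\<phi>_T_hv\<close> settles it.\<close>
    let ?g = "\<Sum>w\<in>?W. const (co f w) * T_poly i (?hv w)"
    have Tp: "T_poly i (?hv w) \<in> polys n" if "w \<in> ?W" for w by (rule polys_T_poly[OF i hvp[OF that]])
    have gp: "?g \<in> polys n" by (intro polys_sum polys_mult polys_const Tp)
    have "T_poly i (f - L (co f)) \<in> ?I" by (rule T_poly_ideal[OF h i co[OF f]])
    then have I: "T_poly i f - ?g \<in> ?I"
      by (simp add: T_poly_minus L_def T_poly_sum T_poly_const_mult)
    have "\<phi> (T_poly i f) = \<phi> ?g"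
    proof -
      have "T_poly i f - L (co ?g) = (T_poly i f - ?g) + (?g - L (co ?g))" by simp
      then have "T_poly i f - L (co ?g) \<in> ?I" using mpoly.span_add[OF I co[OF gp]] by (simp only:)
      then show ?thesis using \<phi>_eq[OF polys_T_poly[OF i f]] by (simp add: \<phi>_def)
    qed
    also have "\<dots> = (\<lambda>D u. \<Sum>w\<in>?W. co f w * T_hecke n i (\<phi> (?hv w) D) u)"
      by (subst \<phi>_sum[OF fin Tp]) (simp_all add: \<phi>_T_hv[OF i])
    also have "\<dots> = (\<lambda>D. T_hecke n i (\<lambda>u. \<Sum>w\<in>?W. co f w * \<phi> (?hv w) D u))"
      by (simp add: T_hecke_sum)
    also have "(\<lambda>D u. \<Sum>w\<in>?W. co f w * \<phi> (?hv w) D u) = \<phi> (L (co f))"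
      unfolding L_def by (rule \<phi>_sum[OF fin hvp, symmetric])
    then have "(\<lambda>D. T_hecke n i (\<lambda>u. \<Sum>w\<in>?W. co f w * \<phi> (?hv w) D u)) =
        (\<lambda>D. T_hecke n i (\<phi> (L (co f)) D))" by (simp add: fun_eq_iff)
    also have "\<phi> (L (co f)) = \<phi> f"
      by (subst \<phi>_eq[OF L_polys]) (simp_all add: \<phi>_def mpoly.span_zero)
    finally show ?thesis .
  qed
  show ?thesis
    by (rule exI[of _ \<phi>]) (use 1 2 3 4 5 6 in blast)
qed

end
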